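(* Let $\lambda_0,\lambda_1>0$ and $\gamma_0>0>\gamma_1$, let $\Gamma$ be the associated telegraph process, and let $m_t=\min_{u\in[0,t]}\Gamma(u)$. For $n\ge1$, $t>0$ and $x>0$, let $g^+(t,x;n)$ be the density in $x$ of the measure $\mathrm P_0\{\Gamma(t)\in \mathrm dx,\ m_t=0,\ N(t)=n\}$. Then for all $n\ge0$ and $x>0$, $$g^+(t,x;2n+1)=\frac{\lambda_0}{\xi_0(t,x)}\cdot\frac{z(t,x)^n}{n!^2}\,\theta(t,x)\cdot\frac1{\gamma_0}\Big(x-\frac{\gamma_1}{n+1}\xi_1(t,x)\Big)\mathbf 1_{\{0<x<\gamma_0t\}},$$ $$g^+(t,x;2n+2)=\lambda_0\lambda_1\,\frac{z(t,x)^n}{n!(n+1)!}\,\theta(t,x)\cdot\frac{x}{\gamma_0}\,\mathbf 1_{\{0<x<\gamma_0t\}}.$$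
   Context: $\varepsilon=\varepsilon(t)\in\{0,1\}$, $t\ge0$, is a two-state continuous-time Markov process which leaves state $i$ at rate $\lambda_i$ and switches to state $1-i$. $\mathrm P_i\{\cdot\}=\mathrm P\{\cdot\mid\varepsilon(0)=i\}$. $N(t)$ is the number of switchings of $\varepsilon$ up to time $t$, $N(0)=0$. The telegraph process is $\Gamma(t)=\int_0^t\gamma_{\varepsilon(s)}\,\mathrm ds$. Notation: $$\xi_0(t,x)=\frac{x-\gamma_1t}{\gamma_0-\gamma_1},\qquad \xi_1(t,x)=t-\xi_0(t,x)=\frac{\gamma_0t-x}{\gamma_0-\gamma_1},$$ $$z(t,x)=\lambda_0\lambda_1\xi_0(t,x)\xi_1(t,x),\qquad \theta(t,x)=\frac{\exp(-\lambda_0\xi_0(t,x)-\lambda_1\xi_1(t,x))}{\gamma_0-\gamma_1}.$$ Densities are understood up to Lebesgue-null sets of $x$. *)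

theory Defs
  imports "HOL-Probability.Probability"
begin

text \<open>
  A homogeneous continuous-time Markov process with state space \<open>{0, 1}\<close> and cadlag paths
  (nat carries the discrete topology, so these are right-continuous step functions with finitely
  many jumps in bounded time intervals); \<open>p h i j\<close> is the probability of being in \<open>j\<close> a time \<open>h\<close>
  after being in \<open>i\<close>. The initial distribution is arbitrary. Only times \<open>t \<ge> 0\<close> are constrained.
\<close>
locale two_state_Markov = prob_space M
  for M :: "'a measure" and \<epsilon> :: "real \<Rightarrow> 'a \<Rightarrow> nat"
    and p :: "real \<Rightarrow> nat \<Rightarrow> nat \<Rightarrow> real" and lam :: "nat \<Rightarrow> real" +
  assumes state_measurable: "\<And>t. t \<ge> 0 \<Longrightarrow> \<epsilon> t \<in> measurable M (count_space {0, 1})"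
    and right_continuous:
      "\<And>\<omega> t. \<omega> \<in> space M \<Longrightarrow> t \<ge> 0 \<Longrightarrow> continuous (at_right t) (\<lambda>u. \<epsilon> u \<omega>)"
    and left_limits:
      "\<And>\<omega> t. \<omega> \<in> space M \<Longrightarrow> t > 0 \<Longrightarrow> \<exists>l. ((\<lambda>u. \<epsilon> u \<omega>) \<longlongrightarrow> l) (at_left t)"
    and Markov:
      "\<And>(n::nat) (\<tau> :: nat \<Rightarrow> real) (i :: nat \<Rightarrow> nat) h j.
         0 \<le> \<tau> 0 \<Longrightarrow> (\<And>k. k < n \<Longrightarrow> \<tau> k < \<tau> (Suc k)) \<Longrightarrow> h > 0 \<Longrightarrow> j \<in> {0, 1} \<Longrightarrow>
         \<P>(\<omega> in M. \<forall>k\<le>n. \<epsilon> (\<tau> k) \<omega> = i k) > 0 \<Longrightarrow>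
         \<P>(\<omega> in M. \<epsilon> (\<tau> n + h) \<omega> = j \<bar> \<forall>k\<le>n. \<epsilon> (\<tau> k) \<omega> = i k) = p h (i n) j"
    and rates: "\<And>i. i \<in> {0, 1} \<Longrightarrow> ((\<lambda>h. p h i (1 - i) / h) \<longlongrightarrow> lam i) (at_right 0)"

definition P_init :: "'a measure \<Rightarrow> (real \<Rightarrow> 'a \<Rightarrow> nat) \<Rightarrow> nat \<Rightarrow> 'a measure" where
  "P_init M \<epsilon> i = uniform_measure M {\<omega> \<in> space M. \<epsilon> 0 \<omega> = i}"

definition switchings :: "(real \<Rightarrow> 'a \<Rightarrow> nat) \<Rightarrow> real \<Rightarrow> 'a \<Rightarrow> nat" where
  "switchings \<epsilon> t \<omega> = card {s. 0 < s \<and> s \<le> t \<and> \<not> isCont (\<lambda>u. \<epsilon> u \<omega>) s}"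

definition telegraph :: "(nat \<Rightarrow> real) \<Rightarrow> (real \<Rightarrow> 'a \<Rightarrow> nat) \<Rightarrow> real \<Rightarrow> 'a \<Rightarrow> real" where
  "telegraph \<gamma> \<epsilon> t \<omega> = integral {0..t} (\<lambda>s. \<gamma> (\<epsilon> s \<omega>))"

text \<open>The infimum is attained, since the paths of the telegraph process are continuous.\<close>
definition running_min :: "(nat \<Rightarrow> real) \<Rightarrow> (real \<Rightarrow> 'a \<Rightarrow> nat) \<Rightarrow> real \<Rightarrow> 'a \<Rightarrow> real" where
  "running_min \<gamma> \<epsilon> t \<omega> = (INF u\<in>{0..t}. telegraph \<gamma> \<epsilon> u \<omega>)"

text \<open>
  \<open>g\<close> is a version of the density on \<open>{0<..}\<close>, with respect to Lebesgue measure, of the measure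
  \<open>P\<^sub>0{\<Gamma>(t) \<in> dx, m\<^sub>t = 0, N(t) = n}\<close>; such a \<open>g\<close> is unique up to null sets.
\<close>
definition gplus_density ::
    "'a measure \<Rightarrow> (real \<Rightarrow> 'a \<Rightarrow> nat) \<Rightarrow> (nat \<Rightarrow> real) \<Rightarrow> real \<Rightarrow> nat \<Rightarrow> (real \<Rightarrow> real) \<Rightarrow> bool" where
  "gplus_density M \<epsilon> \<gamma> t n g \<longleftrightarrow>
     g \<in> borel_measurable borel \<and> (\<forall>x>0. g x \<ge> 0) \<and>
     (\<forall>B \<in> sets borel. B \<subseteq> {0<..} \<longrightarrow>
        (let E = {\<omega> \<in> space M. telegraph \<gamma> \<epsilon> t \<omega> \<in> B \<and> running_min \<gamma> \<epsilon> t \<omega> = 0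
                                \<and> switchings \<epsilon> t \<omega> = n}
         in E \<in> sets M \<and>
            emeasure (P_init M \<epsilon> 0) E = (\<integral>\<^sup>+x\<in>B. ennreal (g x) \<partial>lborel)))"

definition xi0 :: "(nat \<Rightarrow> real) \<Rightarrow> real \<Rightarrow> real \<Rightarrow> real" where
  "xi0 \<gamma> t x = (x - \<gamma> 1 * t) / (\<gamma> 0 - \<gamma> 1)"

definition xi1 :: "(nat \<Rightarrow> real) \<Rightarrow> real \<Rightarrow> real \<Rightarrow> real" where
  "xi1 \<gamma> t x = t - xi0 \<gamma> t x"

definition zfun :: "(nat \<Rightarrow> real) \<Rightarrow> (nat \<Rightarrow> real) \<Rightarrow> real \<Rightarrow> real \<Rightarrow> real" where
  "zfun lam \<gamma> t x = lam 0 * lam 1 * xi0 \<gamma> t x * xi1 \<gamma> t x"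

definition theta :: "(nat \<Rightarrow> real) \<Rightarrow> (nat \<Rightarrow> real) \<Rightarrow> real \<Rightarrow> real \<Rightarrow> real" where
  "theta lam \<gamma> t x = exp (- lam 0 * xi0 \<gamma> t x - lam 1 * xi1 \<gamma> t x) / (\<gamma> 0 - \<gamma> 1)"

end

theory Submission
  imports Defs
begin

text \<open>
  Let \<open>T\<^sub>n\<close> be the \<open>n\<close>-th switching time and let \<open>(a, b)\<close> be the times spent in the states 0 and 1 up to
  \<open>T\<^sub>n\<close>, so that \<open>T\<^sub>n = a + b\<close> and the telegraph process is at \<open>\<gamma> 0 * a + \<gamma> 1 * b\<close>. The path is piecewise
  linear, so its minimum is 0 iff this level is nonnegative at every switching time and at time \<open>t\<close>.

  Given the past up to \<open>T\<^sub>n\<close>, the next duration is exponential. Hence the density of \<open>(a, b)\<close> at \<open>T\<^sub>n\<close> on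
  the event that the path has stayed nonnegative is a product of rates times
  \<open>exp (- lam 0 * a - lam 1 * b)\<close> times a volume \<open>h\<^sub>n(a, b)\<close>, where \<open>h\<^sub>n\<^sub>+\<^sub>1\<close> arises from \<open>h\<^sub>n\<close> by
  integrating over the last duration, restricted to \<open>\<kappa> * b \<le> a\<close> with \<open>\<kappa> = - \<gamma> 1 / \<gamma> 0\<close>. The volumes are
  the polynomials \<open>odd_volume\<close> and \<open>even_volume\<close>, and the recursion reduces to differentiating them. The
  constraint at time \<open>t\<close> is one more integration of the same kind over the unfinished last duration;
  substituting \<open>a = xi0 \<gamma> t x\<close>, \<open>b = xi1 \<gamma> t x\<close> gives the densities in \<open>x\<close>.
\<close>

section \<open>Switching paths\<close>

text \<open>The Markov hypothesis concerns deterministic times only, whereas the recursion restarts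
  at a switching time; the strong Markov property at \<open>T n\<close> has to be produced from path
  regularity and the rates. Holding times are exponential because remaining in state i at all points
  of a grid of m steps over a time h has conditional probability (1 - p (h/m) i (1-i))^m.

  The first monomial of each volume is the unconstrained volume, a product of two simplices. The
  second is the volume of the durations along which the level becomes negative, as in the ballot
  problem.

  Two obstacles shape the computation. After one switching \<open>(a, b)\<close> lies on the axis b
  = 0, so a planar density exists only from the second switching on, and the induction starts there.
  Moreover the last duration is cut off at t: multiplying the probability by the rate turns the
  exponential tail into the exponential density, so the cut-off duration obeys the same integral
  identities as a completed one.\<close>

locale binary_path =
  fixes e :: "real \<Rightarrow> nat"
  assumes binary: "\<And>u. u \<ge> 0 \<Longrightarrow> e u \<in> {0, 1}"
    and right_cont: "\<And>u. u \<ge> 0 \<Longrightarrow> continuous (at_right u) e"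
    and left_lim: "\<And>u. u > 0 \<Longrightarrow> \<exists>l. (e \<longlongrightarrow> l) (at_left u)"
begin

text \<open>Half-open intervals, so that the jump sets of adjacent intervals partition the jump set
  of their union.\<close>

definition jumps :: "real \<Rightarrow> real \<Rightarrow> real set" where
  "jumps a b = {r. a < r \<and> r \<le> b \<and> \<not> isCont e r}"

definition N :: "real \<Rightarrow> nat" where
  "N s = card (jumps 0 s)"

text \<open>The generalised inverse of the counting function. It is meaningful only on paths that
  switch \<open>n\<close> times, hence the hypotheses \<open>n \<le> N s\<close> below.\<close>

definition T :: "nat \<Rightarrow> real" where
  "T n = Inf {s. 0 \<le> s \<and> n \<le> N s}"

section \<open>Local structure of a binary path with one-sided limits\<close>

lemma right_constant:
  assumes "x \<ge> 0"
  obtains d where "d > 0" "\<And>u. x \<le> u \<Longrightarrow> u < x + d \<Longrightarrow> e u = e x"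
proof -
  have "(e \<longlongrightarrow> e x) (at_right x)"
    using right_cont[OF assms] by (simp add: continuous_within)
  then have "eventually (\<lambda>u. e u = e x) (at_right x)"
    by (simp add: tendsto_discrete)
  then obtain b where "b > x" "\<And>u. x < u \<Longrightarrow> u < b \<Longrightarrow> e u = e x"
    unfolding eventually_at_right_field by blast
  then show ?thesis
    by (intro that[of "b - x"]) (auto simp: order_le_less)
qed

lemma left_constant:
  assumes "x > 0"
  obtains d l where "0 < d" "d \<le> x" "\<And>u. x - d < u \<Longrightarrow> u < x \<Longrightarrow> e u = l"
proof -
  obtain l where "(e \<longlongrightarrow> l) (at_left x)"
    using left_lim[OF assms] by blast
  then have "eventually (\<lambda>u. e u = l) (at_left x)"
    by (simp add: tendsto_discrete)
  then obtain b where b: "b < x" "\<And>u. b < u \<Longrightarrow> u < x \<Longrightarrow> e u = l"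
    unfolding eventually_at_left_field by blast
  show ?thesis
    using b assms by (intro that[of "x - max b 0" l]) auto
qed

lemma isCont_if_constant:
  assumes "open S" "r \<in> S" "\<And>u. u \<in> S \<Longrightarrow> e u = c"
  shows "isCont e r"
proof -
  have "isCont e r \<longleftrightarrow> isCont (\<lambda>_. c) r"
    using assms by (intro isCont_cong) (auto simp: eventually_nhds)
  then show ?thesis by simp
qed

text \<open>On each side of \<open>x\<close> the path is constant near \<open>x\<close>, because
  limits in a discrete space are attained eventually; so only \<open>x\<close> itself can be a jump.
  As there are just two states, the end values differ exactly if \<open>x\<close> is one. Stated as
  a parity, this is additive under concatenation of intervals.\<close>

lemma local_structure:
  assumes "x \<ge> 0"
  obtains d where "d > 0"
    "\<And>a b. 0 \<le> a \<Longrightarrow> a \<le> x \<Longrightarrow> x \<le> b \<Longrightarrow> b - a < d \<Longrightarrow>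
       jumps a b \<subseteq> {x} \<and> even (e a + e b + card (jumps a b))"
proof -
  obtain d1 where d1: "d1 > 0" "\<And>u. x \<le> u \<Longrightarrow> u < x + d1 \<Longrightarrow> e u = e x"
    using right_constant[OF assms] by blast
  have "isCont e r" if "x < r" "r < x + d1" for r
    using that by (intro isCont_if_constant[of "{x<..<x+d1}" r "e x"] d1(2)) simp_all
  then have J1: "jumps x b = {}" if "b < x + d1" for b
    unfolding jumps_def using that by fastforce
  show ?thesis
  proof (cases "x = 0")
    case True
    show ?thesis
    proof (rule that[OF d1(1)])
      fix a b assume ab: "0 \<le> a" "a \<le> x" "x \<le> b" "b - a < d1"
      then have "a = x" "e b = e x" "jumps a b = {}" using True J1 d1(2)[of b] by auto
      then show "jumps a b \<subseteq> {x} \<and> even (e a + e b + card (jumps a b))" by simp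
    qed
  next
    case False
    then have "x > 0" using assms by simp
    then obtain d2 l where d2: "0 < d2" "d2 \<le> x" "\<And>u. x - d2 < u \<Longrightarrow> u < x \<Longrightarrow> e u = l"
      using left_constant by blast
    \<comment> \<open>Right continuity holds by assumption, so continuity at \<open>x\<close> is
      agreement with the left limit.\<close>
    have iff: "isCont e x \<longleftrightarrow> e x = l"
    proof
      assume "isCont e x"
      then have "(e \<longlongrightarrow> e x) (at_left x)"
        by (simp add: isCont_def filterlim_at_split)
      then have "eventually (\<lambda>u. e u = e x) (at_left x)"
        by (simp add: tendsto_discrete)
      moreover have "eventually (\<lambda>u. e u = l) (at_left x)"
        unfolding eventually_at_left_field using d2 by (intro exI[of _ "x - d2"]) auto
      ultimately have "eventually (\<lambda>u. e x = l) (at_left x)"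
        by eventually_elim simp
      then show "e x = l" by simp
    next
      assume "e x = l"
      then show "isCont e x"
      proof (intro isCont_if_constant[of "{x-d2<..<x+d1}" x l])
        show "e u = l" if "u \<in> {x-d2<..<x+d1}" for u
          using that d1(2)[of u] d2(3)[of u] \<open>e x = l\<close> by (cases "u < x") auto
      qed (use d1(1) d2(1) in auto)
    qed
    have bin: "e x \<in> {0,1}" "l \<in> {0,1}"
      using binary[of x] binary[of "x - d2/2"] d2(3)[of "x - d2/2"] d2(1,2) \<open>x > 0\<close> by auto
    show ?thesis
    proof (rule that[of "min d1 d2"])
      show "min d1 d2 > 0" using d1 d2 by simp
      fix a b assume ab: "0 \<le> a" "a \<le> x" "x \<le> b" "b - a < min d1 d2"
      have eb: "e b = e x" using ab d1(2)[of b] by auto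
      show "jumps a b \<subseteq> {x} \<and> even (e a + e b + card (jumps a b))"
      proof (cases "a = x")
        case True
        then show ?thesis using J1[of b] ab eb by auto
      next
        case False
        then have ea: "e a = l" using ab d2(3)[of a] by auto
        have nl: "isCont e r" if "a < r" "r < x" for r
          using that ab by (intro isCont_if_constant[of "{x-d2<..<x}" r l] d2(3)) simp_all
        have nr: "isCont e r" if "x < r" "r \<le> b" for r
          using that J1[of b] ab by (auto simp: jumps_def)
        have sub: "jumps a b = (if isCont e x then {} else {x})"
        proof -
          have "r \<in> jumps a b \<longleftrightarrow> r = x \<and> \<not> isCont e x" for r
            unfolding jumps_def using nl[of r] nr[of r] ab False
            by (cases r x rule: linorder_cases) auto
          then show ?thesis by auto
        qed
        show ?thesis
          using ea eb sub iff bin by auto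
      qed
    qed
  qed
qed

lemma jumps_split: "a \<le> b \<Longrightarrow> b \<le> c \<Longrightarrow> jumps a c = jumps a b \<union> jumps b c"
  and jumps_disjoint: "jumps a b \<inter> jumps b c = {}"
  by (auto simp: jumps_def)

text \<open>Both properties pass from adjacent intervals to their union, the value at the common end
  point being counted twice in the parity. By Bolzano's bisection principle the local statement then
  suffices.\<close>

lemma jumps_finite_parity:
  assumes "0 \<le> a" "a \<le> b"
  shows "finite (jumps a b)" and "even (e a + e b + card (jumps a b))"
proof -
  \<comment> \<open>The condition \<open>0 \<le> a\<close> belongs to the induction predicate: the
    small intervals around a point may begin at negative times, where the path is
    unconstrained.\<close>
  have "0 \<le> a \<longrightarrow> finite (jumps a b) \<and> even (e a + e b + card (jumps a b))"
    using \<open>a \<le> b\<close>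
  proof (induction rule: Bolzano)
    case (trans a b c)
    then have "card (jumps a c) = card (jumps a b) + card (jumps b c)" if "0 \<le> a"
      using that jumps_split[of a b c] jumps_disjoint[of a b c]
      by (simp add: card_Un_disjoint)
    then show ?case using trans jumps_split[of a b c] by auto
  next
    case (local x)
    show ?case
    proof (cases "x \<ge> 0")
      case True
      then obtain d where "d > 0" "\<And>a b. 0 \<le> a \<Longrightarrow> a \<le> x \<Longrightarrow> x \<le> b \<Longrightarrow> b - a < d \<Longrightarrow>
         jumps a b \<subseteq> {x} \<and> even (e a + e b + card (jumps a b))"
        using local_structure by metis
      then show ?thesis by (meson finite.emptyI finite_insert finite_subset)
    next
      case False
      then show ?thesis by (intro exI[of _ 1]) auto
    qed
  qed
  then show "finite (jumps a b)" "even (e a + e b + card (jumps a b))"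
    using assms by auto
qed

section \<open>Number of switchings and switching times\<close>

lemma N_0 [simp]: "N 0 = 0"
proof -
  have "jumps 0 0 = {}" by (auto simp: jumps_def)
  then show ?thesis by (simp add: N_def)
qed

lemma N_add: "0 \<le> a \<Longrightarrow> a \<le> b \<Longrightarrow> N b = N a + card (jumps a b)"
  unfolding N_def using jumps_split[of 0 a b] jumps_disjoint[of 0 a b]
    jumps_finite_parity(1)[of 0 a] jumps_finite_parity(1)[of a b]
  by (simp add: card_Un_disjoint)

lemma N_mono: "0 \<le> a \<Longrightarrow> a \<le> b \<Longrightarrow> N a \<le> N b"
  using N_add[of a b] by simp

lemma N_parity: "0 \<le> s \<Longrightarrow> even (e 0 + e s + N s)"
  using jumps_finite_parity(2)[of 0 s] by (simp add: N_def)

lemma N_right_constant: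
  assumes "x \<ge> 0"
  obtains d where "d > 0" "\<And>u. x \<le> u \<Longrightarrow> u < x + d \<Longrightarrow> N u = N x"
proof -
  obtain d where d: "d > 0" "\<And>a b. 0 \<le> a \<Longrightarrow> a \<le> x \<Longrightarrow> x \<le> b \<Longrightarrow> b - a < d \<Longrightarrow>
         jumps a b \<subseteq> {x} \<and> even (e a + e b + card (jumps a b))"
    using local_structure[OF assms] by metis
  show ?thesis
  proof (rule that[OF d(1)])
    fix u assume u: "x \<le> u" "u < x + d"
    then have "jumps x u \<subseteq> {x}" using d(2)[of x u] assms by simp
    moreover have "x \<notin> jumps x u" by (simp add: jumps_def)
    ultimately have "jumps x u = {}" by auto
    then show "N u = N x" using N_add[of x u] assms u by simp
  qed
qed

text \<open>At a single point the count grows by at most one. This prevents the switching times from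
  skipping a value of \<open>N\<close>.\<close>

lemma N_left_step:
  assumes "x > 0"
  obtains u where "0 \<le> u" "u < x" "N x \<le> Suc (N u)"
proof -
  obtain d where d: "d > 0" "\<And>a b. 0 \<le> a \<Longrightarrow> a \<le> x \<Longrightarrow> x \<le> b \<Longrightarrow> b - a < d \<Longrightarrow>
         jumps a b \<subseteq> {x} \<and> even (e a + e b + card (jumps a b))"
    using local_structure[of x] assms by (metis less_imp_le)
  define u where "u = max 0 (x - d/2)"
  have u: "0 \<le> u" "u < x" "x - u < d" using assms d(1) by (auto simp: u_def)
  then have "jumps u x \<subseteq> {x}" using d(2)[of u x] by auto
  then have "card (jumps u x) \<le> 1" using card_mono[of "{x}" "jumps u x"] by simp
  then show ?thesis using u N_add[of u x] by (intro that[of u]) auto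
qed

context
  fixes n s assumes reach: "0 \<le> s" "n \<le> N s"
begin

lemma T_nonneg: "0 \<le> T n"
  unfolding T_def using reach by (intro cInf_greatest) auto

lemma T_le: "T n \<le> s"
  unfolding T_def using reach by (intro cInf_lower bdd_belowI[of _ 0]) auto

text \<open>The infimum is attained since \<open>N\<close> is constant to the right of every point,
  and the count there does not exceed \<open>n\<close> since it grows in steps of size one.\<close>

lemma N_T: "N (T n) = n"
proof -
  let ?S = "{s. 0 \<le> s \<and> n \<le> N s}"
  have ne: "?S \<noteq> {}" and bd: "bdd_below ?S" using reach by (auto intro: bdd_belowI[of _ 0])
  have "n \<le> N (T n)"
  proof -
    obtain d where d: "d > 0" "\<And>u. T n \<le> u \<Longrightarrow> u < T n + d \<Longrightarrow> N u = N (T n)"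
      using N_right_constant[OF T_nonneg] by blast
    obtain u where "u \<in> ?S" "u < T n + d"
      using cInf_lessD[OF ne, of "T n + d"] d(1) unfolding T_def by auto
    moreover have "T n \<le> u" unfolding T_def using \<open>u \<in> ?S\<close> bd by (rule cInf_lower)
    ultimately show ?thesis using d(2)[of u] by simp
  qed
  moreover have "N (T n) \<le> n"
  proof (cases "T n = 0")
    case False
    then have "T n > 0" using T_nonneg by simp
    then obtain u where u: "0 \<le> u" "u < T n" "N (T n) \<le> Suc (N u)"
      using N_left_step by blast
    have "\<not> n \<le> N u"
      using u cInf_lower[OF _ bd, of u] unfolding T_def by auto
    then show ?thesis using u by simp
  qed simp
  ultimately show ?thesis by simp
qed

end

text \<open>The Galois connection between \<open>T\<close> and \<open>N\<close>, through which
  statements about switching times become statements about counts at fixed times.\<close>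

lemma T_le_iff:
  assumes "0 \<le> s" "n \<le> N s" "0 \<le> r"
  shows "T n \<le> r \<longleftrightarrow> n \<le> N r"
  using assms N_T[of s n] T_nonneg[of s n] N_mono[of "T n" r] T_le[of r n] by auto

lemma T_0 [simp]: "T 0 = 0"
  using T_nonneg[of 0 0] T_le[of 0 0] by simp

lemma T_mono: "0 \<le> s \<Longrightarrow> n \<le> N s \<Longrightarrow> k \<le> n \<Longrightarrow> T k \<le> T n"
  using T_le_iff[of s k "T n"] N_T[of s n] T_nonneg[of s n] by simp

lemma T_less_Suc: "0 \<le> s \<Longrightarrow> Suc n \<le> N s \<Longrightarrow> T n < T (Suc n)"
  using T_mono[of s "Suc n" n] N_T[of s "Suc n"] N_T[of s n] by (cases "T n = T (Suc n)") auto

lemma N_between: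
  assumes "0 \<le> s" "n \<le> N s" "T n \<le> u" "u \<le> s" "Suc n \<le> N s \<Longrightarrow> u < T (Suc n)"
  shows "N u = n"
proof -
  have "0 \<le> u" using T_nonneg[of s n] assms by simp
  then show ?thesis
    using assms T_le_iff[of s n u] T_le_iff[of s "Suc n" u] N_mono[of u s]
    by (cases "Suc n \<le> N s") auto
qed

end

locale binary_path_0 = binary_path +
  assumes start: "e 0 = 0"
begin

lemma state_eq: 
  assumes "0 \<le> s"
  shows "e s = N s mod 2"
proof -
  have "e s = 0 \<or> e s = 1" "even (e s + N s)"
    using N_parity[of s] binary[of s] start assms by auto
  then show ?thesis by presburger
qed

end

text \<open>A function of the switching times alone: on a path started in 0 the state between the
  \<open>n\<close>-th and the next switching is \<open>n mod 2\<close>.\<close>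

primrec occupation :: "nat \<Rightarrow> (nat \<Rightarrow> real) \<Rightarrow> nat \<Rightarrow> real" where
  "occupation i \<tau> 0 = 0"
| "occupation i \<tau> (Suc n) = occupation i \<tau> n + (if n mod 2 = i then \<tau> (Suc n) - \<tau> n else 0)"

definition switch_level :: "(nat \<Rightarrow> real) \<Rightarrow> (nat \<Rightarrow> real) \<Rightarrow> nat \<Rightarrow> real" where
  "switch_level \<gamma> \<tau> n = \<gamma> 0 * occupation 0 \<tau> n + \<gamma> 1 * occupation 1 \<tau> n"

definition stays_nonneg :: "(nat \<Rightarrow> real) \<Rightarrow> (nat \<Rightarrow> real) \<Rightarrow> nat \<Rightarrow> bool" where
  "stays_nonneg \<gamma> \<tau> n \<longleftrightarrow> (\<forall>k\<le>n. 0 \<le> switch_level \<gamma> \<tau> k)"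

lemma occupation_sum: "occupation 0 \<tau> n + occupation 1 \<tau> n = \<tau> n - \<tau> 0"
  by (induction n) auto

lemma switch_level_0 [simp]: "switch_level \<gamma> \<tau> 0 = 0"
  by (simp add: switch_level_def)

lemma switch_level_Suc: "switch_level \<gamma> \<tau> (Suc n) = switch_level \<gamma> \<tau> n + \<gamma> (n mod 2) * (\<tau> (Suc n) - \<tau> n)"
  using mod2_eq_if[of n] by (auto simp: switch_level_def algebra_simps)

lemma stays_nonneg_0 [simp]: "stays_nonneg \<gamma> \<tau> 0"
  by (simp add: stays_nonneg_def)

lemma stays_nonneg_Suc: "stays_nonneg \<gamma> \<tau> (Suc n) \<longleftrightarrow> stays_nonneg \<gamma> \<tau> n \<and> 0 \<le> switch_level \<gamma> \<tau> (Suc n)"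
  by (auto simp: stays_nonneg_def le_Suc_eq)

section \<open>The piecewise linear path and its minimum\<close>

context binary_path_0
begin

context
  fixes \<gamma> :: "nat \<Rightarrow> real"
begin

abbreviation \<Gamma> :: "real \<Rightarrow> real" where
  "\<Gamma> u \<equiv> integral {0..u} (\<lambda>s. \<gamma> (e s))"

lemma state_between:
  assumes "0 \<le> s" "n \<le> N s" "T n \<le> u" "u \<le> s" "Suc n \<le> N s \<Longrightarrow> u < T (Suc n)"
  shows "e u = n mod 2"
  using state_eq[of u] N_between[OF assms] T_nonneg[OF assms(1,2)] assms(3) by simp

text \<open>The right end may itself be a switching time: the state is known in the open interval,
  and end points do not affect the integral.\<close>

lemma has_integral_segment:
  assumes "0 \<le> s" "n \<le> N s" "T n \<le> u" "u \<le> s" "Suc n \<le> N s \<Longrightarrow> u \<le> T (Suc n)"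
  shows "((\<lambda>v. \<gamma> (e v)) has_integral (\<gamma> (n mod 2) * (u - T n))) {T n..u}"
proof -
  have c: "((\<lambda>v. \<gamma> (n mod 2)) has_integral (\<gamma> (n mod 2) * (u - T n))) (cbox (T n) u)"
    using has_integral_const_real[of "\<gamma> (n mod 2)" "T n" u] assms(3) by (simp add: mult.commute)
  have "e v = n mod 2" if "v \<in> box (T n) u" for v
    using that assms by (intro state_between[of s n v]) auto
  then show ?thesis
    using has_integral_spike_interior[OF c, of "\<lambda>v. \<gamma> (e v)"] by simp
qed

lemma has_integral_T:
  assumes "0 \<le> s" "n \<le> N s"
  shows "((\<lambda>v. \<gamma> (e v)) has_integral switch_level \<gamma> T n) {0..T n}"
  using assms(2)
proof (induction n)
  case 0
  then show ?case using has_integral_refl(2)[of "\<lambda>v. \<gamma> (e v)" 0] by simp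
next
  case (Suc n)
  then have "T n < T (Suc n)" "T (Suc n) \<le> s" using T_less_Suc[of s n] T_le[of s "Suc n"] assms(1) by auto
  then have "((\<lambda>v. \<gamma> (e v)) has_integral (\<gamma> (n mod 2) * (T (Suc n) - T n))) {T n..T (Suc n)}"
    using Suc.prems assms(1) by (intro has_integral_segment[of s]) auto
  then show ?case
    unfolding switch_level_Suc
    using Suc T_nonneg[of s n] assms(1) \<open>T n < T (Suc n)\<close>
    by (intro has_integral_combine[of 0 "T n"]) auto
qed

lemma \<Gamma>_segment:
  assumes "0 \<le> s" "n \<le> N s" "T n \<le> u" "u \<le> s" "Suc n \<le> N s \<Longrightarrow> u \<le> T (Suc n)"
  shows "\<Gamma> u = switch_level \<gamma> T n + \<gamma> (n mod 2) * (u - T n)"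
  using has_integral_combine[OF T_nonneg[OF assms(1,2)] assms(3) has_integral_T[OF assms(1,2)]
      has_integral_segment[OF assms]]
  by (rule integral_unique)

lemma \<Gamma>_T: "0 \<le> s \<Longrightarrow> n \<le> N s \<Longrightarrow> \<Gamma> (T n) = switch_level \<gamma> T n"
  using has_integral_T by (rule integral_unique)

lemma \<Gamma>_end: "0 \<le> t \<Longrightarrow> \<Gamma> t = switch_level \<gamma> T (N t) + \<gamma> (N t mod 2) * (t - T (N t))"
  using \<Gamma>_segment[of t "N t" t] T_le[of t "N t"] by simp

lemma affine_lower_bound:
  fixes p q :: real
  assumes "c \<le> p + q * x" "c \<le> p + q * z" "x \<le> y" "y \<le> z"
  shows "c \<le> p + q * y"
proof (cases "q \<ge> 0")
  case True
  then have "q * x \<le> q * y" using assms by (intro mult_left_mono) auto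
  then show ?thesis using assms by simp
next
  case False
  then have "q * z \<le> q * y" using assms by (intro mult_left_mono_neg) auto
  then show ?thesis using assms by simp
qed

lemma \<Gamma>_lower_bound:
  assumes "0 \<le> u" "u \<le> t" "\<And>k. k \<le> N t \<Longrightarrow> c \<le> switch_level \<gamma> T k" "c \<le> \<Gamma> t"
  shows "c \<le> \<Gamma> u"
proof -
  have Nu: "N u \<le> N t" using N_mono assms by simp
  \<comment> \<open>The right end of the linear piece containing \<open>u\<close>: the next
    switching time, or \<open>t\<close> on the last piece.\<close>
  define z where "z = (if N u = N t then t else T (Suc (N u)))"
  have t0: "0 \<le> t" using assms by simp
  have "u \<le> z"
    using T_le_iff[of t "Suc (N u)" u] Nu assms t0 by (auto simp: z_def)
  have zt: "z \<le> t"
    using T_le[of t "Suc (N u)"] Nu t0 by (auto simp: z_def)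
  have seg: "\<Gamma> v = switch_level \<gamma> T (N u) + \<gamma> (N u mod 2) * (v - T (N u))" if "T (N u) \<le> v" "v \<le> z" for v
    using that zt Nu t0 by (intro \<Gamma>_segment[of t]) (auto simp: z_def split: if_splits)
  have Tu: "T (N u) \<le> u" using T_le[of u "N u"] assms by simp
  have "c \<le> \<Gamma> (T (N u))" using \<Gamma>_T[of t "N u"] Nu t0 assms(3) by simp
  moreover have "c \<le> \<Gamma> z"
    using \<Gamma>_T[of t "Suc (N u)"] Nu t0 assms(3)[of "Suc (N u)"] assms(4) by (auto simp: z_def)
  ultimately show ?thesis
    using affine_lower_bound[of c "switch_level \<gamma> T (N u)" "\<gamma> (N u mod 2)" "T (N u) - T (N u)" "z - T (N u)" "u - T (N u)"]
      seg[of "T (N u)"] seg[of z] seg[of u] Tu \<open>u \<le> z\<close> by simp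
qed

lemma INF_\<Gamma>_eq_0_iff:
  assumes "0 \<le> t"
  shows "(INF u\<in>{0..t}. \<Gamma> u) = 0 \<longleftrightarrow> stays_nonneg \<gamma> T (N t) \<and> 0 \<le> \<Gamma> t"
proof -
  \<comment> \<open>A real-valued infimum is informative only for a set that is bounded below; the
    smallest corner value provides the bound.\<close>
  define c where "c = Min (insert (\<Gamma> t) (switch_level \<gamma> T ` {..N t}))"
  have "c \<le> \<Gamma> u" if "u \<in> {0..t}" for u
    using that unfolding c_def by (intro \<Gamma>_lower_bound[of u t] Min_le) auto
  then have bdd: "bdd_below (\<Gamma> ` {0..t})" by (intro bdd_belowI[of _ c]) auto
  have "\<Gamma> 0 = 0" by simp
  have "(INF u\<in>{0..t}. \<Gamma> u) \<le> 0"
    using cINF_lower[OF bdd, of 0] assms by simp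
  then have "(INF u\<in>{0..t}. \<Gamma> u) = 0 \<longleftrightarrow> 0 \<le> (INF u\<in>{0..t}. \<Gamma> u)" by auto
  also have "\<dots> \<longleftrightarrow> (\<forall>u\<in>{0..t}. 0 \<le> \<Gamma> u)"
    using assms by (intro le_cINF_iff bdd) simp
  also have "\<dots> \<longleftrightarrow> stays_nonneg \<gamma> T (N t) \<and> 0 \<le> \<Gamma> t"
  proof (intro iffI conjI ballI)
    assume *: "\<forall>u\<in>{0..t}. 0 \<le> \<Gamma> u"
    show "0 \<le> \<Gamma> t" using * assms by simp
    show "stays_nonneg \<gamma> T (N t)"
      unfolding stays_nonneg_def
    proof safe
      fix k assume "k \<le> N t"
      then show "0 \<le> switch_level \<gamma> T k"
        using * \<Gamma>_T[of t k] T_le[of t k] T_nonneg[of t k] assms by (metis atLeastAtMost_iff)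
    qed
  next
    fix u assume "stays_nonneg \<gamma> T (N t) \<and> 0 \<le> \<Gamma> t" "u \<in> {0..t}"
    then show "0 \<le> \<Gamma> u" by (intro \<Gamma>_lower_bound[of u t]) (auto simp: stays_nonneg_def)
  qed
  finally show ?thesis .
qed

end

end

context binary_path
begin

text \<open>Exchanging the two states makes the results on paths started in 0 available for paths
  started in 1.\<close>

lemma flipped_path:
  assumes "e 0 = 1"
  shows "binary_path_0 (\<lambda>u. 1 - e u)"
proof
  show "1 - e u \<in> {0, 1}" if "0 \<le> u" for u using binary[OF that] by auto
  show "continuous (at_right u) (\<lambda>u. 1 - e u)" if u: "0 \<le> u" for u
  proof -
    have "eventually (\<lambda>v. e v = e u) (at_right u)"
      using right_cont[OF u] by (simp add: continuous_within tendsto_discrete)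
    then have "eventually (\<lambda>v. 1 - e v = 1 - e u) (at_right u)"
      by eventually_elim simp
    then show ?thesis by (simp add: continuous_within tendsto_discrete)
  qed
  show "\<exists>l. ((\<lambda>u. 1 - e u) \<longlongrightarrow> l) (at_left u)" if u: "0 < u" for u
  proof -
    obtain l where "(e \<longlongrightarrow> l) (at_left u)" using left_lim[OF u] by blast
    then have "eventually (\<lambda>v. e v = l) (at_left u)" by (simp add: tendsto_discrete)
    then have "eventually (\<lambda>v. 1 - e v = 1 - l) (at_left u)" by eventually_elim simp
    then show ?thesis by (intro exI[of _ "1 - l"]) (simp add: tendsto_discrete)
  qed
  show "1 - e 0 = 0" using assms by simp
qed

text \<open>Such a path first moves downwards: its level is negative at the first switching, or at
  \<open>t\<close> if there is none before. The case matters because the initial law is arbitrary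
  and the event in the theorem is a set of paths with either start.\<close>

lemma INF_neq_0_if_start_1:
  fixes \<gamma> :: "nat \<Rightarrow> real"
  assumes "e 0 = 1" "\<gamma> 1 < 0" "0 < t"
  shows "(INF u\<in>{0..t}. integral {0..u} (\<lambda>s. \<gamma> (e s))) \<noteq> 0"
proof
  assume INF: "(INF u\<in>{0..t}. integral {0..u} (\<lambda>s. \<gamma> (e s))) = 0"
  interpret v: binary_path_0 "\<lambda>u. 1 - e u" using assms(1) by (rule flipped_path)
  define \<delta> where "\<delta> i = \<gamma> (1 - i)" for i :: nat
  have \<delta>: "\<delta> 0 < 0" using assms(2) by (simp add: \<delta>_def)
  have "\<gamma> (e s) = \<delta> (1 - e s)" if "0 \<le> s" for s
    using binary[OF that] by (auto simp: \<delta>_def)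
  then have "integral {0..u} (\<lambda>s. \<gamma> (e s)) = integral {0..u} (\<lambda>s. \<delta> (1 - e s))" for u
    by (intro integral_cong) auto
  then have "stays_nonneg \<delta> v.T (v.N t)" "0 \<le> integral {0..t} (\<lambda>s. \<delta> (1 - e s))"
    using v.INF_\<Gamma>_eq_0_iff[of t \<delta>] INF assms(3) by auto
  moreover have "\<not> stays_nonneg \<delta> v.T (v.N t)" if "Suc 0 \<le> v.N t"
  proof -
    have "v.T 0 < v.T 1" using v.T_less_Suc[of t 0] that assms(3) by simp
    then have "switch_level \<delta> v.T 1 < 0"
      using \<delta> switch_level_Suc[of \<delta> v.T 0] by (simp add: mult_neg_pos)
    then show ?thesis using that unfolding stays_nonneg_def by (auto simp: not_le)
  qed
  moreover have "integral {0..t} (\<lambda>s. \<delta> (1 - e s)) < 0" if "v.N t = 0"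
    using v.\<Gamma>_end[of t \<delta>] that assms(3) \<delta> by (simp add: mult_neg_pos del: One_nat_def)
  ultimately show False by (cases "v.N t") auto
qed

end

section \<open>The switching times of the Markov process\<close>

lemma measurable_count_space_level_set:
  assumes "X \<in> measurable M (count_space A)"
  shows "{\<omega> \<in> space M. X \<omega> = i} \<in> sets M"
proof (cases "i \<in> A")
  case True
  then have "X -` {i} \<inter> space M \<in> sets M"
    by (intro measurable_sets[OF assms]) simp
  moreover have "X -` {i} \<inter> space M = {\<omega> \<in> space M. X \<omega> = i}" by auto
  ultimately show ?thesis by simp
next
  case False
  then have "{\<omega> \<in> space M. X \<omega> = i} = {}"
    using measurable_space[OF assms] by auto
  then show ?thesis by (simp only: sets.empty_sets)
qed

text \<open>Dominated convergence for indicators. It serves both discretisations below: the grid for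
  holding times and the rounding of switching times.\<close>

lemma (in finite_measure) measure_tendsto_eventually:
  assumes X: "\<And>m. X m \<in> sets M" "Y \<in> sets M"
    and ev: "AE \<omega> in M. eventually (\<lambda>m. \<omega> \<in> X m \<longleftrightarrow> \<omega> \<in> Y) sequentially"
  shows "(\<lambda>m. measure M (X m)) \<longlonglongrightarrow> measure M Y"
proof -
  have "(\<lambda>m. \<integral>\<omega>. indicat_real (X m) \<omega> \<partial>M) \<longlonglongrightarrow> (\<integral>\<omega>. indicat_real Y \<omega> \<partial>M)"
  proof (rule integral_dominated_convergence[where w="\<lambda>_. 1"])
    show "AE \<omega> in M. (\<lambda>m. indicat_real (X m) \<omega>) \<longlonglongrightarrow> indicat_real Y \<omega>"
      using ev
    proof eventually_elim
      case (elim \<omega>)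
      then have "eventually (\<lambda>m. indicat_real (X m) \<omega> = indicat_real Y \<omega>) sequentially"
        by eventually_elim (simp add: indicator_def)
      then show ?case by (rule tendsto_eventually)
    qed
  qed (use X in auto)
  then show ?thesis using X by (simp add: sets.Int_space_eq2)
qed

text \<open>The case of a constant sequence is the classical limit. The difference is controlled by
  |u^m - v^m| \<le> m |u - v| for u and v in the unit interval around 0, and here m |u - v| is |x m
  - a|.\<close>

lemma tendsto_power_exp:
  fixes x :: "nat \<Rightarrow> real"
  assumes x: "x \<longlonglongrightarrow> a" and a: "a > 0"
  shows "(\<lambda>m. (1 - x m / Suc m) ^ Suc m) \<longlonglongrightarrow> exp (- a)"
proof -
  have "(\<lambda>n. (1 + (-a) / n) ^ n) \<longlonglongrightarrow> exp (-a)"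
    by (rule tendsto_exp_limit_sequentially)
  from LIMSEQ_Suc[OF this] have w: "(\<lambda>m. (1 - a / Suc m) ^ Suc m) \<longlonglongrightarrow> exp (-a)"
    by simp
  have inv: "(\<lambda>m. 1 / real (Suc m)) \<longlonglongrightarrow> 0"
    using LIMSEQ_Suc[OF lim_1_over_n] by simp
  have "(\<lambda>m. x m * (1 / Suc m)) \<longlonglongrightarrow> a * 0" "(\<lambda>m. a * (1 / Suc m)) \<longlonglongrightarrow> a * 0"
    by (intro tendsto_intros x inv)+
  \<comment> \<open>Together with positivity these bounds place both bases in [-1, 1].\<close>
  then have "eventually (\<lambda>m. x m / Suc m < 2) sequentially" "eventually (\<lambda>m. a / Suc m < 2) sequentially"
    by (auto dest!: order_tendstoD(2)[where a=2])
  moreover have "eventually (\<lambda>m. 0 < x m) sequentially"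
    using order_tendstoD(1)[OF x a] .
  ultimately have "eventually (\<lambda>m. norm ((1 - x m / Suc m) ^ Suc m - (1 - a / Suc m) ^ Suc m) \<le> \<bar>x m - a\<bar>) sequentially"
  proof eventually_elim
    case (elim m)
    have "norm ((1 - x m / Suc m) ^ Suc m - (1 - a / Suc m) ^ Suc m)
        \<le> Suc m * norm ((1 - x m / Suc m) - (1 - a / Suc m))"
      using elim a by (intro norm_power_diff) (auto simp: abs_le_iff)
    also have "\<dots> = \<bar>real (Suc m) * ((1 - x m / Suc m) - (1 - a / Suc m))\<bar>"
      unfolding abs_mult by simp
    also have "(1 - x m / Suc m) - (1 - a / Suc m) = (a - x m) / Suc m"
      by (simp add: diff_divide_distrib)
    also have "real (Suc m) * ((a - x m) / Suc m) = a - x m"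
      by (simp del: of_nat_Suc)
    finally show ?case by (simp add: abs_minus_commute)
  qed
  moreover have "(\<lambda>m. \<bar>x m - a\<bar>) \<longlonglongrightarrow> 0"
    using x by (intro tendsto_rabs_zero) (simp add: LIM_zero)
  ultimately have "(\<lambda>m. (1 - x m / Suc m) ^ Suc m - (1 - a / Suc m) ^ Suc m) \<longlonglongrightarrow> 0"
    by (rule Lim_null_comparison)
  from tendsto_add[OF this w] show ?thesis by simp
qed

lemma tendsto_divide_Suc_0: "(\<lambda>m. (h::real) / real (Suc m)) \<longlonglongrightarrow> 0"
  using tendsto_mult_right_zero[OF LIMSEQ_inverse_real_of_nat, of h] by (simp add: divide_inverse)

lemma grid_point_in_interval:
  fixes h s :: real
  assumes "k \<le> Suc m" "0 < h"
  shows "s + real k * (h / Suc m) \<in> {s..s+h}"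
proof -
  have "real k * (h / Suc m) \<le> Suc m * (h / Suc m)"
    using assms by (intro mult_right_mono) (auto simp del: of_nat_Suc)
  then show ?thesis using assms by simp
qed

text \<open>The Markov property is in product form, which remains meaningful when the conditioning
  event is null, and for finite sets of times with last element \<open>s\<close>. All paths, not
  just almost all, start in 0.\<close>

locale switching_from_0 = prob_space P
  for P :: "'a measure" and \<epsilon> :: "real \<Rightarrow> 'a \<Rightarrow> nat"
    and p :: "real \<Rightarrow> nat \<Rightarrow> nat \<Rightarrow> real" and lam :: "nat \<Rightarrow> real" +
  assumes state_measurable: "\<And>t. t \<ge> 0 \<Longrightarrow> \<epsilon> t \<in> measurable P (count_space {0, 1})"
    and start: "\<And>\<omega>. \<omega> \<in> space P \<Longrightarrow> \<epsilon> 0 \<omega> = 0"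
    and right_continuous:
      "\<And>\<omega> t. \<omega> \<in> space P \<Longrightarrow> t \<ge> 0 \<Longrightarrow> continuous (at_right t) (\<lambda>u. \<epsilon> u \<omega>)"
    and left_limits:
      "\<And>\<omega> t. \<omega> \<in> space P \<Longrightarrow> t > 0 \<Longrightarrow> \<exists>l. ((\<lambda>u. \<epsilon> u \<omega>) \<longlongrightarrow> l) (at_left t)"
    and transition:
      "\<And>J s f h j. finite J \<Longrightarrow> J \<subseteq> {0..s} \<Longrightarrow> s \<in> J \<Longrightarrow> h > 0 \<Longrightarrow> j \<in> {0, 1} \<Longrightarrow>
         prob {\<omega> \<in> space P. (\<forall>u\<in>J. \<epsilon> u \<omega> = f u) \<and> \<epsilon> (s + h) \<omega> = j}
         = p h (f s) j * prob {\<omega> \<in> space P. \<forall>u\<in>J. \<epsilon> u \<omega> = f u}"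
    and rates: "\<And>i. i \<in> {0, 1} \<Longrightarrow> ((\<lambda>h. p h i (1 - i) / h) \<longlongrightarrow> lam i) (at_right 0)"
    and lam_pos: "\<And>i. i \<in> {0, 1} \<Longrightarrow> lam i > 0"
begin

section \<open>The Markov property for the natural filtration\<close>

lemma binary: "\<omega> \<in> space P \<Longrightarrow> u \<ge> 0 \<Longrightarrow> \<epsilon> u \<omega> = 0 \<or> \<epsilon> u \<omega> = 1"
  using measurable_space[OF state_measurable, of u \<omega>] by auto

lemma path: "\<omega> \<in> space P \<Longrightarrow> binary_path_0 (\<lambda>u. \<epsilon> u \<omega>)"
  using binary start right_continuous left_limits by unfold_locales auto

definition F :: "real \<Rightarrow> 'a measure" where
  "F s = sigma (space P) {{\<omega> \<in> space P. \<epsilon> u \<omega> = i} | u i. 0 \<le> u \<and> u \<le> s}"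

text \<open>Each cylinder prescribes the present state at \<open>s\<close>, which is what the
  transition law requires.\<close>

definition cylinders :: "real \<Rightarrow> 'a set set" where
  "cylinders s = {{\<omega> \<in> space P. \<forall>u\<in>J. \<epsilon> u \<omega> = f u} | J f. finite J \<and> J \<subseteq> {0..s} \<and> s \<in> J}"

lemma space_F [simp]: "space (F s) = space P"
  by (simp add: F_def space_measure_of_conv)

lemma sets_F: "sets (F s) = sigma_sets (space P) {{\<omega> \<in> space P. \<epsilon> u \<omega> = i} | u i. 0 \<le> u \<and> u \<le> s}"
  unfolding F_def by (rule sets_measure_of) auto

lemma state_in_F: "0 \<le> u \<Longrightarrow> u \<le> s \<Longrightarrow> {\<omega> \<in> space P. \<epsilon> u \<omega> = i} \<in> sets (F s)"
  unfolding sets_F by (rule sigma_sets.Basic) auto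

lemma state_in_events: "0 \<le> u \<Longrightarrow> {\<omega> \<in> space P. \<epsilon> u \<omega> = i} \<in> events"
  using state_measurable by (rule measurable_count_space_level_set)

lemma F_mono: "s \<le> t \<Longrightarrow> sets (F s) \<subseteq> sets (F t)"
  unfolding sets_F by (intro sigma_sets_mono') fastforce

lemma F_events: "sets (F s) \<subseteq> events"
  unfolding sets_F using state_in_events by (intro sets.sigma_sets_subset) auto

lemma Int_stable_cylinders: "Int_stable (cylinders s)"
proof (rule Int_stableI)
  fix A B assume "A \<in> cylinders s" "B \<in> cylinders s"
  then obtain J f K g where A: "A = {\<omega> \<in> space P. \<forall>u\<in>J. \<epsilon> u \<omega> = f u}" "finite J" "J \<subseteq> {0..s}" "s \<in> J"
    and B: "B = {\<omega> \<in> space P. \<forall>u\<in>K. \<epsilon> u \<omega> = g u}" "finite K" "K \<subseteq> {0..s}"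
    unfolding cylinders_def by blast
  \<comment> \<open>If the prescriptions conflict, the intersection is empty and must still be
    presented as a cylinder; 2 is not a state, so prescribing it gives the empty set.\<close>
  define h where "h u = (if \<exists>v\<in>J\<inter>K. f v \<noteq> g v then 2 else if u \<in> J then f u else g u)" for u
  have "A \<inter> B = {\<omega> \<in> space P. \<forall>u\<in>J\<union>K. \<epsilon> u \<omega> = h u}"
  proof (cases "\<exists>v\<in>J\<inter>K. f v \<noteq> g v")
    case True
    then have "A \<inter> B = {}" using A(1) B(1) by auto
    moreover have "\<epsilon> s \<omega> \<noteq> h s" if "\<omega> \<in> space P" for \<omega>
      using binary[of \<omega> s] that True A by (auto simp: h_def)
    then have "{\<omega> \<in> space P. \<forall>u\<in>J\<union>K. \<epsilon> u \<omega> = h u} = {}" using A(4) by auto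
    ultimately show ?thesis by simp
  next
    case False
    then have "h u = f u" if "u \<in> J" for u using that by (auto simp: h_def)
    moreover have "h u = g u" if "u \<in> K" for u using that False by (auto simp: h_def)
    ultimately show ?thesis using A(1) B(1) by auto
  qed
  then show "A \<inter> B \<in> cylinders s"
    unfolding cylinders_def using A B by (intro CollectI exI[of _ "J \<union> K"] exI[of _ h]) auto
qed

lemma F_subset_cylinders:
  assumes "0 \<le> s"
  shows "sets (F s) \<subseteq> sigma_sets (space P) (cylinders s)"
  unfolding sets_F
proof (rule sigma_sets_mono, safe)
  fix u i assume u: "0 \<le> u" "u \<le> s"
  \<comment> \<open>A cylinder has to fix the state at \<open>s\<close> as well, so the event is
    split according to that state.\<close>
  define B where "B j = {\<omega> \<in> space P. \<forall>v\<in>{u,s}. \<epsilon> v \<omega> = (if v = u then i else j)}" for j :: nat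
  show "{\<omega> \<in> space P. \<epsilon> u \<omega> = i} \<in> sigma_sets (space P) (cylinders s)"
  proof (cases "u = s")
    case True
    then have "{\<omega> \<in> space P. \<epsilon> u \<omega> = i} = {\<omega> \<in> space P. \<forall>v\<in>{s}. \<epsilon> v \<omega> = i}" by auto
    moreover have "\<dots> \<in> cylinders s"
      unfolding cylinders_def using assms by (intro CollectI exI[of _ "{s}"] exI[of _ "\<lambda>_. i"]) auto
    ultimately show ?thesis by (metis sigma_sets.Basic)
  next
    case False
    have "B j \<in> cylinders s" for j
      unfolding cylinders_def B_def using assms u
      by (intro CollectI exI[of _ "{u,s}"] exI[of _ "\<lambda>v. if v = u then i else j"]) auto
    then have "(\<Union>j. B j) \<in> sigma_sets (space P) (cylinders s)"
      by (intro sigma_sets.Union sigma_sets.Basic) auto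
    moreover have "(\<Union>j. B j) = {\<omega> \<in> space P. \<epsilon> u \<omega> = i}"
      using False by (auto simp: B_def)
    ultimately show ?thesis by simp
  qed
qed

text \<open>A pi-lambda argument: the product formula holds on the intersection-stable cylinders,
  and both sides are additive in \<open>A\<close>.\<close>

lemma markov:
  assumes A: "A \<in> sets (F s)" and s: "0 \<le> s" and h: "h > 0" and j: "j \<in> {0, 1}"
  shows "prob (A \<inter> {\<omega> \<in> space P. \<epsilon> s \<omega> = i \<and> \<epsilon> (s + h) \<omega> = j}) = p h i j * prob (A \<inter> {\<omega> \<in> space P. \<epsilon> s \<omega> = i})"
proof -
  let ?X = "{\<omega> \<in> space P. \<epsilon> s \<omega> = i \<and> \<epsilon> (s + h) \<omega> = j}" and ?Y = "{\<omega> \<in> space P. \<epsilon> s \<omega> = i}"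
  have Y: "?Y \<in> events" using s by (rule state_in_events)
  have "?X = ?Y \<inter> {\<omega> \<in> space P. \<epsilon> (s + h) \<omega> = j}" by auto
  then have X: "?X \<in> events" using Y state_in_events[of "s + h" j] s h by auto
  \<comment> \<open>The formula for the whole space, from which complements are obtained by
    subtraction.\<close>
  have XY: "prob ?X = p h i j * prob ?Y"
    using transition[of "{s}" s h j "\<lambda>_. i"] s h j by simp
  have pow: "cylinders s \<subseteq> Pow (space P)" by (auto simp: cylinders_def)
  have AC: "A \<in> sigma_sets (space P) (cylinders s)" using A F_subset_cylinders[OF s] by auto
  have cyl: "sigma_sets (space P) (cylinders s) \<subseteq> events"
  proof (rule sets.sigma_sets_subset, safe)
    fix B assume "B \<in> cylinders s"
    then obtain J f where B: "B = {\<omega> \<in> space P. \<forall>u\<in>J. \<epsilon> u \<omega> = f u}" "finite J" "J \<subseteq> {0..s}" "s \<in> J"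
      unfolding cylinders_def by blast
    then have "B = (\<Inter>u\<in>J. {\<omega> \<in> space P. \<epsilon> u \<omega> = f u})" by auto
    moreover have "\<dots> \<in> events"
      using B by (intro sets.finite_INT state_in_events) auto
    ultimately show "B \<in> events" by simp
  qed
  from Int_stable_cylinders pow AC show ?thesis
  proof (induction rule: sigma_sets_induct_disjoint)
    case (basic B)
    then obtain J f where B: "B = {\<omega> \<in> space P. \<forall>u\<in>J. \<epsilon> u \<omega> = f u}" "finite J" "J \<subseteq> {0..s}" "s \<in> J"
      unfolding cylinders_def by blast
    show ?case
    proof (cases "f s = i")
      case True
      then have "B \<inter> ?X = {\<omega> \<in> space P. (\<forall>u\<in>J. \<epsilon> u \<omega> = f u) \<and> \<epsilon> (s + h) \<omega> = j}" "B \<inter> ?Y = B"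
        using B by auto
      then show ?thesis using transition[OF B(2,3,4) h j, of f] B(1) True by simp
    next
      case False
      then have "B \<inter> ?X = {}" "B \<inter> ?Y = {}" using B by auto
      then show ?thesis by simp
    qed
  next
    case (compl B)
    then have "B \<in> events" using cyl by auto
    have *: "(space P - B) \<inter> Z = Z - (B \<inter> Z)" if "Z \<subseteq> space P" for Z using that by auto
    have d: "prob ((space P - B) \<inter> Z) = prob Z - prob (B \<inter> Z)" if "Z \<in> events" for Z
      using that \<open>B \<in> events\<close> *[OF sets.sets_into_space[OF that]] by (simp add: finite_measure_Diff)
    show ?case unfolding d[OF X] d[OF Y] using compl XY by (simp add: right_diff_distrib)
  next
    case (union B)
    then have B: "range B \<subseteq> events" using cyl by auto
    have "(\<lambda>n. prob (B n \<inter> Z)) sums prob ((\<Union>n. B n) \<inter> Z)" if "Z \<in> events" for Z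
      using finite_measure_UNION[of "\<lambda>n. B n \<inter> Z"] B union(1) that
      by (auto simp: disjoint_family_on_def)
    from this[OF X] sums_mult[OF this[OF Y], of "p h i j"] show ?case
      using union by (simp add: sums_iff)
  qed simp
qed

text \<open>The numbers \<open>p h i j\<close> are tied to probabilities only through states that
  occur with positive probability, so the row sum is read off at a time when \<open>i\<close>
  does.\<close>

lemma transition_sum_reachable:
  assumes s: "0 \<le> s" "prob {\<omega> \<in> space P. \<epsilon> s \<omega> = i} > 0" and i: "i \<in> {0, 1}" and h: "h > 0"
  shows "p h i i = 1 - p h i (1 - i)"
proof -
  let ?Y = "{\<omega> \<in> space P. \<epsilon> s \<omega> = i}" and ?X = "\<lambda>j. {\<omega> \<in> space P. \<epsilon> s \<omega> = i \<and> \<epsilon> (s + h) \<omega> = j}"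
  have X: "?X j \<in> events" for j
  proof -
    have "?X j = ?Y \<inter> {\<omega> \<in> space P. \<epsilon> (s + h) \<omega> = j}" by auto
    then show ?thesis using state_in_events[of s i] state_in_events[of "s + h" j] s h by auto
  qed
  have "?Y = ?X i \<union> ?X (1 - i)" "?X i \<inter> ?X (1 - i) = {}"
    using i by (auto dest: binary[OF _ add_nonneg_nonneg[OF s(1) less_imp_le[OF h]]])
  then have "prob ?Y = prob (?X i) + prob (?X (1 - i))"
    using finite_measure_Union[OF X X, of i "1 - i"] by simp
  also have "prob (?X j) = p h i j * prob ?Y" if "j \<in> {0,1}" for j
    using transition[of "{s}" s h j "\<lambda>_. i"] s h that by simp
  then have "prob (?X i) + prob (?X (1 - i)) = (p h i i + p h i (1 - i)) * prob ?Y"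
    using i by (auto simp: algebra_simps)
  finally show ?thesis using s(2) by simp
qed

text \<open>State 1 is occupied with positive probability at some small time, since the rate
  \<open>lam 0\<close> is positive and hence so is \<open>p h 0 1\<close> for small
  \<open>h\<close>.\<close>

lemma reachable:
  assumes "i \<in> {0, 1}"
  shows "\<exists>s\<ge>0. prob {\<omega> \<in> space P. \<epsilon> s \<omega> = i} > 0"
proof (cases "i = 0")
  case True
  have "{\<omega> \<in> space P. \<epsilon> 0 \<omega> = 0} = space P" using start by auto
  then show ?thesis using True prob_space by (intro exI[of _ 0]) auto
next
  case False
  then have i: "i = 1" using assms by simp
  have "eventually (\<lambda>h. 0 < p h 0 (1 - 0) / h) (at_right 0)"
    using order_tendstoD(1)[OF rates[of 0] lam_pos[of 0]] by simp
  moreover have "eventually (\<lambda>h::real. 0 < h) (at_right 0)" by (rule eventually_at_right_less)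
  ultimately have "eventually (\<lambda>h. 0 < h \<and> 0 < p h 0 1) (at_right 0)"
    by eventually_elim (auto simp: zero_less_divide_iff)
  then obtain h where h: "h > 0" "p h 0 1 > 0"
    using eventually_happens'[OF trivial_limit_at_right_real] by blast
  have "{\<omega> \<in> space P. \<epsilon> 0 \<omega> = 0} = space P" using start by auto
  moreover have "{\<omega> \<in> space P. \<epsilon> 0 \<omega> = 0 \<and> \<epsilon> h \<omega> = 1} = {\<omega> \<in> space P. \<epsilon> h \<omega> = 1}"
    using start by auto
  ultimately have "prob {\<omega> \<in> space P. \<epsilon> h \<omega> = 1} = p h 0 1"
    using transition[of "{0}" 0 h 1 "\<lambda>_. 0"] h prob_space by simp
  then show ?thesis using h i by (intro exI[of _ h]) auto
qed

lemma transition_sum: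
  assumes "i \<in> {0, 1}" "h > 0"
  shows "p h i i = 1 - p h i (1 - i)"
proof -
  obtain s where "s \<ge> 0" "prob {\<omega> \<in> space P. \<epsilon> s \<omega> = i} > 0"
    using reachable[OF assms(1)] by auto
  then show ?thesis using transition_sum_reachable assms by simp
qed

section \<open>Exponential holding from a deterministic time\<close>

lemma grid_measurable:
  assumes "A \<in> sets (F s)" "0 \<le> s" "0 \<le> \<delta>"
  shows "A \<inter> {\<omega> \<in> space P. \<forall>k\<le>m. \<epsilon> (s + real k * \<delta>) \<omega> = i} \<in> sets (F (s + real m * \<delta>))"
proof -
  have "A \<in> sets (F (s + real m * \<delta>))" using assms F_mono[of s "s + real m * \<delta>"] by auto
  moreover have "{\<omega> \<in> space P. \<forall>k\<le>m. \<epsilon> (s + real k * \<delta>) \<omega> = i}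
      = (\<Inter>k\<in>{..m}. {\<omega> \<in> space P. \<epsilon> (s + real k * \<delta>) \<omega> = i})" by auto
  moreover have "\<dots> \<in> sets (F (s + real m * \<delta>))"
    using assms by (intro sets.finite_INT state_in_F) (auto intro!: mult_right_mono)
  ultimately show ?thesis by auto
qed

lemma prob_grid:
  assumes A: "A \<in> sets (F s)" and s: "0 \<le> s" and \<delta>: "0 < \<delta>" and i: "i \<in> {0, 1}"
  shows "prob (A \<inter> {\<omega> \<in> space P. \<forall>k\<le>m. \<epsilon> (s + real k * \<delta>) \<omega> = i})
    = prob (A \<inter> {\<omega> \<in> space P. \<epsilon> s \<omega> = i}) * (p \<delta> i i) ^ m"
proof (induction m)
  case 0
  then show ?case by simp
next
  case (Suc m)
  let ?s = "s + real m * \<delta>" and ?A = "\<lambda>m. A \<inter> {\<omega> \<in> space P. \<forall>k\<le>m. \<epsilon> (s + real k * \<delta>) \<omega> = i}"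
  have s': "s + real (Suc m) * \<delta> = ?s + \<delta>" by (simp add: algebra_simps)
  have "?A (Suc m) = ?A m \<inter> {\<omega> \<in> space P. \<epsilon> ?s \<omega> = i \<and> \<epsilon> (?s + \<delta>) \<omega> = i}"
    unfolding s'[symmetric] by (auto simp: le_Suc_eq)
  also have "prob \<dots> = p \<delta> i i * prob (?A m \<inter> {\<omega> \<in> space P. \<epsilon> ?s \<omega> = i})"
    using s \<delta> i grid_measurable[OF A s, of \<delta> m i] by (intro markov) auto
  also have "?A m \<inter> {\<omega> \<in> space P. \<epsilon> ?s \<omega> = i} = ?A m" by blast
  finally show ?case using Suc by simp
qed

text \<open>By right continuity a deviation from state \<open>i\<close> at \<open>u\<close> persists
  on an interval to the right of \<open>u\<close>, and every fine enough grid meets that interval. A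
  deviation at the right end itself is seen because the end is a grid point.\<close>

lemma grid_tendsto:
  assumes "\<omega> \<in> space P" "0 \<le> s" "0 < h"
  shows "eventually (\<lambda>m. (\<forall>k\<le>Suc m. \<epsilon> (s + real k * (h / Suc m)) \<omega> = i)
    \<longleftrightarrow> (\<forall>u\<in>{s..s+h}. \<epsilon> u \<omega> = i)) sequentially"
proof (cases "\<forall>u\<in>{s..s+h}. \<epsilon> u \<omega> = i")
  case True
  then show ?thesis
    using grid_point_in_interval[OF _ assms(3), of _ _ s] by (intro always_eventually) blast
next
  case False
  interpret binary_path_0 "\<lambda>u. \<epsilon> u \<omega>" using path assms by blast
  obtain u where u: "s \<le> u" "u \<le> s + h" "\<epsilon> u \<omega> \<noteq> i" using False by auto
  have "0 \<le> u" using u(1) assms(2) by simp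
  then obtain d where d: "d > 0" "\<And>v. u \<le> v \<Longrightarrow> v < u + d \<Longrightarrow> \<epsilon> v \<omega> = \<epsilon> u \<omega>"
    using right_constant by blast
  have "eventually (\<lambda>m. h / Suc m < d) sequentially"
    using order_tendstoD(2)[OF tendsto_divide_Suc_0 d(1)] .
  then show ?thesis
  proof eventually_elim
    case (elim m)
    define \<delta> where "\<delta> = h / Suc m"
    have \<delta>: "\<delta> > 0" using assms by (simp add: \<delta>_def)
    \<comment> \<open>The index of the first grid point at or after \<open>u\<close>.\<close>
    define k where "k = nat \<lceil>(u - s) / \<delta>\<rceil>"
    have k1: "(u - s) / \<delta> \<le> k" unfolding k_def by linarith
    have "0 \<le> (u - s) / \<delta>" using u \<delta> by simp
    then have k2: "k < (u - s) / \<delta> + 1" unfolding k_def by linarith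
    have "u \<le> s + k * \<delta>" using k1 \<delta> by (simp add: pos_divide_le_eq algebra_simps)
    moreover have "s + k * \<delta> < u + d"
    proof -
      have "k * \<delta> < ((u - s) / \<delta> + 1) * \<delta>" using k2 \<delta> by (rule mult_strict_right_mono)
      also have "\<dots> = (u - s) + \<delta>" using \<delta> by (simp add: field_simps)
      finally show ?thesis using elim by (simp add: \<delta>_def)
    qed
    ultimately have "\<epsilon> (s + k * \<delta>) \<omega> \<noteq> i" using d(2)[of "s + k * \<delta>"] u(3) by simp
    moreover have "k \<le> Suc m"
    proof -
      have "(u - s) / \<delta> \<le> h / \<delta>" using u \<delta> by (intro divide_right_mono) auto
      also have "\<dots> = Suc m" using assms by (simp add: \<delta>_def)
      finally show ?thesis unfolding k_def by linarith
    qed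
    ultimately show ?case using False unfolding \<delta>_def by blast
  qed
qed

lemma stay_events: "0 \<le> s \<Longrightarrow> 0 < h \<Longrightarrow> {\<omega> \<in> space P. \<forall>u\<in>{s..s+h}. \<epsilon> u \<omega> = i} \<in> events"
proof -
  assume s: "0 \<le> s" "0 < h"
  let ?B = "\<lambda>m. {\<omega> \<in> space P. \<forall>k\<le>Suc m. \<epsilon> (s + real k * (h / Suc m)) \<omega> = i}"
  have "space P \<in> sets (F s)" using sets.top[of "F s"] unfolding space_F .
  moreover have "0 \<le> h / real (Suc m)" for m using s(2) by simp
  ultimately have "space P \<inter> ?B m \<in> events" for m
    by (rule subsetD[OF F_events grid_measurable[OF _ s(1)]])
  moreover have "space P \<inter> ?B m = ?B m" for m by blast
  ultimately have B: "?B m \<in> events" for m by (simp only:)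
  have "{\<omega> \<in> space P. \<forall>u\<in>{s..s+h}. \<epsilon> u \<omega> = i} = (\<Inter>m. ?B m)"
  proof (intro equalityI subsetI)
    fix \<omega> assume "\<omega> \<in> {\<omega> \<in> space P. \<forall>u\<in>{s..s+h}. \<epsilon> u \<omega> = i}"
    moreover have "s + real k * (h / Suc m) \<in> {s..s+h}" if "k \<le> Suc m" for k m
      using grid_point_in_interval that s(2) by blast
    ultimately show "\<omega> \<in> (\<Inter>m. ?B m)" by blast
  next
    fix \<omega> assume "\<omega> \<in> (\<Inter>m. ?B m)"
    then have \<omega>: "\<omega> \<in> space P" "\<And>m. \<forall>k\<le>Suc m. \<epsilon> (s + real k * (h / Suc m)) \<omega> = i" by blast+
    from grid_tendsto[OF \<omega>(1) s, of i]
    have "eventually (\<lambda>m::nat. \<forall>u\<in>{s..s+h}. \<epsilon> u \<omega> = i) sequentially"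
      by eventually_elim (use \<omega>(2) in blast)
    then have "\<forall>u\<in>{s..s+h}. \<epsilon> u \<omega> = i" by simp
    then show "\<omega> \<in> {\<omega> \<in> space P. \<forall>u\<in>{s..s+h}. \<epsilon> u \<omega> = i}" using \<omega>(1) by blast
  qed
  also have "\<dots> \<in> events" using B by (intro sets.countable_INT) blast+
  finally show ?thesis .
qed

text \<open>The grid events have geometric probabilities, and m times the one-step exit probability
  tends to \<open>lam i * h\<close>, so the powers converge to the exponential.\<close>

lemma prob_stay:
  assumes A: "A \<in> sets (F s)" and s: "0 \<le> s" and h: "0 < h" and i: "i \<in> {0, 1}"
  shows "prob (A \<inter> {\<omega> \<in> space P. \<forall>u\<in>{s..s+h}. \<epsilon> u \<omega> = i})
    = prob (A \<inter> {\<omega> \<in> space P. \<epsilon> s \<omega> = i}) * exp (- lam i * h)"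
proof -
  let ?c = "prob (A \<inter> {\<omega> \<in> space P. \<epsilon> s \<omega> = i})"
  let ?B = "\<lambda>m. A \<inter> {\<omega> \<in> space P. \<forall>k\<le>Suc m. \<epsilon> (s + real k * (h / Suc m)) \<omega> = i}"
  let ?S = "A \<inter> {\<omega> \<in> space P. \<forall>u\<in>{s..s+h}. \<epsilon> u \<omega> = i}"
  have B: "?B m \<in> events" for m
    using grid_measurable[OF A s, of "h / Suc m" "Suc m" i] F_events h by (auto simp del: of_nat_Suc)
  have S: "?S \<in> events" using A F_events stay_events[OF s h] by auto
  have "(\<lambda>m. prob (?B m)) \<longlonglongrightarrow> prob ?S"
  proof (rule measure_tendsto_eventually[OF B S], rule AE_I2)
    fix \<omega> assume \<omega>: "\<omega> \<in> space P"
    show "eventually (\<lambda>m. \<omega> \<in> ?B m \<longleftrightarrow> \<omega> \<in> ?S) sequentially"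
      using grid_tendsto[OF \<omega> s h, of i] by eventually_elim (use \<omega> in blast)
  qed
  moreover have "(\<lambda>m. prob (?B m)) \<longlonglongrightarrow> ?c * exp (- (lam i * h))"
  proof -
    let ?x = "\<lambda>m. Suc m * p (h / Suc m) i (1 - i)"
    have "filterlim (\<lambda>m. h / real (Suc m)) (at_right 0) sequentially"
      using h by (intro tendsto_imp_filterlim_at_right tendsto_divide_Suc_0) auto
    from filterlim_compose[OF rates[OF i] this]
    have "(\<lambda>m. h * (p (h / Suc m) i (1 - i) / (h / Suc m))) \<longlonglongrightarrow> h * lam i"
      by (intro tendsto_intros)
    moreover have eq: "h * (q / (h / c)) = c * q" for q c :: real using h by simp
    ultimately have "?x \<longlonglongrightarrow> lam i * h"
      by (simp only: eq mult.commute[of h "lam i"])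
    from tendsto_power_exp[OF this] have "(\<lambda>m. (1 - p (h / Suc m) i (1 - i)) ^ Suc m) \<longlonglongrightarrow> exp (- (lam i * h))"
      using h lam_pos[OF i] by simp
    then have "(\<lambda>m. ?c * p (h / Suc m) i i ^ Suc m) \<longlonglongrightarrow> ?c * exp (- (lam i * h))"
      using transition_sum[OF i] h by (intro tendsto_intros) simp
    moreover have "prob (?B m) = ?c * p (h / Suc m) i i ^ Suc m" for m
      using h by (intro prob_grid[OF A s _ i]) simp
    ultimately show ?thesis by (simp only:)
  qed
  ultimately have "prob ?S = ?c * exp (- (lam i * h))" by (rule LIMSEQ_unique)
  then show ?thesis by simp
qed

section \<open>Measurability of counts and switching times\<close>

abbreviation N :: "real \<Rightarrow> 'a \<Rightarrow> nat" where
  "N s \<omega> \<equiv> binary_path.N (\<lambda>u. \<epsilon> u \<omega>) s"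

abbreviation T :: "nat \<Rightarrow> 'a \<Rightarrow> real" where
  "T n \<omega> \<equiv> binary_path.T (\<lambda>u. \<epsilon> u \<omega>) n"

text \<open>At a time with at least \<open>n\<close> switchings, a state different from
  \<open>n mod 2\<close> reveals a further one. Rational times see it because the count is constant
  to the right of a switching; \<open>s\<close> is added for a switching exactly at
  \<open>s\<close>. The condition is a countable union, so measurability of \<open>N\<close> follows
  by induction.\<close>

lemma N_Suc_ge_iff:
  assumes \<omega>: "\<omega> \<in> space P" and s: "0 \<le> s"
  shows "Suc n \<le> N s \<omega> \<longleftrightarrow> (\<exists>q \<in> insert s (\<rat> \<inter> {0..s}). n \<le> N q \<omega> \<and> \<epsilon> q \<omega> \<noteq> n mod 2)"
proof -
  interpret w: binary_path_0 "\<lambda>u. \<epsilon> u \<omega>" using path \<omega> by blast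
  show ?thesis
  proof
    assume S: "Suc n \<le> N s \<omega>"
    define u where "u = T (Suc n) \<omega>"
    have u: "0 \<le> u" "u \<le> s" "N u \<omega> = Suc n"
      using w.T_nonneg[OF s S] w.T_le[OF s S] w.N_T[OF s S] by (auto simp: u_def)
    have "\<exists>q \<in> insert s (\<rat> \<inter> {0..s}). N q \<omega> = Suc n"
    proof (cases "u = s")
      case False
      obtain d where d: "d > 0" "\<And>v. u \<le> v \<Longrightarrow> v < u + d \<Longrightarrow> N v \<omega> = N u \<omega>"
        using w.N_right_constant[OF u(1)] by blast
      obtain q where "q \<in> \<rat>" "u < q" "q < min (u + d) s"
        using Rats_dense_in_real[of u "min (u + d) s"] d(1) u(2) False by auto
      then show ?thesis using d(2)[of q] u by (intro bexI[of _ q]) auto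
    qed (use u in auto)
    then obtain q where q: "q \<in> insert s (\<rat> \<inter> {0..s})" "N q \<omega> = Suc n" by blast
    have "\<epsilon> q \<omega> = Suc n mod 2" using w.state_eq[of q] q s by auto
    then show "\<exists>q \<in> insert s (\<rat> \<inter> {0..s}). n \<le> N q \<omega> \<and> \<epsilon> q \<omega> \<noteq> n mod 2"
      using q by (intro bexI[of _ q]) (auto simp: mod_Suc)
  next
    assume "\<exists>q \<in> insert s (\<rat> \<inter> {0..s}). n \<le> N q \<omega> \<and> \<epsilon> q \<omega> \<noteq> n mod 2"
    then obtain q where q: "0 \<le> q" "q \<le> s" "n \<le> N q \<omega>" "\<epsilon> q \<omega> \<noteq> n mod 2" using s by auto
    then have "N q \<omega> \<noteq> n" using w.state_eq[of q] by auto
    then show "Suc n \<le> N s \<omega>" using q w.N_mono[of q s] by simp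
  qed
qed

lemma N_ge_in_F: "0 \<le> s \<Longrightarrow> {\<omega> \<in> space P. n \<le> N s \<omega>} \<in> sets (F s)"
proof (induction n arbitrary: s)
  case 0
  then show ?case using sets.top[of "F s"] by simp
next
  case (Suc n)
  let ?Q = "insert s (\<rat> \<inter> {0..s})"
  have "{\<omega> \<in> space P. Suc n \<le> N s \<omega>}
      = (\<Union>q\<in>?Q. {\<omega> \<in> space P. n \<le> N q \<omega>} - {\<omega> \<in> space P. \<epsilon> q \<omega> = n mod 2})"
    using N_Suc_ge_iff[OF _ Suc.prems] by auto
  also have "\<dots> \<in> sets (F s)"
  proof (rule sets.countable_UN'')
    show "countable ?Q" using countable_rat by (auto intro: countable_subset)
    fix q assume "q \<in> ?Q"
    then have "0 \<le> q" "q \<le> s" using Suc.prems by auto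
    then show "{\<omega> \<in> space P. n \<le> N q \<omega>} - {\<omega> \<in> space P. \<epsilon> q \<omega> = n mod 2} \<in> sets (F s)"
      using Suc.IH[of q] F_mono[of q s] state_in_F[of q s] by blast
  qed
  finally show ?case .
qed

lemma N_eq_in_F: "0 \<le> s \<Longrightarrow> {\<omega> \<in> space P. N s \<omega> = n} \<in> sets (F s)"
proof -
  assume "0 \<le> s"
  moreover have "{\<omega> \<in> space P. N s \<omega> = n} = {\<omega> \<in> space P. n \<le> N s \<omega>} - {\<omega> \<in> space P. Suc n \<le> N s \<omega>}"
    by auto
  ultimately show ?thesis using N_ge_in_F by auto
qed

definition reaches :: "nat \<Rightarrow> 'a \<Rightarrow> bool" where
  "reaches n \<omega> \<longleftrightarrow> (\<exists>s\<ge>0. n \<le> N s \<omega>)"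

lemma reaches_iff:
  assumes "\<omega> \<in> space P"
  shows "reaches n \<omega> \<longleftrightarrow> (\<exists>k. n \<le> N (real k) \<omega>)"
proof -
  interpret w: binary_path_0 "\<lambda>u. \<epsilon> u \<omega>" using path assms by blast
  show ?thesis
    unfolding reaches_def
    using w.N_mono real_arch_simple by (metis le_trans of_nat_0_le_iff)
qed

lemma reaches_events [measurable]: "{\<omega> \<in> space P. reaches n \<omega>} \<in> events"
proof -
  have "{\<omega> \<in> space P. reaches n \<omega>} = (\<Union>k. {\<omega> \<in> space P. n \<le> N (real k) \<omega>})"
    using reaches_iff by auto
  also have "\<dots> \<in> events"
    using subsetD[OF F_events N_ge_in_F[OF of_nat_0_le_iff]] by (intro sets.countable_UN) blast
  finally show ?thesis .
qed

text \<open>If the count stopped at \<open>n\<close>, the path would stay in one state from some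
  integer time on. This has probability at most \<open>exp (- lam i * h)\<close> for arbitrarily
  large \<open>h\<close>, and there are countably many such events.\<close>

lemma AE_reaches: "AE \<omega> in P. \<forall>n. reaches n \<omega>"
proof -
  have "AE \<omega> in P. \<not> (\<forall>h::nat. \<forall>u\<in>{real k..real k + real (Suc h)}. \<epsilon> u \<omega> = i)" if i: "i \<in> {0, 1}" for k i
  proof -
    let ?S = "\<lambda>h::nat. {\<omega> \<in> space P. \<forall>u\<in>{real k..real k + real (Suc h)}. \<epsilon> u \<omega> = i}"
    have S: "?S h \<in> events" for h by (rule stay_events) auto
    have le: "prob (\<Inter>h. ?S h) \<le> exp (- lam i * Suc h)" for h
    proof -
      have "prob (\<Inter>h. ?S h) \<le> prob (?S h)" using S by (intro finite_measure_mono) auto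
      also have "?S h = space P \<inter> ?S h" by auto
      also have "prob \<dots> = prob (space P \<inter> {\<omega> \<in> space P. \<epsilon> (real k) \<omega> = i}) * exp (- lam i * Suc h)"
        using sets.top[of "F (real k)"] i by (intro prob_stay) auto
      also have "\<dots> \<le> 1 * exp (- lam i * Suc h)" by (intro mult_right_mono prob_le_1) auto
      finally show ?thesis by simp
    qed
    have "(\<lambda>h. exp (- lam i * Suc h)) \<longlonglongrightarrow> 0"
    proof -
      have "LIM h sequentially. lam i * real (Suc h) :> at_top"
        by (intro filterlim_tendsto_pos_mult_at_top[OF tendsto_const lam_pos[OF i]]
            filterlim_compose[OF filterlim_real_sequentially filterlim_Suc])
      then have "LIM h sequentially. - (lam i * real (Suc h)) :> at_bot"
        by (simp add: filterlim_uminus_at_top[symmetric] filterlim_uminus_at_bot)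
      from filterlim_compose[OF exp_at_bot this] show ?thesis by simp
    qed
    then have "prob (\<Inter>h. ?S h) \<le> 0"
      using le by (intro LIMSEQ_le_const) auto
    then have "emeasure P (\<Inter>h. ?S h) = 0"
      by (simp add: emeasure_eq_measure measure_le_0_iff)
    then have "(\<Inter>h. ?S h) \<in> null_sets P" using S by auto
    then show ?thesis
      by (rule AE_I') auto
  qed
  then have "AE \<omega> in P. \<forall>k. \<forall>i\<in>{0,1}. \<not> (\<forall>h::nat. \<forall>u\<in>{real k..real k + real (Suc h)}. \<epsilon> u \<omega> = i)"
    by (subst AE_all_countable, intro allI AE_ball_countable') auto
  then show ?thesis
    using AE_space
  proof eventually_elim
    case (elim \<omega>)
    interpret w: binary_path_0 "\<lambda>u. \<epsilon> u \<omega>" using path elim by blast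
    show ?case
    proof
      fix n
      show "reaches n \<omega>"
      proof (induction n)
        case 0
        then show ?case by (auto simp: reaches_def)
      next
        case (Suc n)
        then obtain k where k: "n \<le> N (real k) \<omega>" using reaches_iff elim by blast
        show ?case
        proof (rule ccontr)
          assume "\<not> reaches (Suc n) \<omega>"
          then have "N u \<omega> < Suc n" if "0 \<le> u" for u
            using that unfolding reaches_def by (meson not_le)
          moreover have "n \<le> N u \<omega>" if "real k \<le> u" for u using that k w.N_mono[of "real k" u] by simp
          ultimately have "N u \<omega> = n" if "real k \<le> u" for u
            using that by (metis le_antisym less_Suc_eq_le of_nat_0_le_iff order_trans)
          then have "\<epsilon> u \<omega> = n mod 2" if "real k \<le> u" for u
            using that w.state_eq[of u] by simp
          moreover have "n mod 2 \<in> {0, 1}" by auto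
          ultimately show False using elim(1) by (meson atLeastAtMost_iff)
        qed
      qed
    qed
  qed
qed

text \<open>
  The events known at the \<open>n\<close>-th switching time. Since the switching times are real-valued functions,
  with a junk value on paths that never switch \<open>n\<close> times, only the trace on \<open>{n \<le> N s}\<close> matters.
\<close>
definition G :: "nat \<Rightarrow> 'a measure" where
  "G n = sigma (space P) {A. A \<subseteq> space P \<and> A \<in> events \<and> (\<forall>s\<ge>0. A \<inter> {\<omega> \<in> space P. n \<le> N s \<omega>} \<in> sets (F s))}"

lemma space_G [simp]: "space (G n) = space P"
  by (simp add: G_def space_measure_of_conv)

text \<open>The defining family is already a sigma-algebra, so generating adds nothing. Closure
  under complements uses that \<open>{n \<le> N s}\<close> is known at time
  \<open>s\<close>.\<close>

lemma sets_G: "sets (G n) = {A. A \<subseteq> space P \<and> A \<in> events \<and> (\<forall>s\<ge>0. A \<inter> {\<omega> \<in> space P. n \<le> N s \<omega>} \<in> sets (F s))}"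
proof -
  let ?G = "{A. A \<subseteq> space P \<and> A \<in> events \<and> (\<forall>s\<ge>0. A \<inter> {\<omega> \<in> space P. n \<le> N s \<omega>} \<in> sets (F s))}"
  have "sigma_algebra (space P) ?G"
    unfolding sigma_algebra_iff2
  proof (intro conjI ballI allI impI)
    show "?G \<subseteq> Pow (space P)" by auto
    show "{} \<in> ?G" by auto
    show "space P - A \<in> ?G" if "A \<in> ?G" for A
    proof -
      have "(space P - A) \<inter> {\<omega> \<in> space P. n \<le> N s \<omega>}
        = {\<omega> \<in> space P. n \<le> N s \<omega>} - A \<inter> {\<omega> \<in> space P. n \<le> N s \<omega>}" for s by auto
      then show ?thesis using that N_ge_in_F by auto
    qed
    show "(\<Union>i. A i) \<in> ?G" if "range A \<subseteq> ?G" for A :: "nat \<Rightarrow> 'a set"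
    proof -
      have "A i \<in> ?G" for i using that by blast
      then have A: "A i \<subseteq> space P" "A i \<in> events"
        "s \<ge> 0 \<Longrightarrow> A i \<inter> {\<omega> \<in> space P. n \<le> N s \<omega>} \<in> sets (F s)" for i s
        by blast+
      have "(\<Union>i. A i) \<inter> {\<omega> \<in> space P. n \<le> N s \<omega>} \<in> sets (F s)" if "s \<ge> 0" for s
      proof -
        have "(\<Union>i. A i) \<inter> {\<omega> \<in> space P. n \<le> N s \<omega>} = (\<Union>i. A i \<inter> {\<omega> \<in> space P. n \<le> N s \<omega>})"
          by blast
        also have "\<dots> \<in> sets (F s)" using A(3)[OF that] by (intro sets.countable_UN) blast
        finally show ?thesis .
      qed
      moreover have "(\<Union>i. A i) \<in> events" using A(2) by (intro sets.countable_UN) blast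
      ultimately show ?thesis using A(1) by blast
    qed
  qed
  then show ?thesis
    unfolding G_def by (subst sets_measure_of) (auto simp: sigma_algebra.sigma_sets_eq)
qed

lemma G_events: "sets (G n) \<subseteq> events"
  by (auto simp: sets_G)

lemma measurable_G_P: "f \<in> measurable (G n) L \<Longrightarrow> f \<in> measurable P L"
  using measurable_mono[of L L "G n" P] G_events by auto

lemma T_le_iff_N:
  assumes "\<omega> \<in> space P" "reaches n \<omega>" "0 \<le> r"
  shows "T n \<omega> \<le> r \<longleftrightarrow> n \<le> N r \<omega>"
proof -
  interpret w: binary_path_0 "\<lambda>u. \<epsilon> u \<omega>" using path assms by blast
  show ?thesis using assms w.T_le_iff by (auto simp: reaches_def)
qed

lemma T_nonneg:
  assumes "\<omega> \<in> space P" "reaches n \<omega>"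
  shows "0 \<le> T n \<omega>"
proof -
  interpret w: binary_path_0 "\<lambda>u. \<epsilon> u \<omega>" using path assms by blast
  show ?thesis using assms w.T_nonneg by (auto simp: reaches_def)
qed

lemma T_unreached:
  assumes "\<omega> \<in> space P" "\<not> reaches n \<omega>"
  shows "T n \<omega> = Inf {}"
proof -
  interpret w: binary_path_0 "\<lambda>u. \<epsilon> u \<omega>" using path assms by blast
  have "{s. 0 \<le> s \<and> n \<le> N s \<omega>} = {}" using assms by (auto simp: reaches_def)
  then show ?thesis by (simp only: w.T_def)
qed

lemma T_le_events: "{\<omega> \<in> space P. T n \<omega> \<le> r} \<in> events"
proof -
  \<comment> \<open>Paths that never switch \<open>n\<close> times share the unspecified value
    \<open>Inf {}\<close>, which contributes all of them or none.\<close>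
  have "{\<omega> \<in> space P. T n \<omega> \<le> r}
    = (if 0 \<le> r then {\<omega> \<in> space P. n \<le> N r \<omega>} else {}) \<union>
      (if Inf {} \<le> r then space P - {\<omega> \<in> space P. reaches n \<omega>} else {})"
  proof -
    have "T n \<omega> \<le> r \<longleftrightarrow> (0 \<le> r \<and> n \<le> N r \<omega>) \<or> (Inf {} \<le> r \<and> \<not> reaches n \<omega>)" if "\<omega> \<in> space P" for \<omega>
      using T_le_iff_N[OF that, of n r] T_unreached[OF that, of n] T_nonneg[OF that, of n]
      by (cases "reaches n \<omega>"; cases "0 \<le> r") (auto simp: reaches_def)
    then show ?thesis by auto
  qed
  then show ?thesis
    using N_ge_in_F[of r n] F_events[of r] by auto
qed

lemma T_measurable_G:
  assumes "k \<le> n"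
  shows "T k \<in> borel_measurable (G n)"
  unfolding borel_measurable_iff_le space_G sets_G
proof (intro allI CollectI conjI impI)
  fix r s :: real
  show "{\<omega> \<in> space P. T k \<omega> \<le> r} \<in> events" by (rule T_le_events)
  assume s: "0 \<le> s"
  show "{\<omega> \<in> space P. T k \<omega> \<le> r} \<inter> {\<omega> \<in> space P. n \<le> N s \<omega>} \<in> sets (F s)"
  proof (cases "0 \<le> r")
    case True
    \<comment> \<open>On paths with \<open>n \<le> N s\<close> the time \<open>T k\<close> is at
      most \<open>s\<close>, so the comparison with \<open>r\<close> is decided by time
      \<open>min r s\<close>.\<close>
    have "{\<omega> \<in> space P. T k \<omega> \<le> r} \<inter> {\<omega> \<in> space P. n \<le> N s \<omega>}
      = {\<omega> \<in> space P. k \<le> N (min r s) \<omega>} \<inter> {\<omega> \<in> space P. n \<le> N s \<omega>}"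
    proof -
      have "T k \<omega> \<le> r \<longleftrightarrow> k \<le> N (min r s) \<omega>" if "\<omega> \<in> space P" "n \<le> N s \<omega>" for \<omega>
      proof -
        have "reaches k \<omega>" using that s assms by (auto simp: reaches_def intro: le_trans)
        then have "T k \<omega> \<le> r \<longleftrightarrow> k \<le> N r \<omega>" "T k \<omega> \<le> s \<longleftrightarrow> k \<le> N s \<omega>"
          using T_le_iff_N that True s by auto
        then show ?thesis using that(2) assms by (auto simp: min_def)
      qed
      then show ?thesis by auto
    qed
    also have "\<dots> \<in> sets (F s)"
      using N_ge_in_F[of "min r s" k] N_ge_in_F[OF s, of n] F_mono[of "min r s" s] True s by auto
    finally show ?thesis .
  next
    case False
    have "\<not> T k \<omega> \<le> r" if "\<omega> \<in> space P" "n \<le> N s \<omega>" for \<omega>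
    proof -
      have "reaches k \<omega>"
        unfolding reaches_def using le_trans[OF assms that(2)] s by blast
      then show ?thesis using T_nonneg[OF that(1), of k] False by simp
    qed
    then have "{\<omega> \<in> space P. T k \<omega> \<le> r} \<inter> {\<omega> \<in> space P. n \<le> N s \<omega>} = {}" by auto
    then show ?thesis by simp
  qed
qed auto

lemma T_measurable [measurable]: "T k \<in> borel_measurable P"
  unfolding borel_measurable_iff_le using T_le_events by simp

text \<open>
  Round \<open>T n\<close> up to the grid of mesh \<open>1 / (m + 1)\<close>: on each cell the Markov property at a deterministic time
  applies, and \<open>m\<close> then tends to infinity.
\<close>
lemma survival:
  assumes A: "A \<in> sets (G n)" and h: "0 < h"
  shows "prob {\<omega> \<in> A. T n \<omega> + h < T (Suc n) \<omega>} = exp (- lam (n mod 2) * h) * prob {\<omega> \<in> A. T n \<omega> < T (Suc n) \<omega>}"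
proof -
  \<comment> \<open>The index of the first grid point at or after \<open>T n\<close>;
    \<open>c\<close> is that grid point.\<close>
  define K where "K m \<omega> = nat \<lceil>T n \<omega> * real (Suc m)\<rceil>" for m \<omega>
  define c where "c m \<omega> = real (K m \<omega>) / real (Suc m)" for m \<omega>
  \<comment> \<open>The cell \<open>k\<close> without a further switching up to \<open>h\<close>
    after its grid time. The clause \<open>n \<le> N ...\<close> places the event in the trace on
    which membership in \<open>G n\<close> gives membership in \<open>F\<close>. Taking
    \<open>h = 0\<close> gives the part known at the grid time.\<close>
  define E where "E m k h = {\<omega> \<in> A. n \<le> N (real k / real (Suc m)) \<omega> \<and> K m \<omega> = k \<and> N (real k / real (Suc m) + h) \<omega> = n}"
    for m k h
  have A_sp: "A \<subseteq> space P" using sets.sets_into_space[OF A] by simp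
  have E_0: "E m k 0 \<in> sets (F (real k / real (Suc m)))" for m k
  proof -
    let ?s = "real k / real (Suc m)"
    have [measurable]: "T n \<in> borel_measurable (G n)" by (rule T_measurable_G) simp
    have "K m \<in> measurable (G n) (count_space UNIV)"
      unfolding K_def by measurable
    then have "K m -` {k} \<inter> space (G n) \<in> sets (G n)" by (rule measurable_sets) simp
    then have "A \<inter> (K m -` {k} \<inter> space P) \<in> sets (G n)" using A by auto
    then have "(A \<inter> (K m -` {k} \<inter> space P)) \<inter> {\<omega> \<in> space P. n \<le> N ?s \<omega>} \<in> sets (F ?s)"
      by (auto simp: sets_G)
    moreover have "{\<omega> \<in> space P. N ?s \<omega> = n} \<in> sets (F ?s)" by (rule N_eq_in_F) simp
    moreover have "E m k 0 = (A \<inter> (K m -` {k} \<inter> space P)) \<inter> {\<omega> \<in> space P. n \<le> N ?s \<omega>} \<inter> {\<omega> \<in> space P. N ?s \<omega> = n}"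
      using A_sp by (auto simp: E_def)
    ultimately show ?thesis by auto
  qed
  have E_h: "E m k h = E m k 0 \<inter> {\<omega> \<in> space P. \<forall>u\<in>{real k / real (Suc m)..real k / real (Suc m) + h}. \<epsilon> u \<omega> = n mod 2}"
    (is "_ = _ \<inter> ?stay") for m k
  proof -
    let ?s = "real k / real (Suc m)"
    have s0: "0 \<le> ?s" by simp
    have iff: "n \<le> N ?s \<omega> \<and> N (?s + h) \<omega> = n \<longleftrightarrow>
       N ?s \<omega> = n \<and> (\<forall>u\<in>{?s..?s + h}. \<epsilon> u \<omega> = n mod 2)" if "\<omega> \<in> space P" for \<omega>
    proof -
      interpret w: binary_path_0 "\<lambda>u. \<epsilon> u \<omega>" using path that by blast
      show ?thesis
      proof (intro iffI conjI ballI; elim conjE)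
        assume a: "n \<le> N ?s \<omega>" "N (?s + h) \<omega> = n"
        have const: "N u \<omega> = n" if u: "u \<in> {?s..?s + h}" for u
        proof -
          have "0 \<le> u" using u s0 by (meson atLeastAtMost_iff order_trans)
          then show ?thesis
            using w.N_mono[of ?s u] w.N_mono[of u "?s + h"] u a s0 by force
        qed
        show "N ?s \<omega> = n" using const[of ?s] h by simp
        fix u assume u: "u \<in> {?s..?s + h}"
        have "0 \<le> u" using u s0 by (meson atLeastAtMost_iff order_trans)
        then show "\<epsilon> u \<omega> = n mod 2" using const[OF u] w.state_eq[of u] by simp
      next
        assume N_s: "N ?s \<omega> = n" and stay: "\<forall>u\<in>{?s..?s + h}. \<epsilon> u \<omega> = n mod 2"
        show "n \<le> N ?s \<omega>" using N_s by simp
        show "N (?s + h) \<omega> = n"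
        proof (rule ccontr)
          assume ne: "N (?s + h) \<omega> \<noteq> n"
          have sh: "0 \<le> ?s + h" using s0 h by linarith
          have "n \<le> N (?s + h) \<omega>" using w.N_mono[of ?s "?s + h"] h s0 N_s by linarith
          with ne have S: "Suc n \<le> N (?s + h) \<omega>" by simp
          let ?u = "T (Suc n) \<omega>"
          have u: "0 \<le> ?u" "?u \<le> ?s + h" "N ?u \<omega> = Suc n"
            using w.T_nonneg[OF sh S] w.T_le[OF sh S] w.N_T[OF sh S] by auto
          have "?s \<le> ?u"
            using w.N_mono[OF u(1), of ?s] u(3) N_s by (cases "?u \<le> ?s") auto
          then have "\<epsilon> ?u \<omega> = n mod 2" using stay u(2) by (meson atLeastAtMost_iff)
          moreover have "\<epsilon> ?u \<omega> = Suc n mod 2" using w.state_eq[OF u(1)] u(3) by simp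
          ultimately show False by presburger
        qed
      qed
    qed
    show ?thesis
    proof (rule set_eqI)
      fix \<omega>
      show "\<omega> \<in> E m k h \<longleftrightarrow> \<omega> \<in> E m k 0 \<inter> {\<omega> \<in> space P. \<forall>u\<in>{?s..?s + h}. \<epsilon> u \<omega> = n mod 2}"
      proof (cases "\<omega> \<in> A")
        case True
        then have "\<omega> \<in> space P" using A_sp by blast
        show ?thesis
          using iff[OF \<open>\<omega> \<in> space P\<close>] True \<open>\<omega> \<in> space P\<close>
          unfolding E_def mem_Collect_eq Int_iff add_0_right by blast
      qed (simp add: E_def)
    qed
  qed
  have E_0_events: "E m k 0 \<in> events" for m k
    using subsetD[OF F_events E_0] .
  have E_h_events: "E m k h \<in> events" for m k
    unfolding E_h by (intro sets.Int E_0_events stay_events h) simp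
  have prob_E: "prob (E m k h) = exp (- lam (n mod 2) * h) * prob (E m k 0)" for m k
  proof -
    let ?s = "real k / real (Suc m)"
    have "prob (E m k h) = prob (E m k 0 \<inter> {\<omega> \<in> space P. \<epsilon> ?s \<omega> = n mod 2}) * exp (- lam (n mod 2) * h)"
      unfolding E_h by (rule prob_stay[OF E_0 _ h]) auto
    also have "E m k 0 \<inter> {\<omega> \<in> space P. \<epsilon> ?s \<omega> = n mod 2} = E m k 0"
    proof -
      have "\<epsilon> ?s \<omega> = n mod 2" if "\<omega> \<in> E m k 0" for \<omega>
      proof -
        interpret w: binary_path_0 "\<lambda>u. \<epsilon> u \<omega>" using path that A_sp by (auto simp: E_def)
        show ?thesis using that w.state_eq[of ?s] by (simp add: E_def)
      qed
      then show ?thesis using A_sp by (auto simp: E_def)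
    qed
    finally show ?thesis by simp
  qed
  have prob_UN: "prob (\<Union>k. E m k h) = exp (- lam (n mod 2) * h) * prob (\<Union>k. E m k 0)" for m
  proof -
    have "(\<lambda>k. prob (E m k x)) sums prob (\<Union>k. E m k x)" if "\<And>k. E m k x \<in> events" for x
      using that by (intro finite_measure_UNION) (auto simp: disjoint_family_on_def E_def)
    from this[of h] this[of 0] show ?thesis
      using E_0_events E_h_events sums_mult[of "\<lambda>k. prob (E m k 0)" _ "exp (- lam (n mod 2) * h)"] prob_E
      by (simp add: sums_iff)
  qed
  \<comment> \<open>The grid point approaches \<open>T n\<close> from above with error at most
    \<open>1 / Suc m\<close>. Therefore a strict inequality \<open>T n + x < T (Suc n)\<close>
    eventually holds for the rounded time too, and its failure is inherited by every rounded
    time.\<close>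
  have limit: "(\<lambda>m. prob (\<Union>k. E m k x)) \<longlonglongrightarrow> prob {\<omega> \<in> A. T n \<omega> + x < T (Suc n) \<omega>}"
    if ev: "\<And>m k. E m k x \<in> events" and x: "0 \<le> x" for x
  proof (rule measure_tendsto_eventually)
    have "{\<omega> \<in> A. T n \<omega> + x < T (Suc n) \<omega>} = A \<inter> {\<omega> \<in> space P. T n \<omega> + x < T (Suc n) \<omega>}"
      using A_sp by auto
    also have "\<dots> \<in> events" using A G_events by (intro sets.Int) auto
    finally show "{\<omega> \<in> A. T n \<omega> + x < T (Suc n) \<omega>} \<in> events" .
    show "AE \<omega> in P. eventually (\<lambda>m. (\<omega> \<in> (\<Union>k. E m k x)) = (\<omega> \<in> {\<omega> \<in> A. T n \<omega> + x < T (Suc n) \<omega>})) sequentially"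
      using AE_reaches AE_space
    proof eventually_elim
      case (elim \<omega>)
      have T0: "0 \<le> T n \<omega>" using T_nonneg elim by simp
      have c_ge: "T n \<omega> \<le> c m \<omega>" for m
        unfolding c_def K_def using T0 by (simp add: pos_le_divide_eq del: of_nat_Suc)
      have c_le: "c m \<omega> \<le> T n \<omega> + 1 / real (Suc m)" for m
      proof -
        have "real (K m \<omega>) \<le> T n \<omega> * real (Suc m) + 1"
          unfolding K_def using T0 ceiling_correct[of "T n \<omega> * real (Suc m)"] by (simp del: of_nat_Suc)
        then have "c m \<omega> \<le> (T n \<omega> * real (Suc m) + 1) / real (Suc m)"
          unfolding c_def by (intro divide_right_mono) auto
        also have "\<dots> = T n \<omega> + 1 / real (Suc m)" by (simp add: add_divide_distrib del: of_nat_Suc)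
        finally show ?thesis .
      qed
      have mem: "\<omega> \<in> (\<Union>k. E m k x) \<longleftrightarrow> \<omega> \<in> A \<and> c m \<omega> + x < T (Suc n) \<omega>" for m
      proof -
        have c0: "0 \<le> c m \<omega>" by (simp add: c_def)
        have "n \<le> N (c m \<omega>) \<omega>" "n \<le> N (c m \<omega> + x) \<omega>"
          using T_le_iff_N[of \<omega> n "c m \<omega>"] T_le_iff_N[of \<omega> n "c m \<omega> + x"] elim c_ge[of m] c0 x by simp_all
        moreover have "T (Suc n) \<omega> \<le> c m \<omega> + x \<longleftrightarrow> Suc n \<le> N (c m \<omega> + x) \<omega>"
          using elim c0 x by (intro T_le_iff_N) auto
        ultimately show ?thesis
          unfolding E_def c_def by auto
      qed
      show ?case
      proof (cases "T n \<omega> + x < T (Suc n) \<omega>")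
        case True
        have "eventually (\<lambda>m. 1 / real (Suc m) < T (Suc n) \<omega> - (T n \<omega> + x)) sequentially"
          using True by (intro order_tendstoD(2)[OF tendsto_divide_Suc_0]) simp
        then show ?thesis
        proof eventually_elim
          case (elim m)
          then have "c m \<omega> + x < T (Suc n) \<omega>" using c_le[of m] by linarith
          then show ?case using mem True by simp
        qed
      next
        case False
        then have "\<not> c m \<omega> + x < T (Suc n) \<omega>" for m using c_ge[of m] by linarith
        then show ?thesis using mem False by simp
      qed
    qed
  qed (use ev in auto)
  have "(\<lambda>m. exp (- lam (n mod 2) * h) * prob (\<Union>k. E m k 0)) \<longlonglongrightarrow>
      exp (- lam (n mod 2) * h) * prob {\<omega> \<in> A. T n \<omega> + 0 < T (Suc n) \<omega>}"
    by (intro tendsto_intros limit E_0_events) simp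
  moreover have "(\<lambda>m. prob (\<Union>k. E m k h)) \<longlonglongrightarrow> prob {\<omega> \<in> A. T n \<omega> + h < T (Suc n) \<omega>}"
    using h by (intro limit E_h_events) simp
  ultimately show ?thesis
    unfolding prob_UN by (simp add: LIMSEQ_unique)
qed

section \<open>The next duration is exponential and independent of the past\<close>

lemma AE_T_less_Suc: "AE \<omega> in P. \<forall>n. T n \<omega> < T (Suc n) \<omega>"
  using AE_reaches AE_space
proof eventually_elim
  case (elim \<omega>)
  interpret w: binary_path_0 "\<lambda>u. \<epsilon> u \<omega>" using path elim by blast
  show ?case using elim w.T_less_Suc unfolding reaches_def by blast
qed

lemma prob_duration_le:
  assumes A: "A \<in> sets (G n)" and h: "0 \<le> h"
  shows "prob {\<omega> \<in> A. T (Suc n) \<omega> - T n \<omega> \<le> h} = prob A * (1 - exp (- h * lam (n mod 2)))"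
proof -
  have A': "A \<in> events" using subsetD[OF G_events A] .
  have A_sp: "A \<subseteq> space P" using sets.sets_into_space[OF A'] .
  have *: "{\<omega> \<in> A. T n \<omega> + x < T (Suc n) \<omega>} = A \<inter> {\<omega> \<in> space P. T n \<omega> + x < T (Suc n) \<omega>}" for x
    using A_sp by blast
  have ev: "{\<omega> \<in> A. T n \<omega> + x < T (Suc n) \<omega>} \<in> events" for x
    unfolding * using A' by (intro sets.Int) auto
  have "prob {\<omega> \<in> A. T n \<omega> + 0 < T (Suc n) \<omega>} = prob A"
    by (rule finite_measure_eq_AE) (use AE_T_less_Suc A' ev[of 0] in \<open>auto elim!: eventually_mono\<close>)
  then have surv: "prob {\<omega> \<in> A. T n \<omega> + h < T (Suc n) \<omega>} = exp (- lam (n mod 2) * h) * prob A"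
    using survival[OF A, of h] h by (cases "h = 0") auto
  have "{\<omega> \<in> A. T (Suc n) \<omega> - T n \<omega> \<le> h} = A - {\<omega> \<in> A. T n \<omega> + h < T (Suc n) \<omega>}"
    by auto
  then have "prob {\<omega> \<in> A. T (Suc n) \<omega> - T n \<omega> \<le> h} = prob A - prob {\<omega> \<in> A. T n \<omega> + h < T (Suc n) \<omega>}"
    using finite_measure_Diff[OF A' ev[of h]] by auto
  then show ?thesis unfolding surv by (simp add: algebra_simps)
qed

text \<open>Under the law conditioned on \<open>A\<close> the duration has the exponential
  distribution function, which determines its law on all Borel sets. Null \<open>A\<close> are
  separate because conditioning is then undefined.\<close>

lemma emeasure_duration:
  assumes A: "A \<in> sets (G n)" and B: "B \<in> sets borel"
  shows "emeasure P {\<omega> \<in> A. T (Suc n) \<omega> - T n \<omega> \<in> B}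
    = emeasure P A * emeasure (density lborel (exponential_density (lam (n mod 2)))) B"
proof (cases "prob A = 0")
  case True
  have A': "A \<in> events" using subsetD[OF G_events A] .
  have "emeasure P {\<omega> \<in> A. T (Suc n) \<omega> - T n \<omega> \<in> B} \<le> emeasure P A"
    using A' by (intro emeasure_mono) auto
  then show ?thesis using True by (simp add: emeasure_eq_measure)
next
  case False
  have A': "A \<in> events" using subsetD[OF G_events A] .
  have A_sp: "A \<subseteq> space P" using sets.sets_into_space[OF A'] .
  have pos: "emeasure P A \<noteq> 0" "emeasure P A \<noteq> \<infinity>" using False by (auto simp: emeasure_eq_measure)
  let ?U = "uniform_measure P A" and ?S = "\<lambda>\<omega>. T (Suc n) \<omega> - T n \<omega>" and ?l = "lam (n mod 2)"
  interpret U: prob_space ?U using pos by (rule prob_space_uniform_measure)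
  have l: "0 < ?l" by (rule lam_pos) auto
  have dist: "distributed ?U lborel ?S (exponential_density ?l)"
    unfolding U.exponential_distributed_iff[OF l]
  proof (intro conjI allI impI)
    show "?S \<in> borel_measurable ?U" by simp
    fix h :: real assume h: "0 \<le> h"
    have eq: "A \<inter> {\<omega> \<in> space P. ?S \<omega> \<le> h} = {\<omega> \<in> A. ?S \<omega> \<le> h}" using A_sp by auto
    have "U.prob {\<omega> \<in> space ?U. ?S \<omega> \<le> h} = prob (A \<inter> {\<omega> \<in> space P. ?S \<omega> \<le> h}) / prob A"
      using pos by (simp add: measure_uniform_measure)
    also have "\<dots> = 1 - exp (- h * ?l)"
      unfolding eq prob_duration_le[OF A h] using False by simp
    finally show "U.prob {\<omega> \<in> space ?U. ?S \<omega> \<le> h} = 1 - exp (- h * ?l)" .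
  qed
  have eq: "A \<inter> (?S -` B \<inter> space P) = {\<omega> \<in> A. ?S \<omega> \<in> B}" using A_sp by auto
  have "emeasure (density lborel (exponential_density ?l)) B = emeasure (distr ?U lborel ?S) B"
    using distributed_distr_eq_density[OF dist] by simp
  also have "\<dots> = emeasure ?U (?S -` B \<inter> space P)"
    using B by (subst emeasure_distr) auto
  also have "\<dots> = emeasure P {\<omega> \<in> A. ?S \<omega> \<in> B} / emeasure P A"
    using B A' by (subst emeasure_uniform_measure) (auto simp: eq)
  finally have eq: "emeasure (density lborel (exponential_density ?l)) B
      = emeasure P {\<omega> \<in> A. ?S \<omega> \<in> B} / emeasure P A" .
  show ?thesis
    unfolding eq ennreal_times_divide mult.commute[of "emeasure P A"]
    using pos by (simp add: ennreal_mult_divide_eq)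
qed

text \<open>The previous identity says that the joint law of the past and the next duration agrees
  on rectangles with a product measure, so it is that product and Tonelli applies. Transporting
  \<open>P\<close> along the identity to \<open>G n\<close> restricts it to the past.\<close>

lemma nn_integral_duration:
  assumes f: "f \<in> borel_measurable (G n \<Otimes>\<^sub>M borel)"
  shows "(\<integral>\<^sup>+\<omega>. f (\<omega>, T (Suc n) \<omega> - T n \<omega>) \<partial>P) =
    (\<integral>\<^sup>+\<omega>. (\<integral>\<^sup>+s. ennreal (exponential_density (lam (n mod 2)) s) * f (\<omega>, s) \<partial>lborel) \<partial>P)"
proof -
  let ?l = "lam (n mod 2)"
  let ?E = "density lborel (exponential_density ?l)"
  let ?G = "distr P (G n) (\<lambda>\<omega>. \<omega>)"
  let ?S = "\<lambda>\<omega>. (\<omega>, T (Suc n) \<omega> - T n \<omega>)"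
  have id: "(\<lambda>\<omega>. \<omega>) \<in> P \<rightarrow>\<^sub>M G n"
    using G_events by (intro measurableI) (auto simp: Int_absorb2 dest: sets.sets_into_space)
  have S: "?S \<in> P \<rightarrow>\<^sub>M G n \<Otimes>\<^sub>M borel"
    using id by (intro measurable_Pair) auto
  interpret E: prob_space ?E
    by (intro prob_space_exponential_density lam_pos) auto
  interpret GG: prob_space ?G using id by (rule prob_space_distr)
  have "?G \<Otimes>\<^sub>M ?E = distr P (G n \<Otimes>\<^sub>M borel) ?S"
  proof (rule pair_measure_eqI)
    show "sigma_finite_measure ?G" "sigma_finite_measure ?E" by unfold_locales
    show "sets (?G \<Otimes>\<^sub>M ?E) = sets (distr P (G n \<Otimes>\<^sub>M borel) ?S)"
      by (simp cong: sets_pair_measure_cong)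
    fix A B assume "A \<in> sets ?G" "B \<in> sets ?E"
    then have A: "A \<in> sets (G n)" and B: "B \<in> sets borel" by auto
    have A_sp: "A \<subseteq> space P" using sets.sets_into_space[OF A] by simp
    have "emeasure ?G A = emeasure P A"
      using A id A_sp by (subst emeasure_distr) (auto simp: Int_absorb2)
    moreover have "emeasure (distr P (G n \<Otimes>\<^sub>M borel) ?S) (A \<times> B) = emeasure P (?S -` (A \<times> B) \<inter> space P)"
      using A B S by (intro emeasure_distr) auto
    moreover have "?S -` (A \<times> B) \<inter> space P = {\<omega> \<in> A. T (Suc n) \<omega> - T n \<omega> \<in> B}" using A_sp by auto
    ultimately show "emeasure ?G A * emeasure ?E B = emeasure (distr P (G n \<Otimes>\<^sub>M borel) ?S) (A \<times> B)"
      using emeasure_duration[OF A B] by simp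
  qed
  then have "(\<integral>\<^sup>+\<omega>. f (?S \<omega>) \<partial>P) = (\<integral>\<^sup>+x. f x \<partial>(?G \<Otimes>\<^sub>M ?E))"
    using f S by (simp add: nn_integral_distr)
  also have f': "f \<in> borel_measurable (?G \<Otimes>\<^sub>M ?E)"
    using f by (simp cong: measurable_cong_sets sets_pair_measure_cong)
  have "(\<integral>\<^sup>+x. f x \<partial>(?G \<Otimes>\<^sub>M ?E)) = (\<integral>\<^sup>+\<omega>. (\<integral>\<^sup>+s. f (\<omega>, s) \<partial>?E) \<partial>?G)"
    using E.nn_integral_fst[OF f'] by simp
  also have "\<dots> = (\<integral>\<^sup>+\<omega>. (\<integral>\<^sup>+s. f (\<omega>, s) \<partial>?E) \<partial>P)"
    using id E.borel_measurable_nn_integral_fst[OF f'] by (intro nn_integral_distr) auto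
  also have "\<dots> = (\<integral>\<^sup>+\<omega>. (\<integral>\<^sup>+s. ennreal (exponential_density ?l s) * f (\<omega>, s) \<partial>lborel) \<partial>P)"
  proof (intro nn_integral_cong)
    fix \<omega> assume "\<omega> \<in> space P"
    then have "(\<lambda>s. f (\<omega>, s)) \<in> borel_measurable borel"
      using measurable_compose[OF measurable_Pair1' f, of \<omega>] by simp
    then show "(\<integral>\<^sup>+s. f (\<omega>, s) \<partial>?E) = (\<integral>\<^sup>+s. ennreal (exponential_density ?l s) * f (\<omega>, s) \<partial>lborel)"
      by (intro nn_integral_density) auto
  qed
  finally show ?thesis .
qed

lemma measurable_occupation: "k \<le> n \<Longrightarrow> (\<lambda>\<omega>. occupation i (\<lambda>j. T j \<omega>) k) \<in> borel_measurable (G n)"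
proof (induction k)
  case (Suc k)
  then have [measurable]: "(\<lambda>\<omega>. occupation i (\<lambda>j. T j \<omega>) k) \<in> borel_measurable (G n)"
    "T k \<in> borel_measurable (G n)" "T (Suc k) \<in> borel_measurable (G n)"
    using T_measurable_G by auto
  show ?case by simp
qed simp

lemma measurable_switch_level: "k \<le> n \<Longrightarrow> (\<lambda>\<omega>. switch_level \<gamma> (\<lambda>j. T j \<omega>) k) \<in> borel_measurable (G n)"
  unfolding switch_level_def by (intro borel_measurable_add borel_measurable_times measurable_occupation) auto

lemma measurable_stays_nonneg: "Measurable.pred (G n) (\<lambda>\<omega>. stays_nonneg \<gamma> (\<lambda>j. T j \<omega>) n)"
proof -
  have "Measurable.pred (G n) (\<lambda>\<omega>. 0 \<le> switch_level \<gamma> (\<lambda>j. T j \<omega>) k)" if "k \<le> n" for k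
    using measurable_switch_level[OF that] by measurable
  then have "Measurable.pred (G n) (\<lambda>\<omega>. \<forall>k\<in>{..n}. 0 \<le> switch_level \<gamma> (\<lambda>j. T j \<omega>) k)"
    by (intro pred_intros_finite) auto
  moreover have "(\<forall>k\<in>{..n}. Q k) = (\<forall>k\<le>n. Q k)" for Q by auto
  ultimately show ?thesis by (simp only: stays_nonneg_def)
qed

end

section \<open>Volumes of the sets of admissible durations\<close>

text \<open>
  With \<open>2 * k + 1\<close> switchings there are \<open>k + 1\<close> durations in each state, with \<open>2 * k + 2\<close> switchings there is
  one more in state 0; the volumes are those of the durations with sums \<open>a\<close> and \<open>b\<close> along which the level
  stays nonnegative. In \<open>odd_volume\<close> the truncated exponent \<open>k - 1\<close> is harmless at \<open>k = 0\<close> because of the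
  factor \<open>k\<close> in front.
\<close>
definition odd_volume :: "real \<Rightarrow> nat \<Rightarrow> real \<Rightarrow> real \<Rightarrow> real" where
  "odd_volume \<kappa> k a b = (a ^ k * b ^ k - \<kappa> * (real k / (real k + 1)) * (a ^ (k - 1) * b ^ (k + 1))) / (fact k)\<^sup>2"

definition even_volume :: "real \<Rightarrow> nat \<Rightarrow> real \<Rightarrow> real \<Rightarrow> real" where
  "even_volume \<kappa> k a b = (a ^ (k + 1) * b ^ k - \<kappa> * (a ^ k * b ^ (k + 1))) / (fact k * fact (k + 1))"

lemma odd_volume_0 [simp]: "odd_volume \<kappa> 0 a b = 1"
  by (simp add: odd_volume_def)

lemma odd_volume_nonneg:
  assumes "0 \<le> b" "0 < \<kappa>" "\<kappa> * b \<le> a"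
  shows "0 \<le> odd_volume \<kappa> k a b"
proof (cases k)
  case (Suc j)
  have a: "0 \<le> a" using assms by (meson mult_nonneg_nonneg less_imp_le order_trans)
  have "\<kappa> * b * (real k / (real k + 1)) \<le> \<kappa> * b * 1"
    using assms by (intro mult_left_mono) auto
  then have "0 \<le> a - \<kappa> * (real k / (real k + 1)) * b" using assms(3) by (simp add: mult_ac)
  then have "0 \<le> a ^ j * b ^ k * (a - \<kappa> * (real k / (real k + 1)) * b)"
    using a assms by auto
  also have "\<dots> = a ^ k * b ^ k - \<kappa> * (real k / (real k + 1)) * (a ^ (k - 1) * b ^ (k + 1))"
    unfolding Suc by (simp add: algebra_simps)
  finally show ?thesis by (simp add: odd_volume_def)
qed simp

lemma even_volume_nonneg:
  assumes "0 \<le> b" "0 < \<kappa>" "\<kappa> * b \<le> a"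
  shows "0 \<le> even_volume \<kappa> k a b"
proof -
  have a: "0 \<le> a" using assms by (meson mult_nonneg_nonneg less_imp_le order_trans)
  then have "0 \<le> a ^ k * b ^ k * (a - \<kappa> * b)" using assms by auto
  also have "\<dots> = a ^ (k + 1) * b ^ k - \<kappa> * (a ^ k * b ^ (k + 1))" by (simp add: algebra_simps)
  finally show ?thesis by (simp add: even_volume_def)
qed

lemma even_volume_deriv: "((\<lambda>a. even_volume \<kappa> k a b) has_real_derivative odd_volume \<kappa> k a b) (at a)"
proof -
  have p1: "((\<lambda>a. a ^ (k + 1)) has_real_derivative (real k + 1) * a ^ k) (at a)"
    using DERIV_pow[of "k + 1" a] by (simp add: add.commute)
  \<comment> \<open>\<open>DERIV_pow\<close> yields \<open>real k * a ^ (k - 1)\<close>, the same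
    truncated power as in \<open>odd_volume\<close>, so \<open>k = 0\<close> is covered
    uniformly.\<close>
  have "((\<lambda>a. even_volume \<kappa> k a b) has_real_derivative
      ((real k + 1) * a ^ k * b ^ k - \<kappa> * (real k * a ^ (k - 1) * b ^ (k + 1))) / (fact k * fact (k + 1))) (at a)"
    unfolding even_volume_def
    using DERIV_cdivide[OF DERIV_diff[OF DERIV_cmult_right[OF p1] DERIV_cmult[OF DERIV_cmult_right[OF DERIV_pow[of k a]]]]]
    by simp
  also have "((real k + 1) * a ^ k * b ^ k - \<kappa> * (real k * a ^ (k - 1) * b ^ (k + 1))) / (fact k * fact (k + 1))
      = ((real k + 1) * (a ^ k * b ^ k - \<kappa> * (real k / (real k + 1)) * (a ^ (k - 1) * b ^ (k + 1)))) / ((real k + 1) * (fact k)\<^sup>2)"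
    by (rule arg_cong2[where f="(/)"]) (simp_all add: field_simps power2_eq_square)
  also have "\<dots> = odd_volume \<kappa> k a b"
    unfolding odd_volume_def by (rule mult_divide_mult_cancel_left) simp
  finally show ?thesis .
qed

lemma odd_volume_deriv: "((\<lambda>b. odd_volume \<kappa> (Suc k) a b) has_real_derivative even_volume \<kappa> k a b) (at b)"
proof -
  have p1: "((\<lambda>b. b ^ Suc k) has_real_derivative real (Suc k) * b ^ k) (at b)"
    using DERIV_pow[of "Suc k" b] by simp
  have p2: "((\<lambda>b. b ^ (Suc k + 1)) has_real_derivative (real (Suc k) + 1) * b ^ Suc k) (at b)"
    using DERIV_pow[of "Suc k + 1" b] by (simp add: add.commute)
  have "((\<lambda>b. odd_volume \<kappa> (Suc k) a b) has_real_derivative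
      (a ^ Suc k * (real (Suc k) * b ^ k) - \<kappa> * (real (Suc k) / (real (Suc k) + 1)) * (a ^ k * ((real (Suc k) + 1) * b ^ (Suc k)))) / (fact (Suc k))\<^sup>2) (at b)"
    unfolding odd_volume_def diff_Suc_1
    by (rule DERIV_cdivide[OF DERIV_diff[OF DERIV_cmult[OF p1] DERIV_cmult[OF DERIV_cmult[OF p2]]]])
  also have "(a ^ Suc k * (real (Suc k) * b ^ k) - \<kappa> * (real (Suc k) / (real (Suc k) + 1)) * (a ^ k * ((real (Suc k) + 1) * b ^ (Suc k)))) / (fact (Suc k))\<^sup>2
      = (real (Suc k) * (a ^ (k + 1) * b ^ k - \<kappa> * (a ^ k * b ^ (k + 1)))) / (real (Suc k) * (fact k * fact (k + 1)))"
  proof (rule arg_cong2[where f="(/)"])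
    have "real (Suc k) / (real (Suc k) + 1) * (real (Suc k) + 1) = real (Suc k)" by simp
    then have "\<kappa> * (real (Suc k) / (real (Suc k) + 1)) * (a ^ k * ((real (Suc k) + 1) * b ^ (Suc k)))
      = real (Suc k) * (\<kappa> * (a ^ k * b ^ (k + 1)))"
      by (metis (no_types, opaque_lifting) Suc_eq_plus1 mult.assoc mult.left_commute)
    then show "a ^ Suc k * (real (Suc k) * b ^ k) - \<kappa> * (real (Suc k) / (real (Suc k) + 1)) * (a ^ k * ((real (Suc k) + 1) * b ^ (Suc k)))
      = real (Suc k) * (a ^ (k + 1) * b ^ k - \<kappa> * (a ^ k * b ^ (k + 1)))"
      by (simp add: algebra_simps)
    show "(fact (Suc k))\<^sup>2 = real (Suc k) * (fact k * fact (k + 1))"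
      by (simp add: power2_eq_square)
  qed
  also have "\<dots> = even_volume \<kappa> k a b"
    unfolding even_volume_def by (rule mult_divide_mult_cancel_left) simp
  finally show ?thesis .
qed

lemma measurable_volume [measurable]:
  "(\<lambda>x. odd_volume \<kappa> k (f x) (g x)) \<in> borel_measurable M"
  "(\<lambda>x. even_volume \<kappa> k (f x) (g x)) \<in> borel_measurable M"
  if [measurable]: "f \<in> borel_measurable M" "g \<in> borel_measurable M"
  unfolding odd_volume_def even_volume_def by measurable

text \<open>The last duration in state 0 raises the first occupation time from \<open>x\<close> to
  \<open>a\<close> with \<open>b\<close> fixed. Nonnegativity at its start is the lower limit
  \<open>\<kappa> * b\<close>, which is a root of the antiderivative
  \<open>even_volume\<close>.\<close>

lemma nn_integral_odd_volume:
  assumes "0 \<le> b" "0 < \<kappa>" "\<kappa> * b \<le> a"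
  shows "(\<integral>\<^sup>+x. ennreal (odd_volume \<kappa> k x b) * indicator {\<kappa> * b..a} x \<partial>lborel) = ennreal (even_volume \<kappa> k a b)"
proof -
  have "(\<integral>\<^sup>+x. ennreal (odd_volume \<kappa> k x b) * indicator {\<kappa> * b..a} x \<partial>lborel)
     = ennreal (even_volume \<kappa> k a b - even_volume \<kappa> k (\<kappa> * b) b)"
    using assms by (intro nn_integral_FTC_Icc even_volume_deriv odd_volume_nonneg) auto
  also have "even_volume \<kappa> k (\<kappa> * b) b = 0"
    by (simp add: even_volume_def power_mult_distrib)
  finally show ?thesis by simp
qed

text \<open>The last duration in state 1 raises the second occupation time from \<open>y\<close> to
  \<open>b\<close>. A descent is lowest at its end, so \<open>\<kappa> * b \<le> a\<close> implies
  the constraint at every \<open>y\<close> passed, and the antiderivative vanishes at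
  \<open>y = 0\<close>.\<close>

lemma nn_integral_even_volume:
  assumes "0 \<le> b" "0 < \<kappa>" "\<kappa> * b \<le> a"
  shows "(\<integral>\<^sup>+y. ennreal (even_volume \<kappa> k a y) * indicator {0..b} y \<partial>lborel) = ennreal (odd_volume \<kappa> (Suc k) a b)"
proof -
  have "\<kappa> * y \<le> a" if "y \<le> b" for y
    using mult_left_mono[of y b \<kappa>] that assms by linarith
  then have "(\<integral>\<^sup>+y. ennreal (even_volume \<kappa> k a y) * indicator {0..b} y \<partial>lborel)
     = ennreal (odd_volume \<kappa> (Suc k) a b - odd_volume \<kappa> (Suc k) a 0)"
    using assms by (intro nn_integral_FTC_Icc odd_volume_deriv even_volume_nonneg) auto
  also have "odd_volume \<kappa> (Suc k) a 0 = 0"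
    by (simp add: odd_volume_def)
  finally show ?thesis by simp
qed

text \<open>Adding an independent duration convolves densities: the substitution
  \<open>a' = a + s\<close> and Tonelli move the duration from the test function \<open>g\<close> to
  the density \<open>H\<close>.\<close>

lemma nn_integral_shift_swap:
  fixes H e g :: "real \<Rightarrow> ennreal"
  assumes [measurable]: "H \<in> borel_measurable borel" "e \<in> borel_measurable borel" "g \<in> borel_measurable borel"
  shows "(\<integral>\<^sup>+a. H a * (\<integral>\<^sup>+s. e s * g (a + s) \<partial>lborel) \<partial>lborel)
    = (\<integral>\<^sup>+a'. g a' * (\<integral>\<^sup>+a. H a * e (a' - a) \<partial>lborel) \<partial>lborel)"
proof -
  have "(\<integral>\<^sup>+s. e s * g (a + s) \<partial>lborel) = (\<integral>\<^sup>+a'. e (a' - a) * g a' \<partial>lborel)" for a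
    using nn_integral_real_affine[of "\<lambda>s. e s * g (a + s)" 1 "- a"] by simp
  then have "(\<integral>\<^sup>+a. H a * (\<integral>\<^sup>+s. e s * g (a + s) \<partial>lborel) \<partial>lborel)
      = (\<integral>\<^sup>+a. (\<integral>\<^sup>+a'. H a * (e (a' - a) * g a') \<partial>lborel) \<partial>lborel)"
    by (simp add: nn_integral_cmult)
  also have "\<dots> = (\<integral>\<^sup>+a'. (\<integral>\<^sup>+a. H a * (e (a' - a) * g a') \<partial>lborel) \<partial>lborel)"
    by (rule lborel_pair.Fubini') measurable
  also have "\<dots> = (\<integral>\<^sup>+a'. g a' * (\<integral>\<^sup>+a. H a * e (a' - a) \<partial>lborel) \<partial>lborel)"
    by (intro nn_integral_cong, subst nn_integral_cmult[symmetric]) (auto simp: mult_ac)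
  finally show ?thesis .
qed

lemma nn_integral_exponential_tail:
  assumes "0 < l" "0 \<le> c"
  shows "(\<integral>\<^sup>+s. ennreal (exponential_density l s) * indicator {c<..} s \<partial>lborel) = ennreal (exp (- l * c))"
proof -
  let ?E = "density lborel (exponential_density l)"
  interpret E: prob_space ?E using assms(1) by (rule prob_space_exponential_density)
  have "distributed ?E lborel (\<lambda>x. x) (exponential_density l)"
    by (auto simp: distributed_def distr_id2)
  from E.exponential_distributedD_gt[OF this assms(2,1)]
  have "measure ?E {c<..} = exp (- c * l)" by (simp add: greaterThan_def)
  then have "emeasure ?E {c<..} = ennreal (exp (- l * c))"
    by (simp add: E.emeasure_eq_measure mult.commute)
  then show ?thesis by (simp add: emeasure_density)
qed

lemma measurable_fst_snd_borel [measurable]: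
  assumes "f \<in> borel_measurable M"
  shows "(\<lambda>x. fst (f x :: real \<times> real)) \<in> borel_measurable M" "(\<lambda>x. snd (f x :: real \<times> real)) \<in> borel_measurable M"
  using assms unfolding borel_prod[symmetric] by auto

section \<open>Densities at switching times and at a fixed time\<close>

text \<open>\<open>xi0\<close> and \<open>xi1\<close> are the occupation times forced by total time
  \<open>t\<close> and final position \<open>x\<close>; this is the second of the two linear
  equations.\<close>

lemma xi_level:
  assumes "\<gamma> 0 \<noteq> \<gamma> 1"
  shows "\<gamma> 0 * xi0 \<gamma> t x + \<gamma> 1 * xi1 \<gamma> t x = x"
proof -
  have "\<gamma> 0 * xi0 \<gamma> t x + \<gamma> 1 * xi1 \<gamma> t x = (\<gamma> 0 - \<gamma> 1) * xi0 \<gamma> t x + \<gamma> 1 * t"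
    by (simp add: xi1_def algebra_simps)
  also have "\<dots> = x" using assms by (simp add: xi0_def)
  finally show ?thesis .
qed

lemma xi1_eq:
  assumes "\<gamma> 0 \<noteq> \<gamma> 1"
  shows "xi1 \<gamma> t x = (\<gamma> 0 * t - x) / (\<gamma> 0 - \<gamma> 1)"
  using assms by (simp add: xi1_def xi0_def field_simps)

locale telegraph_from_0 = switching_from_0 P \<epsilon> p lam
  for P :: "'a measure" and \<epsilon> p lam +
  fixes \<gamma> :: "nat \<Rightarrow> real"
  assumes \<gamma>0: "0 < \<gamma> 0" and \<gamma>1: "\<gamma> 1 < 0"
begin

definition advance :: "nat \<Rightarrow> real \<times> real \<Rightarrow> real \<Rightarrow> real \<times> real" where
  "advance i z s = (if i = 0 then (fst z + s, snd z) else (fst z, snd z + s))"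

definition level :: "real \<times> real \<Rightarrow> real" where
  "level z = \<gamma> 0 * fst z + \<gamma> 1 * snd z"

definition occs :: "nat \<Rightarrow> 'a \<Rightarrow> real \<times> real" where
  "occs n \<omega> = (occupation 0 (\<lambda>j. T j \<omega>) n, occupation 1 (\<lambda>j. T j \<omega>) n)"

text \<open>The law of the occupation times on the surviving paths, given by its action on test
  functions. This form also covers few switchings, when the law has no planar density.\<close>

definition \<Phi> :: "nat \<Rightarrow> (real \<times> real \<Rightarrow> ennreal) \<Rightarrow> ennreal" where
  "\<Phi> n f = (\<integral>\<^sup>+\<omega>. indicator {\<omega>. stays_nonneg \<gamma> (\<lambda>j. T j \<omega>) n} \<omega> * f (occs n \<omega>) \<partial>P)"

definition \<kappa> :: real where
  "\<kappa> = - \<gamma> 1 / \<gamma> 0"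

lemma \<kappa>_pos: "0 < \<kappa>"
  unfolding \<kappa>_def using \<gamma>0 \<gamma>1 by (intro divide_pos_pos) auto

lemma level_nonneg_iff: "0 \<le> level (a, b) \<longleftrightarrow> \<kappa> * b \<le> a"
proof -
  have "\<kappa> * b \<le> a \<longleftrightarrow> - \<gamma> 1 * b \<le> a * \<gamma> 0"
  proof -
    have "\<kappa> * b = (- \<gamma> 1 * b) / \<gamma> 0" by (simp add: \<kappa>_def)
    then show ?thesis by (simp only: pos_divide_le_eq[OF \<gamma>0])
  qed
  then show ?thesis unfolding level_def by (auto simp: mult.commute)
qed

lemma occs_Suc: "occs (Suc n) \<omega> = advance (n mod 2) (occs n \<omega>) (T (Suc n) \<omega> - T n \<omega>)"
  using mod2_eq_if[of n] by (auto simp: occs_def advance_def)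

lemma switch_level_eq_level: "switch_level \<gamma> (\<lambda>j. T j \<omega>) n = level (occs n \<omega>)"
  by (simp add: switch_level_def level_def occs_def)

lemma measurable_advance [measurable]:
  "f \<in> borel_measurable M \<Longrightarrow> g \<in> borel_measurable M \<Longrightarrow> (\<lambda>x. advance i (f x) (g x)) \<in> borel_measurable M"
  unfolding advance_def by (cases "i = 0") (auto intro!: borel_measurable_Pair simp: borel_prod[symmetric])

lemma measurable_level [measurable]: "f \<in> borel_measurable M \<Longrightarrow> (\<lambda>x. level (f x)) \<in> borel_measurable M"
  unfolding level_def by (auto simp: borel_prod[symmetric])

lemma measurable_occs [measurable]: "occs n \<in> borel_measurable (G n)"
  unfolding occs_def[abs_def] by (intro borel_measurable_Pair measurable_occupation) auto

text \<open>The integrand \<open>f\<close> may depend on the next duration in any measurable way: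
  for the recursion it advances to the next switching, for a fixed time it tests whether the
  duration outlasts that time.\<close>

lemma nn_integral_next:
  assumes f: "(\<lambda>(z, s). f z s) \<in> borel_measurable (borel \<Otimes>\<^sub>M borel)"
  shows "(\<integral>\<^sup>+\<omega>. indicator {\<omega>. stays_nonneg \<gamma> (\<lambda>j. T j \<omega>) n} \<omega> * f (occs n \<omega>) (T (Suc n) \<omega> - T n \<omega>) \<partial>P)
    = \<Phi> n (\<lambda>z. \<integral>\<^sup>+s. ennreal (exponential_density (lam (n mod 2)) s) * f z s \<partial>lborel)"
proof -
  let ?I = "indicator {\<omega>. stays_nonneg \<gamma> (\<lambda>j. T j \<omega>) n} :: 'a \<Rightarrow> ennreal"
  have [measurable]: "?I \<in> borel_measurable (G n)"
  proof -
    have [measurable]: "Measurable.pred (G n) (\<lambda>\<omega>. stays_nonneg \<gamma> (\<lambda>j. T j \<omega>) n)"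
      by (rule measurable_stays_nonneg)
    have "?I = (\<lambda>\<omega>. if stays_nonneg \<gamma> (\<lambda>j. T j \<omega>) n then 1 else 0)"
      by (auto simp: indicator_def)
    then show ?thesis by simp
  qed
  have [measurable]: "(\<lambda>x. f (occs n (fst x)) (snd x)) \<in> borel_measurable (G n \<Otimes>\<^sub>M borel)"
    using measurable_compose[OF _ f, of "\<lambda>x. (occs n (fst x), snd x)" "G n \<Otimes>\<^sub>M borel"] by simp
  have "(\<integral>\<^sup>+\<omega>. ?I \<omega> * f (occs n \<omega>) (T (Suc n) \<omega> - T n \<omega>) \<partial>P)
    = (\<integral>\<^sup>+\<omega>. (\<integral>\<^sup>+s. ennreal (exponential_density (lam (n mod 2)) s) * (?I \<omega> * f (occs n \<omega>) s) \<partial>lborel) \<partial>P)"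
    using nn_integral_duration[of "\<lambda>x. ?I (fst x) * f (occs n (fst x)) (snd x)" n] by simp
  also have "\<dots> = (\<integral>\<^sup>+\<omega>. ?I \<omega> * (\<integral>\<^sup>+s. ennreal (exponential_density (lam (n mod 2)) s) * f (occs n \<omega>) s \<partial>lborel) \<partial>P)"
  proof (intro nn_integral_cong)
    fix \<omega>
    have "(\<lambda>s. f (occs n \<omega>) s) \<in> borel_measurable borel"
      using measurable_compose[OF measurable_Pair1' f, of "occs n \<omega>"] by simp
    then show "(\<integral>\<^sup>+s. ennreal (exponential_density (lam (n mod 2)) s) * (?I \<omega> * f (occs n \<omega>) s) \<partial>lborel)
      = ?I \<omega> * (\<integral>\<^sup>+s. ennreal (exponential_density (lam (n mod 2)) s) * f (occs n \<omega>) s \<partial>lborel)"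
      by (subst nn_integral_cmult[symmetric]) (auto simp: mult_ac)
  qed
  finally show ?thesis by (simp add: \<Phi>_def)
qed

lemma \<Phi>_Suc:
  assumes [measurable]: "f \<in> borel_measurable borel"
  shows "\<Phi> (Suc n) f = \<Phi> n (\<lambda>z. \<integral>\<^sup>+s. ennreal (exponential_density (lam (n mod 2)) s)
    * (indicator {0..} (level (advance (n mod 2) z s)) * f (advance (n mod 2) z s)) \<partial>lborel)"
proof -
  have "\<Phi> (Suc n) f = (\<integral>\<^sup>+\<omega>. indicator {\<omega>. stays_nonneg \<gamma> (\<lambda>j. T j \<omega>) n} \<omega> *
    (indicator {0..} (level (advance (n mod 2) (occs n \<omega>) (T (Suc n) \<omega> - T n \<omega>)))
      * f (advance (n mod 2) (occs n \<omega>) (T (Suc n) \<omega> - T n \<omega>))) \<partial>P)"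
    unfolding \<Phi>_def by (intro nn_integral_cong) (simp add: stays_nonneg_Suc switch_level_eq_level occs_Suc indicator_def)
  also have "\<dots> = \<Phi> n (\<lambda>z. \<integral>\<^sup>+s. ennreal (exponential_density (lam (n mod 2)) s)
    * (indicator {0..} (level (advance (n mod 2) z s)) * f (advance (n mod 2) z s)) \<partial>lborel)"
    by (rule nn_integral_next) measurable
  finally show ?thesis .
qed

lemma measurable_next:
  assumes [measurable]: "f \<in> borel_measurable borel"
  shows "(\<lambda>z. \<integral>\<^sup>+s. ennreal (exponential_density l s)
    * (indicator {0..} (level (advance i z s)) * f (advance i z s)) \<partial>lborel) \<in> borel_measurable borel"
  by measurable

lemma \<Phi>_0: "\<Phi> 0 f = f (0, 0)"
  by (simp add: \<Phi>_def occs_def emeasure_space_1)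

text \<open>The density belonging to a fixed time with \<open>2 * k + 1\<close> switchings so far.
  At the following switching time it acquires the factor \<open>lam 1\<close>, the rate of that
  switching; \<open>even_density\<close> likewise acquires \<open>lam 0\<close>.\<close>

definition odd_density :: "nat \<Rightarrow> real \<Rightarrow> real \<Rightarrow> real" where
  "odd_density k a b = lam 0 * (lam 0 * lam 1) ^ k * exp (- lam 0 * a - lam 1 * b) * odd_volume \<kappa> k a b"

definition even_density :: "nat \<Rightarrow> real \<Rightarrow> real \<Rightarrow> real" where
  "even_density k a b = (lam 0 * lam 1) ^ (k + 1) * exp (- lam 0 * a - lam 1 * b) * even_volume \<kappa> k a b"

definition region :: "real \<Rightarrow> real \<Rightarrow> ennreal" where
  "region a b = indicator {0..} b * indicator {\<kappa> * b..} a"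

lemma lam_0: "0 < lam 0" and lam_1: "0 < lam 1"
  using lam_pos by auto

lemma measurable_densities [measurable]:
  "(\<lambda>x. odd_density k (f x) (g x)) \<in> borel_measurable M"
  "(\<lambda>x. even_density k (f x) (g x)) \<in> borel_measurable M"
  "(\<lambda>x. region (f x) (g x)) \<in> borel_measurable M"
  if [measurable]: "f \<in> borel_measurable M" "g \<in> borel_measurable M"
proof -
  have "region (f x) (g x) = (if 0 \<le> g x \<and> \<kappa> * g x \<le> f x then 1 else 0)" for x
    by (auto simp: region_def)
  then show "(\<lambda>x. region (f x) (g x)) \<in> borel_measurable M" by simp
qed (auto simp: odd_density_def even_density_def)

text \<open>The exponential factors of the past and of the new duration multiply to one that does
  not depend on the split point \<open>a\<close>, leaving the volume integral. If \<open>a'\<close>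
  is below \<open>\<kappa> * b\<close>, no ascent from a nonnegative level can end there and both
  sides vanish.\<close>

lemma nn_integral_odd_density:
  "(\<integral>\<^sup>+a. ennreal (lam 1 * odd_density k a b) * region a b * ennreal (exponential_density (lam 0) (a' - a)) \<partial>lborel)
    = ennreal (lam 0 * even_density k a' b) * region a' b"
proof (cases "0 \<le> b \<and> \<kappa> * b \<le> a'")
  case True
  let ?c = "lam 0 * ((lam 0 * lam 1) ^ (k + 1) * exp (- lam 0 * a' - lam 1 * b))"
  have c: "0 \<le> ?c" using lam_0 lam_1 by simp
  have "ennreal (lam 1 * odd_density k a b) * region a b * ennreal (exponential_density (lam 0) (a' - a))
     = ennreal ?c * (ennreal (odd_volume \<kappa> k a b) * indicator {\<kappa> * b..a'} a)" for a
  proof (cases "\<kappa> * b \<le> a \<and> a \<le> a'")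
    case in_range: True
    have vol: "0 \<le> odd_volume \<kappa> k a b" using True in_range by (intro odd_volume_nonneg \<kappa>_pos) auto
    have "exp (- lam 0 * a - lam 1 * b) * exp (- (a' - a) * lam 0) = exp (- lam 0 * a' - lam 1 * b)"
      by (simp add: exp_add[symmetric] algebra_simps)
    then have "lam 1 * odd_density k a b * (lam 0 * exp (- (a' - a) * lam 0)) = ?c * odd_volume \<kappa> k a b"
      by (simp add: odd_density_def mult_ac)
    moreover have "0 \<le> lam 1 * odd_density k a b"
      using vol lam_0 lam_1 by (simp add: odd_density_def)
    ultimately show ?thesis
      using in_range True lam_0 c vol
      by (simp add: region_def exponential_density_def ennreal_mult[symmetric])
  next
    case False
    then show ?thesis using True by (auto simp: region_def exponential_density_def)
  qed
  then have "(\<integral>\<^sup>+a. ennreal (lam 1 * odd_density k a b) * region a b * ennreal (exponential_density (lam 0) (a' - a)) \<partial>lborel)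
    = ennreal ?c * (\<integral>\<^sup>+a. ennreal (odd_volume \<kappa> k a b) * indicator {\<kappa> * b..a'} a \<partial>lborel)"
    by (simp add: nn_integral_cmult)
  also have "\<dots> = ennreal ?c * ennreal (even_volume \<kappa> k a' b)"
    using True by (subst nn_integral_odd_volume) (auto simp: \<kappa>_pos)
  also have "\<dots> = ennreal (lam 0 * even_density k a' b) * region a' b"
    using True c even_volume_nonneg[OF _ \<kappa>_pos, of b a' k]
    by (simp add: region_def even_density_def ennreal_mult[symmetric] mult_ac)
  finally show ?thesis .
next
  case False
  then have zero: "ennreal (lam 1 * odd_density k a b) * region a b * ennreal (exponential_density (lam 0) (a' - a)) = 0" for a
    by (auto simp: region_def exponential_density_def indicator_def)
  show ?thesis unfolding zero using False by (auto simp: region_def)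
qed

text \<open>A descent may start at a nonnegative level and end below zero, in which case the left
  side need not vanish; the hypothesis restricts to admissible ends.\<close>

lemma nn_integral_even_density:
  assumes "\<kappa> * b' \<le> a"
  shows "(\<integral>\<^sup>+b. ennreal (lam 0 * even_density k a b) * region a b * ennreal (exponential_density (lam 1) (b' - b)) \<partial>lborel)
    = ennreal (lam 1 * odd_density (Suc k) a b') * region a b'"
proof (cases "0 \<le> b'")
  case True
  let ?c = "lam 1 * (lam 0 * (lam 0 * lam 1) ^ (k + 1) * exp (- lam 0 * a - lam 1 * b'))"
  have c: "0 \<le> ?c" using lam_0 lam_1 by simp
  have "ennreal (lam 0 * even_density k a b) * region a b * ennreal (exponential_density (lam 1) (b' - b))
     = ennreal ?c * (ennreal (even_volume \<kappa> k a b) * indicator {0..b'} b)" for b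
  proof (cases "0 \<le> b \<and> b \<le> b'")
    case in_range: True
    have le: "\<kappa> * b \<le> a"
      using mult_left_mono[of b b' \<kappa>] in_range assms \<kappa>_pos by linarith
    then have vol: "0 \<le> even_volume \<kappa> k a b" using in_range by (intro even_volume_nonneg \<kappa>_pos) auto
    have "exp (- lam 0 * a - lam 1 * b) * exp (- (b' - b) * lam 1) = exp (- lam 0 * a - lam 1 * b')"
      by (simp add: exp_add[symmetric] algebra_simps)
    then have "lam 0 * even_density k a b * (lam 1 * exp (- (b' - b) * lam 1)) = ?c * even_volume \<kappa> k a b"
      by (simp add: even_density_def mult_ac)
    moreover have "0 \<le> lam 0 * even_density k a b"
      using vol lam_0 lam_1 by (simp add: even_density_def)
    ultimately show ?thesis
      using in_range le lam_1 c vol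
      by (simp add: region_def exponential_density_def ennreal_mult[symmetric])
  next
    case False
    then show ?thesis by (auto simp: region_def exponential_density_def)
  qed
  then have "(\<integral>\<^sup>+b. ennreal (lam 0 * even_density k a b) * region a b * ennreal (exponential_density (lam 1) (b' - b)) \<partial>lborel)
    = ennreal ?c * (\<integral>\<^sup>+b. ennreal (even_volume \<kappa> k a b) * indicator {0..b'} b \<partial>lborel)"
    by (simp add: nn_integral_cmult)
  also have "\<dots> = ennreal ?c * ennreal (odd_volume \<kappa> (Suc k) a b')"
    using True assms by (subst nn_integral_even_volume) (auto simp: \<kappa>_pos)
  also have "\<dots> = ennreal (lam 1 * odd_density (Suc k) a b') * region a b'"
    using True assms c odd_volume_nonneg[OF _ \<kappa>_pos, of b' a "Suc k"]
    by (simp add: region_def odd_density_def ennreal_mult[symmetric] mult_ac)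
  finally show ?thesis .
next
  case False
  then have zero: "ennreal (lam 0 * even_density k a b) * region a b * ennreal (exponential_density (lam 1) (b' - b)) = 0" for b
    by (auto simp: region_def exponential_density_def indicator_def)
  show ?thesis unfolding zero using False by (auto simp: region_def)
qed

lemma \<Phi>_1:
  assumes [measurable]: "f \<in> borel_measurable borel"
  shows "\<Phi> 1 f = (\<integral>\<^sup>+s. ennreal (exponential_density (lam 0) s) * f (s, 0) \<partial>lborel)"
proof -
  have "\<Phi> 1 f = (\<integral>\<^sup>+s. ennreal (exponential_density (lam 0) s) *
      (indicator {0..} (level (s, 0)) * f (s, 0)) \<partial>lborel)"
    using \<Phi>_Suc[OF assms, of 0] by (simp add: \<Phi>_0 advance_def)
  also have "\<dots> = (\<integral>\<^sup>+s. ennreal (exponential_density (lam 0) s) * f (s, 0) \<partial>lborel)"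
    by (intro nn_integral_cong)
      (auto simp: exponential_density_def indicator_def level_nonneg_iff)
  finally show ?thesis .
qed

lemma exponential_density_product:
  assumes "0 \<le> a" "0 \<le> b"
  shows "ennreal (exponential_density (lam 0) a) * ennreal (exponential_density (lam 1) b)
    = ennreal (lam 1 * odd_density 0 a b)"
proof -
  have "lam 0 * exp (- a * lam 0) * (lam 1 * exp (- b * lam 1)) = lam 1 * odd_density 0 a b"
    by (simp add: odd_density_def exp_diff exp_minus field_simps)
  moreover have "ennreal (exponential_density (lam 0) a) * ennreal (exponential_density (lam 1) b)
      = ennreal (lam 0 * exp (- a * lam 0) * (lam 1 * exp (- b * lam 1)))"
    using assms lam_0 lam_1 by (simp add: exponential_density_def ennreal_mult[symmetric])
  ultimately show ?thesis by (simp only:)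
qed

text \<open>The start of the induction: after one duration in each state the law of
  \<open>(a, b)\<close> has a planar density, a product of exponentials cut to the region.\<close>

lemma \<Phi>_2:
  assumes [measurable]: "f \<in> borel_measurable borel"
  shows "\<Phi> 2 f = (\<integral>\<^sup>+a. (\<integral>\<^sup>+b. f (a, b) * (ennreal (lam 1 * odd_density 0 a b) * region a b) \<partial>lborel) \<partial>lborel)"
proof -
  have "\<Phi> 2 f = \<Phi> 1 (\<lambda>z. \<integral>\<^sup>+s. ennreal (exponential_density (lam 1) s)
      * (indicator {0..} (level (advance 1 z s)) * f (advance 1 z s)) \<partial>lborel)"
    using \<Phi>_Suc[OF assms, of 1] by (simp add: numeral_2_eq_2)
  also have "\<dots> = (\<integral>\<^sup>+a. ennreal (exponential_density (lam 0) a) * (\<integral>\<^sup>+b. ennreal (exponential_density (lam 1) b)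
      * (indicator {0..} (level (a, b)) * f (a, b)) \<partial>lborel) \<partial>lborel)"
    by (subst \<Phi>_1[OF measurable_next[OF assms]]) (simp add: advance_def)
  also have "\<dots> = (\<integral>\<^sup>+a. (\<integral>\<^sup>+b. f (a, b) * (ennreal (lam 1 * odd_density 0 a b) * region a b) \<partial>lborel) \<partial>lborel)"
  proof (intro nn_integral_cong)
    fix a
    have "ennreal (exponential_density (lam 0) a) * (ennreal (exponential_density (lam 1) b) * (indicator {0..} (level (a, b)) * f (a, b)))
       = f (a, b) * (ennreal (lam 1 * odd_density 0 a b) * region a b)" for b
    proof (cases "0 \<le> b \<and> \<kappa> * b \<le> a")
      case True
      then have "0 \<le> a" using \<kappa>_pos by (meson mult_nonneg_nonneg less_imp_le order_trans)
      have "ennreal (exponential_density (lam 0) a) * ennreal (exponential_density (lam 1) b) = ennreal (lam 1 * odd_density 0 a b)"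
        using True \<open>0 \<le> a\<close> by (intro exponential_density_product) auto
      then show ?thesis
        using True by (simp add: region_def level_nonneg_iff mult_ac)
    next
      case False
      then show ?thesis by (auto simp: region_def level_nonneg_iff exponential_density_def indicator_def)
    qed
    moreover have "(\<lambda>b. f (a, b)) \<in> borel_measurable borel"
      by measurable
    ultimately show "ennreal (exponential_density (lam 0) a) * (\<integral>\<^sup>+b. ennreal (exponential_density (lam 1) b)
      * (indicator {0..} (level (a, b)) * f (a, b)) \<partial>lborel)
      = (\<integral>\<^sup>+b. f (a, b) * (ennreal (lam 1 * odd_density 0 a b) * region a b) \<partial>lborel)"
      by (subst nn_integral_cmult[symmetric]) auto
  qed
  finally show ?thesis .
qed

lemma indicator_level: "indicator {0..} (level (a, b)) * region a b = region a b"
  by (simp add: region_def indicator_def level_nonneg_iff)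

lemma nn_integral_swap:
  fixes f :: "real \<Rightarrow> real \<Rightarrow> ennreal"
  assumes [measurable]: "case_prod f \<in> borel_measurable (borel \<Otimes>\<^sub>M borel)"
  shows "(\<integral>\<^sup>+a. (\<integral>\<^sup>+b. f a b \<partial>lborel) \<partial>lborel) = (\<integral>\<^sup>+b. (\<integral>\<^sup>+a. f a b \<partial>lborel) \<partial>lborel)"
  by (rule lborel_pair.Fubini'[symmetric]) measurable

lemma \<Phi>_even_step:
  assumes \<Phi>: "\<And>f. f \<in> borel_measurable borel \<Longrightarrow> \<Phi> n f =
      (\<integral>\<^sup>+a. (\<integral>\<^sup>+b. f (a, b) * (ennreal (lam 1 * odd_density k a b) * region a b) \<partial>lborel) \<partial>lborel)"
    and n: "even n" and f[measurable]: "f \<in> borel_measurable borel"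
  shows "\<Phi> (Suc n) f =
      (\<integral>\<^sup>+a. (\<integral>\<^sup>+b. f (a, b) * (ennreal (lam 0 * even_density k a b) * region a b) \<partial>lborel) \<partial>lborel)"
proof -
  let ?W = "\<lambda>a b. ennreal (lam 1 * odd_density k a b) * region a b"
  let ?e = "\<lambda>s. ennreal (exponential_density (lam 0) s)"
  let ?g = "\<lambda>a b. indicator {0..} (level (a, b)) * f (a, b)"
  have n0: "n mod 2 = 0" using n by presburger
  have "\<Phi> (Suc n) f = (\<integral>\<^sup>+a. (\<integral>\<^sup>+b. (\<integral>\<^sup>+s. ?e s * ?g (a + s) b \<partial>lborel) * ?W a b \<partial>lborel) \<partial>lborel)"
    unfolding \<Phi>_Suc[OF f] \<Phi>[OF measurable_next[OF f]] n0 by (simp add: advance_def)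
  also have "\<dots> = (\<integral>\<^sup>+b. (\<integral>\<^sup>+a. (\<integral>\<^sup>+s. ?e s * ?g (a + s) b \<partial>lborel) * ?W a b \<partial>lborel) \<partial>lborel)"
    \<comment> \<open>The new duration is spent in state 0 and adds to \<open>a\<close>, so the
      integral over \<open>a\<close> has to be the inner one before convolving.\<close>
    by (rule nn_integral_swap) measurable
  also have "\<dots> = (\<integral>\<^sup>+b. (\<integral>\<^sup>+a. f (a, b) * (ennreal (lam 0 * even_density k a b) * region a b) \<partial>lborel) \<partial>lborel)"
  proof (rule nn_integral_cong)
    fix b
    have "(\<integral>\<^sup>+a. (\<integral>\<^sup>+s. ?e s * ?g (a + s) b \<partial>lborel) * ?W a b \<partial>lborel)
      = (\<integral>\<^sup>+a'. ?g a' b * (\<integral>\<^sup>+a. ?W a b * ?e (a' - a) \<partial>lborel) \<partial>lborel)"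
      by (subst nn_integral_shift_swap[symmetric]) (auto simp: mult.commute)
    also have "\<dots> = (\<integral>\<^sup>+a. f (a, b) * (ennreal (lam 0 * even_density k a b) * region a b) \<partial>lborel)"
      unfolding nn_integral_odd_density
      by (intro nn_integral_cong) (subst (2) indicator_level[symmetric], simp add: mult_ac)
    finally show "(\<integral>\<^sup>+a. (\<integral>\<^sup>+s. ?e s * ?g (a + s) b \<partial>lborel) * ?W a b \<partial>lborel)
      = (\<integral>\<^sup>+a. f (a, b) * (ennreal (lam 0 * even_density k a b) * region a b) \<partial>lborel)" .
  qed
  also have "\<dots> = (\<integral>\<^sup>+a. (\<integral>\<^sup>+b. f (a, b) * (ennreal (lam 0 * even_density k a b) * region a b) \<partial>lborel) \<partial>lborel)"
    by (rule nn_integral_swap[symmetric]) measurable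
  finally show ?thesis .
qed

lemma \<Phi>_odd_step:
  assumes \<Phi>: "\<And>f. f \<in> borel_measurable borel \<Longrightarrow> \<Phi> n f =
      (\<integral>\<^sup>+a. (\<integral>\<^sup>+b. f (a, b) * (ennreal (lam 0 * even_density k a b) * region a b) \<partial>lborel) \<partial>lborel)"
    and n: "odd n" and f[measurable]: "f \<in> borel_measurable borel"
  shows "\<Phi> (Suc n) f =
      (\<integral>\<^sup>+a. (\<integral>\<^sup>+b. f (a, b) * (ennreal (lam 1 * odd_density (Suc k) a b) * region a b) \<partial>lborel) \<partial>lborel)"
proof -
  let ?W = "\<lambda>a b. ennreal (lam 0 * even_density k a b) * region a b"
  let ?e = "\<lambda>s. ennreal (exponential_density (lam 1) s)"
  let ?g = "\<lambda>a b. indicator {0..} (level (a, b)) * f (a, b)"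
  have n1: "n mod 2 = 1" using n by presburger
  have "\<Phi> (Suc n) f = (\<integral>\<^sup>+a. (\<integral>\<^sup>+b. (\<integral>\<^sup>+s. ?e s * ?g a (b + s) \<partial>lborel) * ?W a b \<partial>lborel) \<partial>lborel)"
    unfolding \<Phi>_Suc[OF f] \<Phi>[OF measurable_next[OF f]] n1 by (simp add: advance_def)
  also have "\<dots> = (\<integral>\<^sup>+a. (\<integral>\<^sup>+b. f (a, b) * (ennreal (lam 1 * odd_density (Suc k) a b) * region a b) \<partial>lborel) \<partial>lborel)"
  proof (rule nn_integral_cong)
    fix a
    have "(\<integral>\<^sup>+b. (\<integral>\<^sup>+s. ?e s * ?g a (b + s) \<partial>lborel) * ?W a b \<partial>lborel)
      = (\<integral>\<^sup>+b'. ?g a b' * (\<integral>\<^sup>+b. ?W a b * ?e (b' - b) \<partial>lborel) \<partial>lborel)"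
      by (subst nn_integral_shift_swap[symmetric]) (auto simp: mult.commute)
    also have "\<dots> = (\<integral>\<^sup>+b. f (a, b) * (ennreal (lam 1 * odd_density (Suc k) a b) * region a b) \<partial>lborel)"
    proof (rule nn_integral_cong)
      fix b'
      show "?g a b' * (\<integral>\<^sup>+b. ?W a b * ?e (b' - b) \<partial>lborel) = f (a, b') * (ennreal (lam 1 * odd_density (Suc k) a b') * region a b')"
      proof (cases "\<kappa> * b' \<le> a")
        case True
        then show ?thesis
          unfolding nn_integral_even_density[OF True] by (simp add: level_nonneg_iff)
      qed (simp add: level_nonneg_iff region_def)
    qed
    finally show "(\<integral>\<^sup>+b. (\<integral>\<^sup>+s. ?e s * ?g a (b + s) \<partial>lborel) * ?W a b \<partial>lborel)
      = (\<integral>\<^sup>+b. f (a, b) * (ennreal (lam 1 * odd_density (Suc k) a b) * region a b) \<partial>lborel)" .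
  qed
  finally show ?thesis .
qed

lemma \<Phi>_density:
  assumes "f \<in> borel_measurable borel"
  shows "\<Phi> (2 * k + 2) f =
      (\<integral>\<^sup>+a. (\<integral>\<^sup>+b. f (a, b) * (ennreal (lam 1 * odd_density k a b) * region a b) \<partial>lborel) \<partial>lborel)"
    and "\<Phi> (2 * k + 3) f =
      (\<integral>\<^sup>+a. (\<integral>\<^sup>+b. f (a, b) * (ennreal (lam 0 * even_density k a b) * region a b) \<partial>lborel) \<partial>lborel)"
proof -
  have "\<forall>f \<in> borel_measurable borel. \<Phi> (2 * k + 2) f =
      (\<integral>\<^sup>+a. (\<integral>\<^sup>+b. f (a, b) * (ennreal (lam 1 * odd_density k a b) * region a b) \<partial>lborel) \<partial>lborel)"
  proof (induction k)
    case 0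
    show ?case unfolding mult_0_right add_0 using \<Phi>_2 by blast
  next
    case (Suc k)
    have "\<Phi> (Suc (2 * k + 2)) f =
      (\<integral>\<^sup>+a. (\<integral>\<^sup>+b. f (a, b) * (ennreal (lam 0 * even_density k a b) * region a b) \<partial>lborel) \<partial>lborel)"
      if "f \<in> borel_measurable borel" for f
      using Suc that by (intro \<Phi>_even_step) auto
    then have "\<Phi> (Suc (Suc (2 * k + 2))) f =
      (\<integral>\<^sup>+a. (\<integral>\<^sup>+b. f (a, b) * (ennreal (lam 1 * odd_density (Suc k) a b) * region a b) \<partial>lborel) \<partial>lborel)"
      if "f \<in> borel_measurable borel" for f
      using that by (intro \<Phi>_odd_step) auto
    moreover have "Suc (Suc (2 * k + 2)) = 2 * Suc k + 2" by simp
    ultimately show ?case by (metis (no_types, lifting))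
  qed
  then have *: "\<Phi> (2 * k + 2) f =
      (\<integral>\<^sup>+a. (\<integral>\<^sup>+b. f (a, b) * (ennreal (lam 1 * odd_density k a b) * region a b) \<partial>lborel) \<partial>lborel)"
    if "f \<in> borel_measurable borel" for f using that by blast
  from *[OF assms] show "\<Phi> (2 * k + 2) f =
      (\<integral>\<^sup>+a. (\<integral>\<^sup>+b. f (a, b) * (ennreal (lam 1 * odd_density k a b) * region a b) \<partial>lborel) \<partial>lborel)" .
  have "\<Phi> (Suc (2 * k + 2)) f =
      (\<integral>\<^sup>+a. (\<integral>\<^sup>+b. f (a, b) * (ennreal (lam 0 * even_density k a b) * region a b) \<partial>lborel) \<partial>lborel)"
    using * by (intro \<Phi>_even_step assms) auto
  moreover have "Suc (2 * k + 2) = 2 * k + 3" by simp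
  ultimately show "\<Phi> (2 * k + 3) f =
      (\<integral>\<^sup>+a. (\<integral>\<^sup>+b. f (a, b) * (ennreal (lam 0 * even_density k a b) * region a b) \<partial>lborel) \<partial>lborel)"
    by (simp only:)
qed

section \<open>The law at a fixed time\<close>

lemma level_advance: "i \<in> {0, 1} \<Longrightarrow> level (advance i z s) = level z + \<gamma> i * s"
  by (auto simp: level_def advance_def algebra_simps)

lemma occs_sum: "\<omega> \<in> space P \<Longrightarrow> fst (occs n \<omega>) + snd (occs n \<omega>) = T n \<omega>"
proof -
  assume "\<omega> \<in> space P"
  then interpret w: binary_path_0 "\<lambda>u. \<epsilon> u \<omega>" using path by blast
  show ?thesis using occupation_sum[of "\<lambda>j. T j \<omega>" n] by (simp add: occs_def)
qed

lemma switchings_eq: "\<omega> \<in> space P \<Longrightarrow> switchings \<epsilon> t \<omega> = N t \<omega>"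
proof -
  assume "\<omega> \<in> space P"
  then interpret w: binary_path_0 "\<lambda>u. \<epsilon> u \<omega>" using path by blast
  show ?thesis by (simp add: switchings_def w.N_def w.jumps_def conj_assoc)
qed

definition position :: "nat \<Rightarrow> real \<Rightarrow> 'a \<Rightarrow> real" where
  "position n t \<omega> = level (advance (n mod 2) (occs n \<omega>) (t - T n \<omega>))"

text \<open>A final position in \<open>B\<close> is positive, so it already contains the constraint
  at time \<open>t\<close>; what remains concerns the switching times only.\<close>

lemma event_iff:
  assumes \<omega>: "\<omega> \<in> space P" and t: "0 \<le> t" and B: "B \<subseteq> {0<..}"
  shows "telegraph \<gamma> \<epsilon> t \<omega> \<in> B \<and> running_min \<gamma> \<epsilon> t \<omega> = 0 \<and> switchings \<epsilon> t \<omega> = n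
    \<longleftrightarrow> N t \<omega> = n \<and> stays_nonneg \<gamma> (\<lambda>j. T j \<omega>) n \<and> position n t \<omega> \<in> B"
proof -
  interpret w: binary_path_0 "\<lambda>u. \<epsilon> u \<omega>" using path[OF \<omega>] .
  have tel: "telegraph \<gamma> \<epsilon> t \<omega> = position (N t \<omega>) t \<omega>"
    unfolding telegraph_def w.\<Gamma>_end[OF t, of \<gamma>] position_def
    by (subst level_advance) (auto simp: switch_level_eq_level[symmetric])
  have rm: "running_min \<gamma> \<epsilon> t \<omega> = 0 \<longleftrightarrow> stays_nonneg \<gamma> (\<lambda>j. T j \<omega>) (N t \<omega>) \<and> 0 \<le> telegraph \<gamma> \<epsilon> t \<omega>"
    unfolding running_min_def telegraph_def using w.INF_\<Gamma>_eq_0_iff[OF t, of \<gamma>] by simp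
  have nonneg: "position n t \<omega> \<in> B \<longrightarrow> 0 \<le> position n t \<omega>"
    using subsetD[OF B, of "position n t \<omega>"] by (auto intro: less_imp_le)
  show ?thesis
  proof (cases "N t \<omega> = n")
    case True
    show ?thesis
      unfolding switchings_eq[OF \<omega>] rm tel True using nonneg by blast
  next
    case False
    then show ?thesis by (simp add: switchings_eq[OF \<omega>])
  qed
qed

lemma measurable_occs_P [measurable]: "occs n \<in> borel_measurable P"
  by (rule measurable_G_P[OF measurable_occs])

lemma measurable_position [measurable]: "position n t \<in> borel_measurable P"
  unfolding position_def[abs_def] by measurable

lemma event_measurable:
  assumes "B \<in> sets borel" "0 \<le> t"
  shows "{\<omega> \<in> space P. N t \<omega> = n \<and> stays_nonneg \<gamma> (\<lambda>j. T j \<omega>) n \<and> position n t \<omega> \<in> B} \<in> events"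
proof -
  have [measurable]: "Measurable.pred P (\<lambda>\<omega>. stays_nonneg \<gamma> (\<lambda>j. T j \<omega>) n)"
    by (rule measurable_G_P[OF measurable_stays_nonneg])
  have "{\<omega> \<in> space P. N t \<omega> = n} \<in> events"
    by (rule subsetD[OF F_events N_eq_in_F[OF assms(2)]])
  moreover have "{\<omega> \<in> space P. stays_nonneg \<gamma> (\<lambda>j. T j \<omega>) n \<and> position n t \<omega> \<in> B} \<in> events"
    using assms by measurable
  moreover have "{\<omega> \<in> space P. N t \<omega> = n \<and> stays_nonneg \<gamma> (\<lambda>j. T j \<omega>) n \<and> position n t \<omega> \<in> B}
    = {\<omega> \<in> space P. N t \<omega> = n} \<inter> {\<omega> \<in> space P. stays_nonneg \<gamma> (\<lambda>j. T j \<omega>) n \<and> position n t \<omega> \<in> B}" by auto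
  ultimately show ?thesis by (simp only: sets.Int)
qed

text \<open>The count at \<open>t\<close> is \<open>n\<close> iff the duration begun at
  \<open>T n\<close> exceeds the remaining time r, which has probability exp(- l r). Multiplied by
  the rate l, this is the exponential density at r, so the cut-off duration behaves like one
  completed at \<open>t\<close>.\<close>

lemma emeasure_event:
  assumes B[measurable]: "B \<in> sets borel" and t: "0 \<le> t"
  shows "ennreal (lam (n mod 2)) * emeasure P {\<omega> \<in> space P. N t \<omega> = n \<and> stays_nonneg \<gamma> (\<lambda>j. T j \<omega>) n \<and> position n t \<omega> \<in> B}
    = \<Phi> n (\<lambda>z. ennreal (exponential_density (lam (n mod 2)) (t - (fst z + snd z)))
        * indicator B (level (advance (n mod 2) z (t - (fst z + snd z)))))"
proof -
  let ?l = "lam (n mod 2)"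
  let ?E = "{\<omega> \<in> space P. N t \<omega> = n \<and> stays_nonneg \<gamma> (\<lambda>j. T j \<omega>) n \<and> position n t \<omega> \<in> B}"
  let ?B = "\<lambda>z. indicator B (level (advance (n mod 2) z (t - (fst z + snd z)))) :: ennreal"
  define f :: "real \<times> real \<Rightarrow> real \<Rightarrow> ennreal"
    where "f z s = (if fst z + snd z \<le> t \<and> t < fst z + snd z + s then ?B z else 0)" for z s
  have l: "0 < ?l" by (rule lam_pos) auto
  have f_meas: "(\<lambda>(z, s). f z s) \<in> borel_measurable (borel \<Otimes>\<^sub>M borel)"
    unfolding f_def by measurable
  have "emeasure P ?E = (\<integral>\<^sup>+\<omega>. indicator ?E \<omega> \<partial>P)"
    by (rule nn_integral_indicator[OF event_measurable[OF B t], symmetric])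
  also have "\<dots> = (\<integral>\<^sup>+\<omega>. indicator {\<omega>. stays_nonneg \<gamma> (\<lambda>j. T j \<omega>) n} \<omega> * f (occs n \<omega>) (T (Suc n) \<omega> - T n \<omega>) \<partial>P)"
  proof (rule nn_integral_cong_AE)
    show "AE \<omega> in P. indicator ?E \<omega> = indicator {\<omega>. stays_nonneg \<gamma> (\<lambda>j. T j \<omega>) n} \<omega> * f (occs n \<omega>) (T (Suc n) \<omega> - T n \<omega>)"
      using AE_reaches AE_space
    proof eventually_elim
      case (elim \<omega>)
      have "T n \<omega> \<le> t \<longleftrightarrow> n \<le> N t \<omega>" "T (Suc n) \<omega> \<le> t \<longleftrightarrow> Suc n \<le> N t \<omega>"
        using elim by (intro T_le_iff_N t; simp)+
      then have N_iff: "N t \<omega> = n \<longleftrightarrow> T n \<omega> \<le> t \<and> t < T (Suc n) \<omega>" by linarith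
      have f: "f (occs n \<omega>) (T (Suc n) \<omega> - T n \<omega>) = (if N t \<omega> = n then indicator B (position n t \<omega>) else 0)"
        unfolding f_def occs_sum[OF elim(2)] N_iff position_def by simp
      show ?case
        unfolding f using elim(2) by (simp add: indicator_def)
    qed
  qed
  also have "\<dots> = \<Phi> n (\<lambda>z. \<integral>\<^sup>+s. ennreal (exponential_density ?l s) * f z s \<partial>lborel)"
    by (rule nn_integral_next[OF f_meas])
  also have "(\<lambda>z. \<integral>\<^sup>+s. ennreal (exponential_density ?l s) * f z s \<partial>lborel)
    = (\<lambda>z. indicator {..t} (fst z + snd z) * (ennreal (exp (- ?l * (t - (fst z + snd z)))) * ?B z))"
  proof
    fix z :: "real \<times> real"
    have "(\<integral>\<^sup>+s. ennreal (exponential_density ?l s) * f z s \<partial>lborel)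
      = (\<integral>\<^sup>+s. (indicator {..t} (fst z + snd z) * ?B z) * (ennreal (exponential_density ?l s) * indicator {t - (fst z + snd z)<..} s) \<partial>lborel)"
    proof (rule nn_integral_cong)
      fix s
      show "ennreal (exponential_density ?l s) * f z s
        = (indicator {..t} (fst z + snd z) * ?B z) * (ennreal (exponential_density ?l s) * indicator {t - (fst z + snd z)<..} s)"
        by (cases "fst z + snd z \<le> t"; cases "t < fst z + snd z + s") (simp_all add: f_def mult_ac)
    qed
    also have "\<dots> = (indicator {..t} (fst z + snd z) * ?B z) * (\<integral>\<^sup>+s. ennreal (exponential_density ?l s) * indicator {t - (fst z + snd z)<..} s \<partial>lborel)"
      by (rule nn_integral_cmult) measurable
    also have "\<dots> = indicator {..t} (fst z + snd z) * (ennreal (exp (- ?l * (t - (fst z + snd z)))) * ?B z)"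
    proof (cases "fst z + snd z \<le> t")
      case True
      then show ?thesis by (subst nn_integral_exponential_tail[OF l]) (auto simp: mult_ac)
    qed simp
    finally show "(\<integral>\<^sup>+s. ennreal (exponential_density ?l s) * f z s \<partial>lborel)
      = indicator {..t} (fst z + snd z) * (ennreal (exp (- ?l * (t - (fst z + snd z)))) * ?B z)" .
  qed
  finally have "ennreal ?l * emeasure P ?E = ennreal ?l * \<Phi> n (\<lambda>z. indicator {..t} (fst z + snd z) * (ennreal (exp (- ?l * (t - (fst z + snd z)))) * ?B z))"
    by (simp only:)
  also have "\<dots> = \<Phi> n (\<lambda>z. ennreal (exponential_density ?l (t - (fst z + snd z))) * ?B z)"
  proof -
    have good_meas: "(indicator {\<omega>. stays_nonneg \<gamma> (\<lambda>j. T j \<omega>) n} :: 'a \<Rightarrow> ennreal) \<in> borel_measurable P"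
    proof -
      have [measurable]: "Measurable.pred P (\<lambda>\<omega>. stays_nonneg \<gamma> (\<lambda>j. T j \<omega>) n)"
        by (rule measurable_G_P[OF measurable_stays_nonneg])
      have "(indicator {\<omega>. stays_nonneg \<gamma> (\<lambda>j. T j \<omega>) n} :: 'a \<Rightarrow> ennreal) = (\<lambda>\<omega>. if stays_nonneg \<gamma> (\<lambda>j. T j \<omega>) n then 1 else 0)"
        by (auto simp: indicator_def)
      then show ?thesis by simp
    qed
    have eq: "ennreal ?l * (indicator {..t} s * (ennreal (exp (- ?l * (t - s))) * b)) = ennreal (exponential_density ?l (t - s)) * b"
      for s and b :: ennreal
    proof (cases "s \<le> t")
      case True
      have "- (t - s) * ?l = - ?l * (t - s)" by (simp add: algebra_simps)
      then have "exponential_density ?l (t - s) = ?l * exp (- ?l * (t - s))"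
        using True by (simp only: exponential_density_def) simp
      then show ?thesis using True l by (simp add: ennreal_mult mult.assoc)
    qed (simp add: exponential_density_def)
    let ?h = "\<lambda>z. indicator {..t} (fst z + snd z) * (ennreal (exp (- ?l * (t - (fst z + snd z)))) * ?B z)"
    let ?I = "indicator {\<omega>. stays_nonneg \<gamma> (\<lambda>j. T j \<omega>) n} :: 'a \<Rightarrow> ennreal"
    have "(\<lambda>\<omega>. ?h (occs n \<omega>)) \<in> borel_measurable P" by measurable
    then have "(\<lambda>\<omega>. ?I \<omega> * ?h (occs n \<omega>)) \<in> borel_measurable P"
      by (rule borel_measurable_times_ennreal[OF good_meas])
    then have "ennreal ?l * \<Phi> n ?h = (\<integral>\<^sup>+\<omega>. ennreal ?l * (?I \<omega> * ?h (occs n \<omega>)) \<partial>P)"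
      unfolding \<Phi>_def by (rule nn_integral_cmult[symmetric])
    also have "\<dots> = (\<integral>\<^sup>+\<omega>. ?I \<omega> * (ennreal ?l * ?h (occs n \<omega>)) \<partial>P)"
      by (simp only: mult.left_commute)
    finally show ?thesis unfolding eq \<Phi>_def .
  qed
  finally show ?thesis .
qed

lemma ennreal_lam_cancel: "i \<in> {0, 1} \<Longrightarrow> ennreal (lam i) * x = ennreal (lam i) * y \<longleftrightarrow> x = y"
  using lam_pos[of i] by (auto simp: ennreal_mult_cancel_left)

text \<open>The unfinished duration is a descent, integrated out over \<open>b\<close>; positivity
  of \<open>B\<close> supplies the admissible end that \<open>nn_integral_even_density\<close>
  requires. With \<open>k = 0\<close> the law at the first switching lies on an axis and is treated
  directly.\<close>

lemma emeasure_event_odd: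
  assumes B[measurable]: "B \<in> sets borel" and t: "0 \<le> t" and B0: "B \<subseteq> {0<..}"
  shows "emeasure P {\<omega> \<in> space P. N t \<omega> = 2 * k + 1 \<and> stays_nonneg \<gamma> (\<lambda>j. T j \<omega>) (2 * k + 1) \<and> position (2 * k + 1) t \<omega> \<in> B}
    = (\<integral>\<^sup>+a. indicator B (level (a, t - a)) * (ennreal (odd_density k a (t - a)) * region a (t - a)) \<partial>lborel)"
    (is "emeasure P ?E = _")
proof -
  let ?e = "\<lambda>s. ennreal (exponential_density (lam 1) s)"
  let ?f = "\<lambda>z. ?e (t - (fst z + snd z)) * indicator B (level (advance 1 z (t - (fst z + snd z))))"
  let ?B = "\<lambda>a. indicator B (level (a, t - a)) :: ennreal"
  have m: "(2 * k + 1) mod 2 = (1::nat)" by presburger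
  have "ennreal (lam 1) * emeasure P ?E = \<Phi> (2 * k + 1) ?f"
    using emeasure_event[OF B t, of "2 * k + 1"] unfolding m .
  also have "\<dots> = (\<integral>\<^sup>+a. ?B a * (ennreal (lam 1 * odd_density k a (t - a)) * region a (t - a)) \<partial>lborel)"
  proof (cases k)
    case 0
    have "\<Phi> (2 * k + 1) ?f = (\<integral>\<^sup>+a. ennreal (exponential_density (lam 0) a) * (?e (t - a) * ?B a) \<partial>lborel)"
      unfolding 0 mult_0_right add_0 by (subst \<Phi>_1) (auto simp: advance_def)
    also have "\<dots> = (\<integral>\<^sup>+a. ?B a * (ennreal (lam 1 * odd_density k a (t - a)) * region a (t - a)) \<partial>lborel)"
    proof (rule nn_integral_cong)
      fix a
      show "ennreal (exponential_density (lam 0) a) * (?e (t - a) * ?B a)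
        = ?B a * (ennreal (lam 1 * odd_density k a (t - a)) * region a (t - a))"
      proof (cases "0 \<le> t - a \<and> level (a, t - a) \<in> B")
        case True
        then have "0 \<le> level (a, t - a)" using B0 by (auto simp: less_imp_le)
        then have le: "\<kappa> * (t - a) \<le> a" by (simp only: level_nonneg_iff)
        have "0 \<le> \<kappa> * (t - a)" using True \<kappa>_pos by (intro mult_nonneg_nonneg) auto
        then have a: "0 \<le> a" using le by linarith
        have "ennreal (exponential_density (lam 0) a) * ?e (t - a) = ennreal (lam 1 * odd_density 0 a (t - a))"
          using True a by (intro exponential_density_product) auto
        then show ?thesis using True le 0 by (simp add: region_def)
      next
        case False
        then show ?thesis by (auto simp: region_def exponential_density_def)
      qed
    qed
    finally show ?thesis .
  next
    case (Suc j)
    have "2 * k + 1 = 2 * j + 3" using Suc by simp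
    then have "\<Phi> (2 * k + 1) ?f = \<Phi> (2 * j + 3) ?f" by (simp only:)
    also have "\<dots> = (\<integral>\<^sup>+a. (\<integral>\<^sup>+b. ?f (a, b) * (ennreal (lam 0 * even_density j a b) * region a b) \<partial>lborel) \<partial>lborel)"
      by (rule \<Phi>_density(2)) measurable
    also have "\<dots> = (\<integral>\<^sup>+a. ?B a * (ennreal (lam 1 * odd_density k a (t - a)) * region a (t - a)) \<partial>lborel)"
    proof (rule nn_integral_cong)
      fix a
      have "(\<integral>\<^sup>+b. ?f (a, b) * (ennreal (lam 0 * even_density j a b) * region a b) \<partial>lborel)
        = (\<integral>\<^sup>+b. ?B a * (ennreal (lam 0 * even_density j a b) * region a b * ?e ((t - a) - b)) \<partial>lborel)"
        by (intro nn_integral_cong) (simp add: advance_def mult_ac diff_diff_eq)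
      also have "\<dots> = ?B a * (\<integral>\<^sup>+b. ennreal (lam 0 * even_density j a b) * region a b * ?e ((t - a) - b) \<partial>lborel)"
        by (rule nn_integral_cmult) measurable
      also have "\<dots> = ?B a * (ennreal (lam 1 * odd_density k a (t - a)) * region a (t - a))"
      proof (cases "level (a, t - a) \<in> B")
        case True
        then have "0 \<le> level (a, t - a)" using B0 by (auto simp: less_imp_le)
        then have le: "\<kappa> * (t - a) \<le> a" by (simp only: level_nonneg_iff)
        show ?thesis unfolding nn_integral_even_density[OF le] Suc ..
      qed simp
      finally show "(\<integral>\<^sup>+b. ?f (a, b) * (ennreal (lam 0 * even_density j a b) * region a b) \<partial>lborel)
        = ?B a * (ennreal (lam 1 * odd_density k a (t - a)) * region a (t - a))" .
    qed
    finally show ?thesis .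
  qed
  also have "\<dots> = (\<integral>\<^sup>+a. ennreal (lam 1) * (?B a * (ennreal (odd_density k a (t - a)) * region a (t - a))) \<partial>lborel)"
    using lam_1 by (intro nn_integral_cong) (simp add: ennreal_mult' mult_ac)
  also have "\<dots> = ennreal (lam 1) * (\<integral>\<^sup>+a. ?B a * (ennreal (odd_density k a (t - a)) * region a (t - a)) \<partial>lborel)"
    by (rule nn_integral_cmult) measurable
  finally show ?thesis by (subst (asm) ennreal_lam_cancel) auto
qed

text \<open>The unfinished duration is an ascent and \<open>a\<close> is integrated out, so the
  result is parametrised by the time \<open>b\<close> in state 1.\<close>

lemma emeasure_event_even:
  assumes B[measurable]: "B \<in> sets borel" and t: "0 \<le> t"
  shows "emeasure P {\<omega> \<in> space P. N t \<omega> = 2 * k + 2 \<and> stays_nonneg \<gamma> (\<lambda>j. T j \<omega>) (2 * k + 2) \<and> position (2 * k + 2) t \<omega> \<in> B}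
    = (\<integral>\<^sup>+b. indicator B (level (t - b, b)) * (ennreal (even_density k (t - b) b) * region (t - b) b) \<partial>lborel)"
    (is "emeasure P ?E = _")
proof -
  let ?e = "\<lambda>s. ennreal (exponential_density (lam 0) s)"
  let ?f = "\<lambda>z. ?e (t - (fst z + snd z)) * indicator B (level (advance 0 z (t - (fst z + snd z))))"
  let ?B = "\<lambda>b. indicator B (level (t - b, b)) :: ennreal"
  have m: "(2 * k + 2) mod 2 = (0::nat)" by presburger
  have "ennreal (lam 0) * emeasure P ?E = \<Phi> (2 * k + 2) ?f"
    using emeasure_event[OF B t, of "2 * k + 2"] unfolding m .
  also have "\<dots> = (\<integral>\<^sup>+a. (\<integral>\<^sup>+b. ?f (a, b) * (ennreal (lam 1 * odd_density k a b) * region a b) \<partial>lborel) \<partial>lborel)"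
    by (rule \<Phi>_density(1)) measurable
  also have "\<dots> = (\<integral>\<^sup>+b. (\<integral>\<^sup>+a. ?f (a, b) * (ennreal (lam 1 * odd_density k a b) * region a b) \<partial>lborel) \<partial>lborel)"
    by (rule nn_integral_swap) measurable
  also have "\<dots> = (\<integral>\<^sup>+b. ennreal (lam 0) * (?B b * (ennreal (even_density k (t - b) b) * region (t - b) b)) \<partial>lborel)"
  proof (rule nn_integral_cong)
    fix b
    have "(\<integral>\<^sup>+a. ?f (a, b) * (ennreal (lam 1 * odd_density k a b) * region a b) \<partial>lborel)
      = (\<integral>\<^sup>+a. ?B b * (ennreal (lam 1 * odd_density k a b) * region a b * ?e ((t - b) - a)) \<partial>lborel)"
      by (intro nn_integral_cong) (simp add: advance_def mult_ac diff_diff_eq add.commute)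
    also have "\<dots> = ?B b * (\<integral>\<^sup>+a. ennreal (lam 1 * odd_density k a b) * region a b * ?e ((t - b) - a) \<partial>lborel)"
      by (rule nn_integral_cmult) measurable
    also have "\<dots> = ennreal (lam 0) * (?B b * (ennreal (even_density k (t - b) b) * region (t - b) b))"
      unfolding nn_integral_odd_density using lam_0 by (simp add: ennreal_mult' mult_ac)
    finally show "(\<integral>\<^sup>+a. ?f (a, b) * (ennreal (lam 1 * odd_density k a b) * region a b) \<partial>lborel)
      = ennreal (lam 0) * (?B b * (ennreal (even_density k (t - b) b) * region (t - b) b))" .
  qed
  also have "\<dots> = ennreal (lam 0) * (\<integral>\<^sup>+b. ?B b * (ennreal (even_density k (t - b) b) * region (t - b) b) \<partial>lborel)"
    by (rule nn_integral_cmult) measurable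
  finally show ?thesis by (subst (asm) ennreal_lam_cancel) auto
qed

section \<open>From occupation times to the position\<close>

definition g_odd :: "real \<Rightarrow> nat \<Rightarrow> real \<Rightarrow> real" where
  "g_odd t n x = lam 0 / xi0 \<gamma> t x * (zfun lam \<gamma> t x ^ n / (fact n)\<^sup>2) * theta lam \<gamma> t x
                * (1 / \<gamma> 0 * (x - \<gamma> 1 / (real n + 1) * xi1 \<gamma> t x))
                * indicat_real {0<..<\<gamma> 0 * t} x"

definition g_even :: "real \<Rightarrow> nat \<Rightarrow> real \<Rightarrow> real" where
  "g_even t n x = lam 0 * lam 1 * (zfun lam \<gamma> t x ^ n / (fact n * fact (n + 1))) * theta lam \<gamma> t x
                * (x / \<gamma> 0) * indicat_real {0<..<\<gamma> 0 * t} x"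

lemma measurable_g [measurable]: "g_odd t n \<in> borel_measurable borel" "g_even t n \<in> borel_measurable borel"
  unfolding g_odd_def[abs_def] g_even_def[abs_def] zfun_def theta_def xi1_def xi0_def by measurable

lemma \<gamma>_diff: "0 < \<gamma> 0 - \<gamma> 1" and \<gamma>_neq: "\<gamma> 0 \<noteq> \<gamma> 1"
  using \<gamma>0 \<gamma>1 by auto

lemma xi_pos:
  assumes "0 < x" "x < \<gamma> 0 * t" "0 < t"
  shows "0 < xi0 \<gamma> t x" "0 < xi1 \<gamma> t x" "\<kappa> * xi1 \<gamma> t x \<le> xi0 \<gamma> t x"
proof -
  have "\<gamma> 1 * t < 0" using \<gamma>1 assms by (simp add: mult_neg_pos)
  then show "0 < xi0 \<gamma> t x" unfolding xi0_def using assms \<gamma>_diff by (intro divide_pos_pos) auto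
  show "0 < xi1 \<gamma> t x" unfolding xi1_eq[of \<gamma>, OF \<gamma>_neq] using assms \<gamma>_diff by (intro divide_pos_pos) auto
  have "0 \<le> level (xi0 \<gamma> t x, xi1 \<gamma> t x)"
    using assms xi_level[OF \<gamma>_neq, of t x] by (simp add: level_def)
  then show "\<kappa> * xi1 \<gamma> t x \<le> xi0 \<gamma> t x" by (simp only: level_nonneg_iff)
qed

lemma g_odd_eq:
  assumes x: "0 < x" "x < \<gamma> 0 * t" and t: "0 < t"
  shows "g_odd t n x = odd_density n (xi0 \<gamma> t x) (xi1 \<gamma> t x) / (\<gamma> 0 - \<gamma> 1)"
proof -
  define a b where "a = xi0 \<gamma> t x" and "b = xi1 \<gamma> t x"
  have a: "a \<noteq> 0" using xi_pos[OF x t] by (simp add: a_def)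
  have "x = \<gamma> 0 * a + \<gamma> 1 * b" using xi_level[OF \<gamma>_neq, of t x] by (simp add: a_def b_def)
  \<comment> \<open>Expressed in \<open>a\<close> and \<open>b\<close>, the level divided by
    \<open>\<gamma> 0\<close> is \<open>a - \<kappa> * b\<close>; the term with
    \<open>1 / (real n + 1)\<close> reduces the coefficient of \<open>b\<close> to
    \<open>\<kappa> * n / (n + 1)\<close>, as in \<open>odd_volume\<close>.\<close>
  then have "1 / \<gamma> 0 * (x - \<gamma> 1 / (real n + 1) * b)
      = \<gamma> 0 / \<gamma> 0 * a + \<gamma> 1 / \<gamma> 0 * b - \<gamma> 1 / \<gamma> 0 * (b / (real n + 1))"
    by (simp add: ring_distribs diff_divide_distrib add_divide_distrib)
  also have "\<dots> = a + (\<gamma> 1 / \<gamma> 0) * (b - b / (real n + 1))"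
    using \<gamma>0 by (simp add: right_diff_distrib)
  also have "b - b / (real n + 1) = real n / (real n + 1) * b"
    by (simp add: field_simps)
  also have "\<gamma> 1 / \<gamma> 0 = - \<kappa>" by (simp add: \<kappa>_def)
  finally have last: "1 / \<gamma> 0 * (x - \<gamma> 1 / (real n + 1) * b) = a - \<kappa> * (real n / (real n + 1)) * b"
    by simp
  \<comment> \<open>Dividing by \<open>a\<close> produces the factor \<open>1 / xi0\<close> of the
    formula and expresses the truncated power \<open>a ^ (n - 1)\<close> uniformly in
    \<open>n\<close>.\<close>
  have "odd_volume \<kappa> n a b = a ^ n * b ^ n / a * (a - \<kappa> * (real n / (real n + 1)) * b) / (fact n)\<^sup>2"
    using a by (cases n) (simp_all add: odd_volume_def algebra_simps)
  then have key: "lam 0 / a * ((lam 0 * lam 1 * a * b) ^ n / (fact n)\<^sup>2) * E * (a - \<kappa> * (real n / (real n + 1)) * b)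
    = lam 0 * (lam 0 * lam 1) ^ n * E * odd_volume \<kappa> n a b" for E
    by (simp add: power_mult_distrib mult_ac)
  have "g_odd t n x = lam 0 / a * ((lam 0 * lam 1 * a * b) ^ n / (fact n)\<^sup>2)
      * exp (- lam 0 * a - lam 1 * b) * (a - \<kappa> * (real n / (real n + 1)) * b) / (\<gamma> 0 - \<gamma> 1)"
    using x unfolding g_odd_def theta_def zfun_def a_def[symmetric] b_def[symmetric] last by simp
  then show ?thesis
    unfolding key odd_density_def a_def[symmetric] b_def[symmetric] .
qed

lemma g_even_eq:
  assumes x: "0 < x" "x < \<gamma> 0 * t" and t: "0 < t"
  shows "g_even t n x = even_density n (xi0 \<gamma> t x) (xi1 \<gamma> t x) / (\<gamma> 0 - \<gamma> 1)"
proof -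
  define a b where "a = xi0 \<gamma> t x" and "b = xi1 \<gamma> t x"
  have "x = \<gamma> 0 * a + \<gamma> 1 * b" using xi_level[OF \<gamma>_neq, of t x] by (simp add: a_def b_def)
  then have last: "x / \<gamma> 0 = a - \<kappa> * b"
    using \<gamma>0 by (simp add: \<kappa>_def field_simps)
  have "even_volume \<kappa> n a b = a ^ n * b ^ n * (a - \<kappa> * b) / (fact n * fact (n + 1))"
    by (simp add: even_volume_def algebra_simps)
  then have key: "lam 0 * lam 1 * ((lam 0 * lam 1 * a * b) ^ n / (fact n * fact (n + 1))) * E * (a - \<kappa> * b)
    = (lam 0 * lam 1) ^ (n + 1) * E * even_volume \<kappa> n a b" for E
    by (simp add: power_mult_distrib mult_ac)
  have "g_even t n x = lam 0 * lam 1 * ((lam 0 * lam 1 * a * b) ^ n / (fact n * fact (n + 1)))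
      * exp (- lam 0 * a - lam 1 * b) * (a - \<kappa> * b) / (\<gamma> 0 - \<gamma> 1)"
    using x unfolding g_even_def theta_def zfun_def a_def[symmetric] b_def[symmetric] last by simp
  then show ?thesis
    unfolding key even_density_def a_def[symmetric] b_def[symmetric] .
qed

lemma g_nonneg:
  assumes "0 < t"
  shows "0 \<le> g_odd t n x" "0 \<le> g_even t n x"
proof -
  have "0 \<le> g_odd t n x \<and> 0 \<le> g_even t n x"
  proof (cases "0 < x \<and> x < \<gamma> 0 * t")
    case True
    note pos = xi_pos[of x t]
    have "0 \<le> odd_volume \<kappa> n (xi0 \<gamma> t x) (xi1 \<gamma> t x)" "0 \<le> even_volume \<kappa> n (xi0 \<gamma> t x) (xi1 \<gamma> t x)"
      using pos True assms by (auto intro!: odd_volume_nonneg even_volume_nonneg \<kappa>_pos less_imp_le[OF pos(2)])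
    then show ?thesis
      using True assms \<gamma>_diff lam_0 lam_1
      by (auto simp: g_odd_eq g_even_eq odd_density_def even_density_def intro!: divide_nonneg_pos mult_nonneg_nonneg)
  next
    case False
    then show ?thesis by (auto simp: g_odd_def g_even_def)
  qed
  then show "0 \<le> g_odd t n x" "0 \<le> g_even t n x" by auto
qed

text \<open>The two sides can differ only at \<open>x = \<gamma> 0 * t\<close>, where
  \<open>xi1\<close> is 0: that boundary point belongs to the closed region but not to the open
  interval of the formula.\<close>

lemma AE_density_eq:
  assumes B: "B \<subseteq> {0<..}" and t: "0 < t"
    and g: "\<And>x. 0 < x \<Longrightarrow> x < \<gamma> 0 * t \<Longrightarrow> g x = d (xi0 \<gamma> t x) (xi1 \<gamma> t x) / (\<gamma> 0 - \<gamma> 1)"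
    and g0: "\<And>x. \<gamma> 0 * t < x \<Longrightarrow> g x = 0"
  shows "AE x in lborel. ennreal (1 / (\<gamma> 0 - \<gamma> 1)) * (indicator B x * (ennreal (d (xi0 \<gamma> t x) (xi1 \<gamma> t x)) * region (xi0 \<gamma> t x) (xi1 \<gamma> t x)))
    = ennreal (g x) * indicator B x"
  using AE_lborel_singleton[of "\<gamma> 0 * t"]
proof eventually_elim
  case (elim x)
  show ?case
  proof (cases "x \<in> B")
    case True
    then have x: "0 < x" using B by auto
    consider "x < \<gamma> 0 * t" | "\<gamma> 0 * t < x" using elim by linarith
    then show ?thesis
    proof cases
      case 1
      then have "region (xi0 \<gamma> t x) (xi1 \<gamma> t x) = 1"
        using xi_pos[OF x 1 t] by (simp add: region_def)
      moreover have "ennreal (g x) = ennreal (1 / (\<gamma> 0 - \<gamma> 1)) * ennreal (d (xi0 \<gamma> t x) (xi1 \<gamma> t x))"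
        using g[OF x 1] \<gamma>_diff by (simp add: ennreal_mult'[symmetric])
      ultimately show ?thesis using True by simp
    next
      case 2
      then have "xi1 \<gamma> t x < 0"
        unfolding xi1_eq[of \<gamma>, OF \<gamma>_neq] using \<gamma>_diff by (intro divide_neg_pos) auto
      then have "region (xi0 \<gamma> t x) (xi1 \<gamma> t x) = 0" by (simp add: region_def)
      then show ?thesis using g0[OF 2] by simp
    qed
  qed simp
qed

text \<open>An affine change of variables; its Jacobian is the denominator in
  \<open>theta\<close>.\<close>

lemma nn_integral_xi0:
  assumes [measurable]: "f \<in> borel_measurable borel"
  shows "(\<integral>\<^sup>+a. f a \<partial>lborel) = (\<integral>\<^sup>+x. ennreal (1 / (\<gamma> 0 - \<gamma> 1)) * f (xi0 \<gamma> t x) \<partial>lborel)"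
proof -
  have "(\<integral>\<^sup>+a. f a \<partial>lborel) = ennreal \<bar>1 / (\<gamma> 0 - \<gamma> 1)\<bar> * (\<integral>\<^sup>+x. f (- \<gamma> 1 * t / (\<gamma> 0 - \<gamma> 1) + 1 / (\<gamma> 0 - \<gamma> 1) * x) \<partial>lborel)"
    using \<gamma>_diff by (intro nn_integral_real_affine) auto
  also have "\<dots> = ennreal (1 / (\<gamma> 0 - \<gamma> 1)) * (\<integral>\<^sup>+x. f (xi0 \<gamma> t x) \<partial>lborel)"
    using \<gamma>_diff by (intro arg_cong2[where f="(*)"] nn_integral_cong arg_cong[where f=f])
      (simp_all add: xi0_def diff_divide_distrib)
  also have "\<dots> = (\<integral>\<^sup>+x. ennreal (1 / (\<gamma> 0 - \<gamma> 1)) * f (xi0 \<gamma> t x) \<partial>lborel)"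
    by (rule nn_integral_cmult[symmetric]) (simp add: xi0_def)
  finally show ?thesis .
qed

lemma nn_integral_xi1:
  assumes [measurable]: "f \<in> borel_measurable borel"
  shows "(\<integral>\<^sup>+b. f b \<partial>lborel) = (\<integral>\<^sup>+x. ennreal (1 / (\<gamma> 0 - \<gamma> 1)) * f (xi1 \<gamma> t x) \<partial>lborel)"
proof -
  have "(\<integral>\<^sup>+b. f b \<partial>lborel) = (\<integral>\<^sup>+a. f (t - a) \<partial>lborel)"
    using nn_integral_real_affine[of f "-1" t] by simp
  also have "\<dots> = (\<integral>\<^sup>+x. ennreal (1 / (\<gamma> 0 - \<gamma> 1)) * f (t - xi0 \<gamma> t x) \<partial>lborel)"
    by (rule nn_integral_xi0) measurable
  finally show ?thesis by (simp add: xi1_def)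
qed

lemma emeasure_position_odd:
  assumes B[measurable]: "B \<in> sets borel" and t: "0 < t" and B0: "B \<subseteq> {0<..}"
  shows "emeasure P {\<omega> \<in> space P. N t \<omega> = 2 * k + 1 \<and> stays_nonneg \<gamma> (\<lambda>j. T j \<omega>) (2 * k + 1) \<and> position (2 * k + 1) t \<omega> \<in> B}
    = (\<integral>\<^sup>+x\<in>B. ennreal (g_odd t k x) \<partial>lborel)"
proof -
  have lev: "level (xi0 \<gamma> t x, t - xi0 \<gamma> t x) = x" for x
    using xi_level[OF \<gamma>_neq, of t x] by (simp add: level_def xi1_def)
  have "emeasure P {\<omega> \<in> space P. N t \<omega> = 2 * k + 1 \<and> stays_nonneg \<gamma> (\<lambda>j. T j \<omega>) (2 * k + 1) \<and> position (2 * k + 1) t \<omega> \<in> B}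
    = (\<integral>\<^sup>+x. ennreal (1 / (\<gamma> 0 - \<gamma> 1)) * (indicator B x * (ennreal (odd_density k (xi0 \<gamma> t x) (xi1 \<gamma> t x)) * region (xi0 \<gamma> t x) (xi1 \<gamma> t x))) \<partial>lborel)"
    unfolding emeasure_event_odd[OF B less_imp_le[OF t] B0]
    by (subst nn_integral_xi0[of _ t]) (simp_all add: lev xi1_def)
  also have "\<dots> = (\<integral>\<^sup>+x. ennreal (g_odd t k x) * indicator B x \<partial>lborel)"
    by (intro nn_integral_cong_AE AE_density_eq[OF B0 t]) (simp_all add: g_odd_eq t, simp add: g_odd_def)
  finally show ?thesis .
qed

lemma emeasure_position_even:
  assumes B[measurable]: "B \<in> sets borel" and t: "0 < t" and B0: "B \<subseteq> {0<..}"
  shows "emeasure P {\<omega> \<in> space P. N t \<omega> = 2 * k + 2 \<and> stays_nonneg \<gamma> (\<lambda>j. T j \<omega>) (2 * k + 2) \<and> position (2 * k + 2) t \<omega> \<in> B}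
    = (\<integral>\<^sup>+x\<in>B. ennreal (g_even t k x) \<partial>lborel)"
proof -
  have xi0: "t - xi1 \<gamma> t x = xi0 \<gamma> t x" for x by (simp add: xi1_def)
  have lev: "level (xi0 \<gamma> t x, xi1 \<gamma> t x) = x" for x
    using xi_level[OF \<gamma>_neq, of t x] by (simp add: level_def)
  have "emeasure P {\<omega> \<in> space P. N t \<omega> = 2 * k + 2 \<and> stays_nonneg \<gamma> (\<lambda>j. T j \<omega>) (2 * k + 2) \<and> position (2 * k + 2) t \<omega> \<in> B}
    = (\<integral>\<^sup>+x. ennreal (1 / (\<gamma> 0 - \<gamma> 1)) * (indicator B x * (ennreal (even_density k (xi0 \<gamma> t x) (xi1 \<gamma> t x)) * region (xi0 \<gamma> t x) (xi1 \<gamma> t x))) \<partial>lborel)"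
    unfolding emeasure_event_even[OF B less_imp_le[OF t]]
    by (subst nn_integral_xi1[of _ t]) (simp_all add: lev xi0)
  also have "\<dots> = (\<integral>\<^sup>+x. ennreal (g_even t k x) * indicator B x \<partial>lborel)"
    by (intro nn_integral_cong_AE AE_density_eq[OF B0 t]) (simp_all add: g_even_eq t, simp add: g_even_def)
  finally show ?thesis .
qed

end

section \<open>Reduction to paths started in state 0\<close>

text \<open>The Markov axiom is phrased with strictly increasing sequences of times; this passes
  from finite sets to such sequences with the present as last term.\<close>

lemma finite_strict_enumeration:
  fixes J :: "'b :: linorder set"
  assumes "finite J" "s \<in> J" "\<And>u. u \<in> J \<Longrightarrow> u \<le> s"
  obtains n :: nat and \<tau> where "\<And>k. k < n \<Longrightarrow> \<tau> k < \<tau> (Suc k)" "\<tau> n = s" "\<tau> ` {..n} = J"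
proof -
  define xs where "xs = sorted_list_of_set J"
  have xs: "set xs = J" "sorted_wrt (<) xs"
    using assms(1) by (auto simp: xs_def)
  then have ne: "xs \<noteq> []" using assms(2) by auto
  define n where "n = length xs - 1"
  have len: "length xs = Suc n" using ne by (simp add: n_def)
  have less: "xs ! k < xs ! m" if "k < m" "m \<le> n" for k m
    using xs(2) that len by (simp add: sorted_wrt_iff_nth_less)
  have img: "(!) xs ` {..n} = J"
    using xs(1) len by (auto simp: set_conv_nth image_iff less_Suc_eq_le)
  obtain m where m: "m \<le> n" "xs ! m = s" using img assms(2) by auto
  have "xs ! n = s"
  proof (rule ccontr)
    assume "xs ! n \<noteq> s"
    then have "m < n" using m by (cases "m = n") auto
    then have "s < xs ! n" using less[of m n] m by simp
    moreover have "xs ! n \<in> J" using img by auto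
    ultimately show False using assms(3) by (meson not_le)
  qed
  then show ?thesis using less img by (intro that[of n "(!) xs"]) auto
qed

context two_state_Markov
begin

lemma level_set_measurable: "0 \<le> u \<Longrightarrow> {\<omega> \<in> space M. \<epsilon> u \<omega> = i} \<in> sets M"
  using state_measurable by (rule measurable_count_space_level_set)

lemma cylinder_measurable:
  assumes "finite J" "J \<subseteq> {0..}"
  shows "{\<omega> \<in> space M. \<forall>u\<in>J. \<epsilon> u \<omega> = f u} \<in> sets M"
proof -
  have "{\<omega> \<in> space M. \<epsilon> u \<omega> = f u} \<in> sets M" if "u \<in> J" for u
    using that assms(2) by (intro level_set_measurable) auto
  then show ?thesis using assms(1) by (intro sets.sets_Collect_finite_All) auto
qed

text \<open>Where the conditioning event has positive probability this is the axiom multiplied out;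
  for a null event both sides vanish by monotonicity.\<close>

lemma Markov_cylinder:
  assumes J: "finite J" "J \<subseteq> {0..s}" "s \<in> J" and h: "h > 0" and j: "j \<in> {0, 1}"
  shows "prob {\<omega> \<in> space M. (\<forall>u\<in>J. \<epsilon> u \<omega> = f u) \<and> \<epsilon> (s + h) \<omega> = j}
    = p h (f s) j * prob {\<omega> \<in> space M. \<forall>u\<in>J. \<epsilon> u \<omega> = f u}"
proof -
  have "u \<le> s" if "u \<in> J" for u using J(2) that by auto
  then obtain n :: nat and \<tau> where \<tau>: "\<And>k. k < n \<Longrightarrow> \<tau> k < \<tau> (Suc k)" "\<tau> n = s" "\<tau> ` {..n} = J"
    using finite_strict_enumeration[OF J(1,3)] by blast
  have \<tau>0: "0 \<le> \<tau> 0" using \<tau>(3) J(2) by auto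
  have all: "(\<forall>k\<le>n. \<epsilon> (\<tau> k) \<omega> = f (\<tau> k)) \<longleftrightarrow> (\<forall>u\<in>J. \<epsilon> u \<omega> = f u)" for \<omega>
    unfolding \<tau>(3)[symmetric] by auto
  show ?thesis
  proof (cases "prob {\<omega> \<in> space M. \<forall>u\<in>J. \<epsilon> u \<omega> = f u} > 0")
    case True
    have "\<P>(\<omega> in M. \<epsilon> (\<tau> n + h) \<omega> = j \<bar> \<forall>k\<le>n. \<epsilon> (\<tau> k) \<omega> = f (\<tau> k)) = p h (f (\<tau> n)) j"
      using True unfolding all[symmetric] by (intro Markov[where i="\<lambda>k. f (\<tau> k)"] \<tau>0 \<tau>(1) h j) auto
    then show ?thesis
      using True unfolding all \<tau>(2) cond_prob_def by (simp add: field_simps conj_commute)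
  next
    case False
    then have zero: "prob {\<omega> \<in> space M. \<forall>u\<in>J. \<epsilon> u \<omega> = f u} = 0"
      by (simp add: not_less measure_le_0_iff)
    have "prob {\<omega> \<in> space M. (\<forall>u\<in>J. \<epsilon> u \<omega> = f u) \<and> \<epsilon> (s + h) \<omega> = j} \<le> prob {\<omega> \<in> space M. \<forall>u\<in>J. \<epsilon> u \<omega> = f u}"
      using J by (intro finite_measure_mono cylinder_measurable) auto
    then have "prob {\<omega> \<in> space M. (\<forall>u\<in>J. \<epsilon> u \<omega> = f u) \<and> \<epsilon> (s + h) \<omega> = j} = 0"
      unfolding zero by (simp only: measure_le_0_iff)
    then show ?thesis unfolding zero by simp
  qed
qed

end

locale started_in_0 = two_state_Markov M \<epsilon> p lam
  for M :: "'a measure" and \<epsilon> p lam +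
  assumes start_pos: "prob {\<omega> \<in> space M. \<epsilon> 0 \<omega> = 0} > 0"
    and lam_pos: "\<And>i. i \<in> {0, 1} \<Longrightarrow> lam i > 0"
begin

definition \<Omega>0 :: "'a set" where
  "\<Omega>0 = {\<omega> \<in> space M. \<epsilon> 0 \<omega> = 0}"

text \<open>The conditional law restricted to the paths started in 0, so that the start holds
  everywhere and not merely almost surely.\<close>

definition P :: "'a measure" where
  "P = restrict_space (P_init M \<epsilon> 0) \<Omega>0"

lemma \<Omega>0_sets: "\<Omega>0 \<in> sets M"
  unfolding \<Omega>0_def by (rule level_set_measurable) simp

lemma \<Omega>0_subset: "\<Omega>0 \<subseteq> space M"
  by (auto simp: \<Omega>0_def)

lemma \<Omega>0_pos: "emeasure M \<Omega>0 \<noteq> 0" "emeasure M \<Omega>0 \<noteq> \<infinity>"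
  using start_pos by (auto simp: \<Omega>0_def emeasure_eq_measure)

lemma sets_P_init: "sets (P_init M \<epsilon> 0) = sets M" and space_P_init: "space (P_init M \<epsilon> 0) = space M"
  by (simp_all add: P_init_def)

lemma space_P: "space P = \<Omega>0"
  using \<Omega>0_subset by (auto simp: P_def space_restrict_space space_P_init)

lemma sets_P: "A \<in> sets P \<longleftrightarrow> A \<in> sets M \<and> A \<subseteq> \<Omega>0"
proof -
  have "\<Omega>0 \<inter> space (P_init M \<epsilon> 0) \<in> sets (P_init M \<epsilon> 0)"
    unfolding sets_P_init space_P_init using \<Omega>0_sets by auto
  then show ?thesis
    unfolding P_def by (subst sets_restrict_space_iff) (auto simp: sets_P_init)
qed

lemma emeasure_P: "A \<subseteq> \<Omega>0 \<Longrightarrow> emeasure P A = emeasure (P_init M \<epsilon> 0) A"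
  unfolding P_def using \<Omega>0_sets by (intro emeasure_restrict_space) (auto simp: sets_P_init space_P_init)

lemma prob_space_P: "prob_space P"
proof
  have "emeasure P (space P) = emeasure (uniform_measure M \<Omega>0) \<Omega>0"
    unfolding space_P emeasure_P[OF subset_refl] by (simp add: P_init_def \<Omega>0_def)
  also have "\<dots> = emeasure M \<Omega>0 / emeasure M \<Omega>0"
    using \<Omega>0_sets by (subst emeasure_uniform_measure) auto
  also have "\<dots> = 1" using \<Omega>0_pos by (intro ennreal_divide_self) (auto simp: emeasure_eq_measure)
  finally show "emeasure P (space P) = 1" .
qed

lemma measure_P:
  assumes "A \<in> sets M" "A \<subseteq> \<Omega>0"
  shows "measure P A = prob A / prob \<Omega>0"
proof -
  have "measure P A = measure (uniform_measure M \<Omega>0) A"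
    unfolding measure_def emeasure_P[OF assms(2)] by (simp add: P_init_def \<Omega>0_def)
  also have "\<dots> = prob (\<Omega>0 \<inter> A) / prob \<Omega>0"
    using \<Omega>0_pos assms by (intro measure_uniform_measure) auto
  finally show ?thesis using assms(2) by (simp add: Int_absorb1)
qed

text \<open>Conditioning on the start amounts to adding time 0 with value 0 to the prescribed
  states; the normalising constant cancels. A conflicting prescription at time 0 makes both events
  empty.\<close>

lemma transition_P:
  assumes J: "finite J" "J \<subseteq> {0..s}" "s \<in> J" and h: "h > 0" and j: "j \<in> {0, 1}"
  shows "measure P {\<omega> \<in> space P. (\<forall>u\<in>J. \<epsilon> u \<omega> = f u) \<and> \<epsilon> (s + h) \<omega> = j}
    = p h (f s) j * measure P {\<omega> \<in> space P. \<forall>u\<in>J. \<epsilon> u \<omega> = f u}"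
proof (cases "0 \<in> J \<and> f 0 \<noteq> 0")
  case True
  then have "{\<omega> \<in> space P. \<forall>u\<in>J. \<epsilon> u \<omega> = f u} = {}"
    unfolding space_P \<Omega>0_def by force
  moreover from this have "{\<omega> \<in> space P. (\<forall>u\<in>J. \<epsilon> u \<omega> = f u) \<and> \<epsilon> (s + h) \<omega> = j} = {}"
    by blast
  ultimately show ?thesis by (simp only: measure_empty)
next
  case False
  define g where "g u = (if u = 0 then 0 else f u)" for u
  let ?J = "insert 0 J"
  have s: "0 \<le> s" using J(2,3) by auto
  have gs: "g s = f s" using False J(3) by (auto simp: g_def)
  have g0: "g 0 = 0" by (simp add: g_def)
  have "g u = f u" if "u \<in> J" for u using False that by (auto simp: g_def)
  then have gJ: "(\<forall>u\<in>J. \<epsilon> u \<omega> = g u) \<longleftrightarrow> (\<forall>u\<in>J. \<epsilon> u \<omega> = f u)" for \<omega>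
    by (intro ball_cong) simp_all
  have g: "\<omega> \<in> space P \<and> (\<forall>u\<in>J. \<epsilon> u \<omega> = f u) \<longleftrightarrow> \<omega> \<in> space M \<and> (\<forall>u\<in>?J. \<epsilon> u \<omega> = g u)" for \<omega>
  proof -
    have ins: "(\<forall>u\<in>?J. R u) \<longleftrightarrow> R 0 \<and> (\<forall>u\<in>J. R u)" for R by blast
    show ?thesis unfolding ins g0 gJ space_P \<Omega>0_def mem_Collect_eq by blast
  qed
  have J': "finite ?J" "?J \<subseteq> {0..s}" "s \<in> ?J" using J s by auto
  let ?X = "{\<omega> \<in> space M. \<forall>u\<in>?J. \<epsilon> u \<omega> = g u}"
  let ?Y = "{\<omega> \<in> space M. (\<forall>u\<in>?J. \<epsilon> u \<omega> = g u) \<and> \<epsilon> (s + h) \<omega> = j}"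
  have X: "{\<omega> \<in> space P. \<forall>u\<in>J. \<epsilon> u \<omega> = f u} = ?X"
    and Y: "{\<omega> \<in> space P. (\<forall>u\<in>J. \<epsilon> u \<omega> = f u) \<and> \<epsilon> (s + h) \<omega> = j} = ?Y"
    by (rule Collect_cong, use g in blast)+
  have X_sets: "?X \<in> sets M" using J' by (intro cylinder_measurable) auto
  have "?Y = ?X \<inter> {\<omega> \<in> space M. \<epsilon> (s + h) \<omega> = j}" by blast
  also have "\<dots> \<in> sets M" using s h by (intro sets.Int X_sets level_set_measurable) simp
  finally have Y_sets: "?Y \<in> sets M" .
  have sub: "?X \<subseteq> \<Omega>0" "?Y \<subseteq> \<Omega>0" unfolding X[symmetric] Y[symmetric] space_P by blast+
  show ?thesis
    unfolding X Y measure_P[OF X_sets sub(1)] measure_P[OF Y_sets sub(2)]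
    using Markov_cylinder[OF J' h j, of g] gs by simp
qed

lemma path_M:
  assumes "\<omega> \<in> space M"
  shows "binary_path (\<lambda>u. \<epsilon> u \<omega>)"
proof
  show "\<epsilon> u \<omega> \<in> {0, 1}" if "0 \<le> u" for u
    using measurable_space[OF state_measurable[OF that] assms] by simp
qed (rule right_continuous[OF assms] left_limits[OF assms]; assumption)+

lemma switching_from_0_P: "switching_from_0 P \<epsilon> p lam"
proof -
  interpret P: prob_space P by (rule prob_space_P)
  show ?thesis
  proof
    show "\<epsilon> t \<in> measurable P (count_space {0, 1})" if "0 \<le> t" for t
      using state_measurable[OF that] unfolding P_def
      by (intro measurable_restrict_space1) (simp add: P_init_def)
    show "\<epsilon> 0 \<omega> = 0" if "\<omega> \<in> space P" for \<omega>
      using that unfolding space_P \<Omega>0_def by blast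
    show "continuous (at_right t) (\<lambda>u. \<epsilon> u \<omega>)" if "\<omega> \<in> space P" "0 \<le> t" for \<omega> t
      using that \<Omega>0_subset unfolding space_P by (intro right_continuous) auto
    show "\<exists>l. ((\<lambda>u. \<epsilon> u \<omega>) \<longlongrightarrow> l) (at_left t)" if "\<omega> \<in> space P" "0 < t" for \<omega> t
      using that \<Omega>0_subset unfolding space_P by (intro left_limits) auto
  qed (fact transition_P rates lam_pos)+
qed

lemma path_start_1:
  assumes "\<omega> \<in> space M" "\<omega> \<notin> \<Omega>0"
  shows "\<epsilon> 0 \<omega> = 1"
  using assms measurable_space[OF state_measurable[of 0], of \<omega>] by (auto simp: \<Omega>0_def)

end

theorem theorem3p1:
  fixes M :: "'a measure" and \<epsilon> :: "real \<Rightarrow> 'a \<Rightarrow> nat"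
    and p :: "real \<Rightarrow> nat \<Rightarrow> nat \<Rightarrow> real" and lam \<gamma> :: "nat \<Rightarrow> real"
    and t :: real and n :: nat
  assumes "two_state_Markov M \<epsilon> p lam"
    and "measure M {\<omega> \<in> space M. \<epsilon> 0 \<omega> = 0} > 0"
    and "lam 0 > 0" and "lam 1 > 0"
    and "\<gamma> 0 > 0" and "0 > \<gamma> 1"
    and "t > 0"
  shows "gplus_density M \<epsilon> \<gamma> t (2 * n + 1)
           (\<lambda>x. lam 0 / xi0 \<gamma> t x * (zfun lam \<gamma> t x ^ n / (fact n)\<^sup>2) * theta lam \<gamma> t x
                * (1 / \<gamma> 0 * (x - \<gamma> 1 / (real n + 1) * xi1 \<gamma> t x))
                * indicat_real {0<..<\<gamma> 0 * t} x)
       \<and> gplus_density M \<epsilon> \<gamma> t (2 * n + 2)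
           (\<lambda>x. lam 0 * lam 1 * (zfun lam \<gamma> t x ^ n / (fact n * fact (n + 1))) * theta lam \<gamma> t x
                * (x / \<gamma> 0) * indicat_real {0<..<\<gamma> 0 * t} x)"
proof -
  interpret two_state_Markov M \<epsilon> p lam by fact
  interpret started_in_0 M \<epsilon> p lam
    using assms by unfold_locales auto
  interpret X: switching_from_0 P \<epsilon> p lam by (rule switching_from_0_P)
  interpret X: telegraph_from_0 P \<epsilon> p lam \<gamma>
    using assms by unfold_locales auto
  \<comment> \<open>Transfers a density computed under \<open>P\<close> to the event in
    \<open>M\<close>, for both parities alike.\<close>
  have density: "gplus_density M \<epsilon> \<gamma> t m g"
    if g: "g \<in> borel_measurable borel" "\<And>x. 0 \<le> g x"
      and eq: "\<And>B. B \<in> sets borel \<Longrightarrow> B \<subseteq> {0<..} \<Longrightarrow>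
        emeasure P {\<omega> \<in> space P. X.N t \<omega> = m \<and> stays_nonneg \<gamma> (\<lambda>j. X.T j \<omega>) m \<and> X.position m t \<omega> \<in> B}
          = (\<integral>\<^sup>+x\<in>B. ennreal (g x) \<partial>lborel)"
    for m g
    unfolding gplus_density_def Let_def
  proof (intro conjI ballI impI allI g)
    fix B :: "real set" assume B: "B \<in> sets borel" "B \<subseteq> {0<..}"
    let ?E = "{\<omega> \<in> space M. telegraph \<gamma> \<epsilon> t \<omega> \<in> B \<and> running_min \<gamma> \<epsilon> t \<omega> = 0 \<and> switchings \<epsilon> t \<omega> = m}"
    let ?F = "{\<omega> \<in> space P. X.N t \<omega> = m \<and> stays_nonneg \<gamma> (\<lambda>j. X.T j \<omega>) m \<and> X.position m t \<omega> \<in> B}"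
    \<comment> \<open>Paths outside \<open>\<Omega>0\<close> start in state 1 and have a nonzero
      running minimum, so the event of the theorem consists of paths started in 0.\<close>
    have "\<omega> \<in> ?E \<longleftrightarrow> \<omega> \<in> ?F" for \<omega>
    proof (cases "\<omega> \<in> space P")
      case True
      then have "\<omega> \<in> space M" using \<Omega>0_subset space_P by blast
      then show ?thesis
        using X.event_iff[OF True less_imp_le[OF \<open>t > 0\<close>] B(2), of m] True by blast
    next
      case False
      have "running_min \<gamma> \<epsilon> t \<omega> \<noteq> 0" if "\<omega> \<in> space M"
      proof -
        interpret w: binary_path "\<lambda>u. \<epsilon> u \<omega>" using that by (rule path_M)
        have "\<epsilon> 0 \<omega> = 1" using that False unfolding space_P by (rule path_start_1)
        then show ?thesis
          using w.INF_neq_0_if_start_1[of \<gamma> t] assms unfolding running_min_def telegraph_def by blast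
      qed
      then show ?thesis using False by blast
    qed
    then have EF: "?E = ?F" by blast
    have F: "?F \<in> sets P" using B(1) \<open>t > 0\<close> by (intro X.event_measurable) auto
    show "?E \<in> sets M" unfolding EF using F sets_P by blast
    have "?F \<subseteq> \<Omega>0" using space_P by blast
    then show "emeasure (P_init M \<epsilon> 0) ?E = (\<integral>\<^sup>+x\<in>B. ennreal (g x) \<partial>lborel)"
      unfolding EF eq[OF B, symmetric] by (rule emeasure_P[symmetric])
  qed
  have "gplus_density M \<epsilon> \<gamma> t (2 * n + 1) (X.g_odd t n)"
    using \<open>t > 0\<close> by (intro density X.measurable_g X.g_nonneg X.emeasure_position_odd)
  moreover have "gplus_density M \<epsilon> \<gamma> t (2 * n + 2) (X.g_even t n)"
    using \<open>t > 0\<close> by (intro density X.measurable_g X.g_nonneg X.emeasure_position_even)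
  ultimately show ?thesis
    unfolding X.g_odd_def[abs_def] X.g_even_def[abs_def] ..
qed

end
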